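(* Let $1\le k\ne k'\le n$ and $1\le m\ne m'\le n$ with $k\ne m$, $k\ne m'$ and $k'\ne m$. Put $h(k,k')=\partial_k-\partial_{k'}$, $e(k,k')=x^{\epsilon_k}(\partial_k-2\partial_{k'})$, $h(m,m')=\partial_m-\partial_{m'}$, $e(m,m')=x^{\epsilon_m}(\partial_m-2\partial_{m'})$. The quantization of $U(\mathbf{S}^+_{\mathbb{Z}})$ over $U(\mathbf{S}^+_{\mathbb{Z}})[[t]]$ by the Drinfel'd twist $\mathcal{F}=\mathcal{F}(m,m')\mathcal{F}(k,k')$ has undeformed product and is given, for $x^\alpha\partial\in\mathbf{S}^+_{\mathbb{Z}}$, by $$\Delta(x^\alpha\partial)=x^\alpha\partial\otimes(1-e(k,k')t)^{\alpha_k-\alpha_{k'}}(1-e(m,m')t)^{\alpha_m-\alpha_{m'}}$$ $$\quad+\sum_{r,\ell=0}^\infty(-1)^{r+\ell}h(k,k')^{\langle\ell\rangle}h(m,m')^{\langle r\rangle}\otimes(1-e(k,k')t)^{-\ell}(1-e(m,m')t)^{-r}\,x^{\alpha+\ell\epsilon_k+r\epsilon_m}\,\partial(m,m';k,k')_{\ell,r}\,t^{r+\ell},$$ $$S(x^\alpha\partial)=-(1-e(k,k')t)^{-\alpha_k+\alpha_{k'}}(1-e(m,m')t)^{-\alpha_m+\alpha_{m'}}\sum_{r,\ell=0}^\infty x^{\alpha+\ell\epsilon_k+r\epsilon_m}\,\partial(m,m';k,k')_{\ell,r}\,h(m,m')_1^{\langle r\rangle}h(k,k')_1^{\langle\ell\rangle}t^{r+\ell},$$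 $$\varepsilon(x^\alpha\partial)=0.$$ Here, for a pair $(a,b)$, $A(a,b)_\ell=\frac1{\ell!}\prod_{j=0}^{\ell-1}(\alpha_a-2\alpha_b+j)$, $B(a,b)_\ell=\partial(\epsilon_a)A(a,b)_{\ell-1}$, $A(a,b)_0=1$, $A(a,b)_{-1}=0$, and $$\partial(m,m';k,k')_{\ell,r}=A(m,m')_rA(k,k')_\ell\,\partial-A(m,m')_rB(k,k')_\ell(\partial_k-2\partial_{k'})-A(k,k')_\ell B(m,m')_r(\partial_m-2\partial_{m'}).$$
   Context: Let $D_i=\frac{\partial}{\partial x_i}$, $\partial_i=x_iD_i$, $T=\bigoplus_{i=1}^n\mathbb{Z}\partial_i$, $\epsilon_i$ the standard basis vectors of $\mathbb{Z}^n$, $\partial(\beta)=\sum a_i\beta_i$ for $\partial=\sum a_i\partial_i\in T$, $\beta\in\mathbb{Z}^n$. $\mathbf{W}^+_{\mathbb{Z}}=\bigoplus_i\bigoplus_{\alpha\in\mathbb{Z}_+^n}\mathbb{Z}x^\alpha D_i$, with $x^\alpha D_i$ identified with $x^{\alpha-\epsilon_i}\partial_i$ and $[x^\alpha\partial,x^\beta\partial']=x^{\alpha+\beta}(\partial(\beta)\partial'-\partial'(\alpha)\partial)$. $\mathbf{S}^+_{\mathbb{Z}}=\{\sum a_iD_i\in\mathbf{W}^+_{\mathbb{Z}}\mid\sum D_i(a_i)=0\}$; the elements $x^\alpha\partial$ considered have $\alpha\in\mathbb{Z}^n$, $\partial\in T$. $U(\mathbf{S}^+_{\mathbb{Z}})$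 is the enveloping algebra over $\mathbb{Z}$; tensor products are $t$-adically completed. $\mathcal{F}(a,b)=\sum_{s\ge0}\frac{(-1)^s}{s!}h(a,b)^{[s]}\otimes e(a,b)^st^s$ (defined after extending scalars to $\mathbb{Q}$), with $x^{[s]}=x(x-1)\cdots(x-s+1)$, $x_a^{\langle s\rangle}=(x+a)(x+a+1)\cdots(x+a+s-1)$, $x^{\langle s\rangle}=x_0^{\langle s\rangle}$. Quantization by a twist $\mathcal{F}$: $\Delta(a)=\mathcal{F}\Delta_0(a)\mathcal{F}^{-1}$, $S(a)=wS_0(a)w^{-1}$ with $w=m(\mathrm{Id}\otimes S_0)(\mathcal{F})$, product, unit and counit unchanged, where $\Delta_0,S_0$ are the standard coproduct and antipode; the formulas have integral coefficients and so give a Hopf structure over $\mathbb{Z}[[t]]$. *)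

theory Defs
  imports
    "HOL-Analysis.Analysis"
    "HOL-Library.Poly_Mapping"
    "HOL-Computational_Algebra.Formal_Power_Series"
begin

section \<open>Lie rings\<close>

class lie_ring = ab_group_add +
  fixes lie :: "'a \<Rightarrow> 'a \<Rightarrow> 'a"
  assumes lie_add_left: "lie (x + y) z = lie x z + lie y z"
    and lie_add_right: "lie x (y + z) = lie x y + lie x z"
    and lie_self: "lie x x = 0"
    and lie_jacobi: "lie x (lie y z) + lie y (lie z x) + lie z (lie x y) = 0"


section \<open>Free abelian groups\<close>

definition zmul :: "int \<Rightarrow> 'a::ab_group_add \<Rightarrow> 'a" where
  "zmul n x = (if 0 \<le> n then ((+) x ^^ nat n) 0 else - ((+) x ^^ nat (- n)) 0)"

lemma zmul_0 [simp]: "zmul 0 x = 0"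
  by (simp add: zmul_def)

lemma zmul_1 [simp]: "zmul 1 x = x"
  by (simp add: zmul_def)

lemma zmul_Suc: "zmul (n + 1) x = zmul n x + x"
proof (cases "0 \<le> n")
  case True
  then show ?thesis by (simp add: zmul_def nat_add_distrib add.commute)
next
  case False
  then obtain k where k: "nat (- n) = Suc k" using not0_implies_Suc[of "nat (- n)"] by auto
  then have n: "n = - int k - 1" by linarith
  show ?thesis
  proof (cases k)
    case 0
    then show ?thesis using n by (simp add: zmul_def)
  next
    case (Suc j)
    have "nat (- (n + 1)) = k" using n by simp
    moreover have "\<not> 0 \<le> n + 1" using n Suc by simp
    ultimately show ?thesis using False k by (simp add: zmul_def)
  qed
qed

lemma zmul_pred: "zmul (n - 1) x = zmul n x - x"
  using zmul_Suc[of "n - 1" x] by (simp add: algebra_simps)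

lemma zmul_add: "zmul (m + n) x = zmul m x + zmul n x"
proof (induction n rule: int_induct[where k = 0])
  case (step1 i)
  then show ?case using zmul_Suc[of "m + i" x] zmul_Suc[of i x] by (simp add: add.assoc)
next
  case (step2 i)
  then show ?case using zmul_pred[of "m + i" x] zmul_pred[of i x]
    by (simp only: add_diff_eq)
qed simp

lemma zmul_add_right: "zmul n (x + y) = zmul n x + zmul n y"
  by (induction n rule: int_induct[where k = 0])
    (simp_all add: zmul_Suc zmul_pred algebra_simps)

definition zlift :: "('x \<Rightarrow> 'a::ab_group_add) \<Rightarrow> ('x \<Rightarrow>\<^sub>0 int) \<Rightarrow> 'a" where
  "zlift f p = (\<Sum>x\<in>Poly_Mapping.keys p. zmul (Poly_Mapping.lookup p x) (f x))"

lemma zlift_superset: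
  assumes "finite A" "Poly_Mapping.keys p \<subseteq> A"
  shows "zlift f p = (\<Sum>x\<in>A. zmul (Poly_Mapping.lookup p x) (f x))"
  unfolding zlift_def using assms
  by (intro sum.mono_neutral_left) (auto simp: in_keys_iff)

lemma zlift_0 [simp]: "zlift f 0 = 0"
  by (simp add: zlift_def)

lemma zlift_add: "zlift f (p + q) = zlift f p + zlift f q"
proof -
  let ?A = "Poly_Mapping.keys p \<union> Poly_Mapping.keys q"
  have "zlift f (p + q) = (\<Sum>x\<in>?A. zmul (Poly_Mapping.lookup (p + q) x) (f x))"
    by (rule zlift_superset) (auto simp: Poly_Mapping.keys_add)
  also have "\<dots> = (\<Sum>x\<in>?A. zmul (Poly_Mapping.lookup p x) (f x))
      + (\<Sum>x\<in>?A. zmul (Poly_Mapping.lookup q x) (f x))"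
    by (simp add: lookup_add zmul_add sum.distrib)
  also have "\<dots> = zlift f p + zlift f q"
    by (simp add: zlift_superset[of ?A])
  finally show ?thesis .
qed

lemma zlift_minus: "zlift f (- p) = - zlift f p"
  using zlift_add[of f p "- p"] by (simp add: eq_neg_iff_add_eq_0 add.commute)

lemma zlift_diff: "zlift f (p - q) = zlift f p - zlift f q"
  using zlift_add[of f p "- q"] by (simp add: zlift_minus)

lemma zlift_of [simp]: "zlift f (frag_of x) = f x"
  by (simp add: zlift_def)

lemma free_ab_induct [case_names zero of diff]:
  fixes p :: "'x \<Rightarrow>\<^sub>0 int"
  assumes "P 0" "\<And>x. P (frag_of x)" "\<And>p q. P p \<Longrightarrow> P q \<Longrightarrow> P (p - q)"
  shows "P p"
  by (rule frag_induction[of p UNIV P]) (use assms in auto)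


section \<open>Tensor products over the integers\<close>

inductive_set tensor_rel :: "('a::ab_group_add \<times> 'b::ab_group_add \<Rightarrow>\<^sub>0 int) set" where
  zero: "0 \<in> tensor_rel"
| left: "frag_of (a + a', b) - frag_of (a, b) - frag_of (a', b) \<in> tensor_rel"
| right: "frag_of (a, b + b') - frag_of (a, b) - frag_of (a, b') \<in> tensor_rel"
| diff: "p \<in> tensor_rel \<Longrightarrow> q \<in> tensor_rel \<Longrightarrow> p - q \<in> tensor_rel"

lemma tensor_rel_uminus: "p \<in> tensor_rel \<Longrightarrow> - p \<in> tensor_rel"
  using tensor_rel.diff[OF tensor_rel.zero, of p] by simp

lemma tensor_rel_add: "p \<in> tensor_rel \<Longrightarrow> q \<in> tensor_rel \<Longrightarrow> p + q \<in> tensor_rel"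
  using tensor_rel.diff[OF _ tensor_rel_uminus, of p q] by simp

quotient_type (overloaded) ('a, 'b) tensor =
  "('a::ab_group_add \<times> 'b::ab_group_add) \<Rightarrow>\<^sub>0 int" / "\<lambda>p q. p - q \<in> tensor_rel"
proof (rule equivpI)
  show "reflp (\<lambda>p q :: ('a \<times> 'b) \<Rightarrow>\<^sub>0 int. p - q \<in> tensor_rel)"
    by (auto intro!: reflpI tensor_rel.zero)
  show "symp (\<lambda>p q :: ('a \<times> 'b) \<Rightarrow>\<^sub>0 int. p - q \<in> tensor_rel)"
    by (rule sympI, drule tensor_rel_uminus) simp
  show "transp (\<lambda>p q :: ('a \<times> 'b) \<Rightarrow>\<^sub>0 int. p - q \<in> tensor_rel)"
    by (rule transpI, drule (1) tensor_rel_add) simp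
qed

instantiation tensor :: (ab_group_add, ab_group_add) ab_group_add
begin

lift_definition zero_tensor :: "('a, 'b) tensor" is 0 .

lift_definition plus_tensor :: "('a, 'b) tensor \<Rightarrow> ('a, 'b) tensor \<Rightarrow> ('a, 'b) tensor" is "(+)"
  by (drule (1) tensor_rel_add) (simp add: algebra_simps)

lift_definition uminus_tensor :: "('a, 'b) tensor \<Rightarrow> ('a, 'b) tensor" is uminus
  by (drule tensor_rel_uminus) (simp add: algebra_simps)

lift_definition minus_tensor :: "('a, 'b) tensor \<Rightarrow> ('a, 'b) tensor \<Rightarrow> ('a, 'b) tensor" is "(-)"
  by (drule (1) tensor_rel.diff) (simp add: algebra_simps)

instance
  by standard (transfer; simp add: algebra_simps tensor_rel.zero)+

end

lift_definition pure_tensor :: "'a::ab_group_add \<Rightarrow> 'b::ab_group_add \<Rightarrow> ('a, 'b) tensor" (infix "\<otimes>" 75)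
  is "\<lambda>a b. frag_of (a, b)" .

lemma tensor_add_left: "(a + a') \<otimes> b = a \<otimes> b + a' \<otimes> b"
  by transfer (metis diff_diff_eq tensor_rel.left)

lemma tensor_add_right: "a \<otimes> (b + b') = a \<otimes> b + a \<otimes> b'"
  by transfer (metis diff_diff_eq tensor_rel.right)

lemma tensor_zero_left [simp]: "0 \<otimes> b = 0"
  using tensor_add_left[of 0 0 b] by simp

lemma tensor_zero_right [simp]: "a \<otimes> 0 = 0"
  using tensor_add_right[of a 0 0] by simp

lemma tensor_induct [case_names zero pure diff]:
  assumes "P 0" "\<And>a b. P (a \<otimes> b)" "\<And>x y. P x \<Longrightarrow> P y \<Longrightarrow> P (x - y)"
  shows "P x"
proof -
  have "P (abs_tensor p)" for p
  proof (induction p rule: free_ab_induct)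
    case zero
    show ?case unfolding zero_tensor.abs_eq[symmetric] by (rule assms(1))
  next
    case (of ab)
    show ?case using assms(2)[of "fst ab" "snd ab"] by (simp add: pure_tensor.abs_eq)
  next
    case (diff p q)
    show ?case unfolding minus_tensor.abs_eq[symmetric] by (rule assms(3)[OF diff])
  qed
  from this[of "rep_tensor x"] show ?thesis
    by (simp only: Quotient_abs_rep[OF Quotient_tensor])
qed

definition biadditive :: "('a::ab_group_add \<Rightarrow> 'b::ab_group_add \<Rightarrow> 'c::ab_group_add) \<Rightarrow> bool" where
  "biadditive f \<longleftrightarrow> (\<forall>a a' b. f (a + a') b = f a b + f a' b) \<and> (\<forall>a b b'. f a (b + b') = f a b + f a b')"

lemma biadditiveI:
  assumes "\<And>a a' b. f (a + a') b = f a b + f a' b" "\<And>a b b'. f a (b + b') = f a b + f a b'"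
  shows "biadditive f"
  using assms by (simp add: biadditive_def)

text \<open>
  The homomorphism induced by a biadditive map; for other maps the value depends on the chosen
  representative and is meaningless.
\<close>

definition tensor_lift ::
  "('a::ab_group_add \<Rightarrow> 'b::ab_group_add \<Rightarrow> 'c::ab_group_add) \<Rightarrow> ('a, 'b) tensor \<Rightarrow> 'c" where
  "tensor_lift f x = zlift (\<lambda>(a, b). f a b) (rep_tensor x)"

lemma zlift_tensor_rel:
  assumes "biadditive f" "p \<in> tensor_rel"
  shows "zlift (\<lambda>(a, b). f a b) p = 0"
  using assms(2)
  by induction (use assms(1) in \<open>auto simp: zlift_diff biadditive_def\<close>)

lemma tensor_lift_abs:
  assumes "biadditive f"
  shows "tensor_lift f (abs_tensor p) = zlift (\<lambda>(a, b). f a b) p"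
proof -
  have "rep_tensor (abs_tensor p) - p \<in> tensor_rel"
    using Quotient_rep_abs[OF Quotient_tensor, of p] by (simp add: tensor_rel.zero)
  from zlift_tensor_rel[OF assms this] show ?thesis
    by (simp add: tensor_lift_def zlift_diff)
qed

lemma tensor_lift_pure [simp]: "biadditive f \<Longrightarrow> tensor_lift f (a \<otimes> b) = f a b"
  by (simp add: pure_tensor.abs_eq tensor_lift_abs)

lemma tensor_lift_zero [simp]: "biadditive f \<Longrightarrow> tensor_lift f 0 = 0"
  by (simp add: zero_tensor.abs_eq tensor_lift_abs)

lemma tensor_abs_cases: obtains p where "x = abs_tensor p"
  using Quotient_abs_rep[OF Quotient_tensor, of x, symmetric] by blast

lemma tensor_lift_add [simp]:
  assumes "biadditive f"
  shows "tensor_lift f (x + y) = tensor_lift f x + tensor_lift f y"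
  by (cases x rule: tensor_abs_cases, cases y rule: tensor_abs_cases)
    (simp add: assms plus_tensor.abs_eq tensor_lift_abs zlift_add)

lemma tensor_lift_diff [simp]:
  assumes "biadditive f"
  shows "tensor_lift f (x - y) = tensor_lift f x - tensor_lift f y"
  using tensor_lift_add[OF assms, of "x - y" y] by (simp add: algebra_simps)

lemma tensor_lift_fun_add:
  "tensor_lift (\<lambda>a b. f a b + g a b) x = tensor_lift f x + tensor_lift g x"
  by (simp add: tensor_lift_def zlift_def zmul_add_right sum.distrib split_beta)

definition tensor_map ::
  "('a::ab_group_add \<Rightarrow> 'c::ab_group_add) \<Rightarrow> ('b::ab_group_add \<Rightarrow> 'd::ab_group_add) \<Rightarrow>
   ('a, 'b) tensor \<Rightarrow> ('c, 'd) tensor" where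
  "tensor_map f g = tensor_lift (\<lambda>a b. f a \<otimes> g b)"

definition tensor_assoc ::
  "(('a::ab_group_add, 'b::ab_group_add) tensor, 'c::ab_group_add) tensor \<Rightarrow>
   ('a, ('b, 'c) tensor) tensor" where
  "tensor_assoc = tensor_lift (\<lambda>x c. tensor_lift (\<lambda>a b. a \<otimes> (b \<otimes> c)) x)"

text \<open>
  The tensor product of two nonzero rings may be zero, so it is an instance of
  \<^class>\<open>ring\<close> and \<^class>\<open>monoid_mult\<close> but not of \<^class>\<open>ring_1\<close>.
\<close>

instantiation tensor :: ("{ring, monoid_mult}", "{ring, monoid_mult}") "{ring, monoid_mult}"
begin

definition one_tensor :: "('a, 'b) tensor" where
  "1 = 1 \<otimes> 1"

definition times_tensor :: "('a, 'b) tensor \<Rightarrow> ('a, 'b) tensor \<Rightarrow> ('a, 'b) tensor" where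
  "x * y = tensor_lift (\<lambda>a b. tensor_lift (\<lambda>c d. (a * c) \<otimes> (b * d)) y) x"

lemma times_tensor_biadd1: "biadditive (\<lambda>c d. (a * c) \<otimes> (b * d))" for a :: 'a and b :: 'b
  by (rule biadditiveI) (simp_all add: distrib_left tensor_add_left tensor_add_right)

lemma times_tensor_biadd2:
  "biadditive (\<lambda>a b. tensor_lift (\<lambda>c d. (a * c) \<otimes> (b * d)) y)" for y :: "('a, 'b) tensor"
  by (rule biadditiveI)
    (simp_all add: distrib_right tensor_add_left tensor_add_right tensor_lift_fun_add)

lemma tensor_mult_pure: "(a \<otimes> b) * (c \<otimes> d) = (a * c) \<otimes> (b * d)" for a c :: 'a and b d :: 'b
  unfolding times_tensor_def
  by (subst tensor_lift_pure[OF times_tensor_biadd2]) (rule tensor_lift_pure[OF times_tensor_biadd1])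

lemma tensor_distrib_right: "(x + y) * z = x * z + y * z" for x y z :: "('a, 'b) tensor"
  by (simp add: times_tensor_def times_tensor_biadd2)

lemma tensor_distrib_left: "z * (x + y) = z * x + z * y" for x y z :: "('a, 'b) tensor"
  by (simp add: times_tensor_def times_tensor_biadd1 tensor_lift_fun_add)

lemma tensor_diff_right: "(x - y) * z = x * z - y * z" for x y z :: "('a, 'b) tensor"
  using tensor_distrib_right[of "x - y" y z] by (simp add: algebra_simps)

lemma tensor_diff_left: "z * (x - y) = z * x - z * y" for x y z :: "('a, 'b) tensor"
  using tensor_distrib_left[of z "x - y" y] by (simp add: algebra_simps)

lemma tensor_mult_zero: "0 * x = 0" "x * 0 = 0" for x :: "('a, 'b) tensor"
  using tensor_diff_right[of 0 0 x] tensor_diff_left[of x 0 0] by simp_all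

instance
proof
  fix x y z :: "('a, 'b) tensor"
  show "(x * y) * z = x * (y * z)"
  proof (induction x rule: tensor_induct)
    case (pure a b)
    show ?case
    proof (induction y rule: tensor_induct)
      case (pure c d)
      show ?case
        by (induction z rule: tensor_induct)
          (simp_all add: tensor_mult_pure tensor_mult_zero tensor_diff_left mult.assoc)
    qed (simp_all add: tensor_mult_zero tensor_diff_left tensor_diff_right)
  qed (simp_all add: tensor_mult_zero tensor_diff_left tensor_diff_right)
  show "1 * x = x"
    by (induction x rule: tensor_induct)
      (simp_all add: one_tensor_def tensor_mult_pure tensor_mult_zero tensor_diff_left)
  show "x * 1 = x"
    by (induction x rule: tensor_induct)
      (simp_all add: one_tensor_def tensor_mult_pure tensor_mult_zero tensor_diff_right)
qed (fact tensor_distrib_right tensor_distrib_left)+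

end


section \<open>The universal enveloping ring of a Lie ring\<close>

datatype 'g word = Word (letters: "'g list")

instantiation word :: (type) monoid_add
begin

definition zero_word :: "'a word" where "0 = Word []"

definition plus_word :: "'a word \<Rightarrow> 'a word \<Rightarrow> 'a word" where
  "v + w = Word (letters v @ letters w)"

instance
  by standard (simp_all add: zero_word_def plus_word_def)

end

abbreviation letter :: "'g \<Rightarrow> 'g word \<Rightarrow>\<^sub>0 int" where
  "letter x \<equiv> frag_of (Word [x])"

text \<open>
  Over the integers linearity is additivity, so the enveloping ring is the free ring on the
  elements of the Lie ring (finitely supported functions on words) modulo the following
  two-sided ideal.
\<close>

inductive_set uea_ideal :: "('g::lie_ring word \<Rightarrow>\<^sub>0 int) set" where
  zero: "0 \<in> uea_ideal"
| add: "letter (x + y) - letter x - letter y \<in> uea_ideal"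
| lie: "letter x * letter y - letter y * letter x - letter (lie x y) \<in> uea_ideal"
| diff: "p \<in> uea_ideal \<Longrightarrow> q \<in> uea_ideal \<Longrightarrow> p - q \<in> uea_ideal"
| mult_left: "p \<in> uea_ideal \<Longrightarrow> r * p \<in> uea_ideal"
| mult_right: "p \<in> uea_ideal \<Longrightarrow> p * r \<in> uea_ideal"

lemma uea_ideal_uminus: "p \<in> uea_ideal \<Longrightarrow> - p \<in> uea_ideal"
  using uea_ideal.diff[OF uea_ideal.zero, of p] by simp

lemma uea_ideal_add: "p \<in> uea_ideal \<Longrightarrow> q \<in> uea_ideal \<Longrightarrow> p + q \<in> uea_ideal"
  using uea_ideal.diff[OF _ uea_ideal_uminus, of p q] by simp

definition word_eval :: "('g \<Rightarrow> 'a::{ring, monoid_mult}) \<Rightarrow> ('g word \<Rightarrow>\<^sub>0 int) \<Rightarrow> 'a" where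
  "word_eval f = zlift (\<lambda>w. prod_list (map f (letters w)))"

lemma frag_of_mult: "frag_of v * frag_of w = (frag_of (v + w) :: 'x::monoid_add \<Rightarrow>\<^sub>0 int)"
  by (simp add: mult_single)

lemma word_eval_mult: "word_eval f (p * q) = word_eval f p * word_eval f q"
proof (induction p rule: free_ab_induct)
  case (of v)
  show ?case
    by (induction q rule: free_ab_induct)
      (simp_all add: word_eval_def frag_of_mult plus_word_def zlift_diff right_diff_distrib)
qed (simp_all add: word_eval_def zlift_diff left_diff_distrib)

lemma word_eval_zero: "word_eval f 0 = 0"
  by (simp add: word_eval_def)

lemma word_eval_diff: "word_eval f (p - q) = word_eval f p - word_eval f q"
  by (simp add: word_eval_def zlift_diff)

lemma word_eval_letter: "word_eval f (letter x) = f x"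
  by (simp add: word_eval_def)

lemma word_eval_ideal:
  assumes "\<And>x y. f (x + y) = f x + f y" "\<And>x y. f (lie x y) = f x * f y - f y * f x"
    and "p \<in> uea_ideal"
  shows "word_eval f p = 0"
  using assms(3)
  by induction (simp_all add: word_eval_mult word_eval_diff word_eval_letter word_eval_zero assms(1,2))

quotient_type (overloaded) 'g uea = "'g::lie_ring word \<Rightarrow>\<^sub>0 int" / "\<lambda>p q. p - q \<in> uea_ideal"
proof (rule equivpI)
  show "reflp (\<lambda>p q :: 'g word \<Rightarrow>\<^sub>0 int. p - q \<in> uea_ideal)"
    by (auto intro!: reflpI uea_ideal.zero)
  show "symp (\<lambda>p q :: 'g word \<Rightarrow>\<^sub>0 int. p - q \<in> uea_ideal)"
    by (rule sympI, drule uea_ideal_uminus) simp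
  show "transp (\<lambda>p q :: 'g word \<Rightarrow>\<^sub>0 int. p - q \<in> uea_ideal)"
    by (rule transpI, drule (1) uea_ideal_add) simp
qed

instantiation uea :: (lie_ring) ring_1
begin

lift_definition zero_uea :: "'a uea" is 0 .

lift_definition one_uea :: "'a uea" is 1 .

lift_definition plus_uea :: "'a uea \<Rightarrow> 'a uea \<Rightarrow> 'a uea" is "(+)"
  by (drule (1) uea_ideal_add) (simp add: algebra_simps)

lift_definition uminus_uea :: "'a uea \<Rightarrow> 'a uea" is uminus
  by (drule uea_ideal_uminus) (simp add: algebra_simps)

lift_definition minus_uea :: "'a uea \<Rightarrow> 'a uea \<Rightarrow> 'a uea" is "(-)"
  by (drule (1) uea_ideal.diff) (simp add: algebra_simps)

lift_definition times_uea :: "'a uea \<Rightarrow> 'a uea \<Rightarrow> 'a uea" is "(*)"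
proof -
  fix p p' q q' :: "'a word \<Rightarrow>\<^sub>0 int"
  assume "p - p' \<in> uea_ideal" "q - q' \<in> uea_ideal"
  then have "(p - p') * q + p' * (q - q') \<in> uea_ideal"
    by (intro uea_ideal_add uea_ideal.mult_left uea_ideal.mult_right)
  then show "p * q - p' * q' \<in> uea_ideal" by (simp add: algebra_simps)
qed

instance
proof
  show "(0::'a uea) \<noteq> 1"
  proof
    assume "(0::'a uea) = 1"
    then have "(1 :: 'a word \<Rightarrow>\<^sub>0 int) \<in> uea_ideal"
      by transfer (drule uea_ideal_uminus, simp)
    then have "word_eval (\<lambda>_. 0::int) (1 :: 'a word \<Rightarrow>\<^sub>0 int) = 0"
      by (rule word_eval_ideal[rotated 2]) auto
    moreover have "word_eval (\<lambda>_. 0::int) (1 :: 'a word \<Rightarrow>\<^sub>0 int) = 1"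
      unfolding word_eval_def single_one[symmetric] zlift_of by (simp add: zero_word_def)
    ultimately show False by simp
  qed
qed (transfer; simp add: algebra_simps uea_ideal.zero)+

end

lift_definition uea_of :: "'g::lie_ring \<Rightarrow> 'g uea" is letter .

lemma uea_of_add: "uea_of (x + y) = uea_of x + uea_of y"
  by transfer (metis diff_diff_eq uea_ideal.add)

lemma uea_of_lie: "uea_of (lie x y) = uea_of x * uea_of y - uea_of y * uea_of x"
  by transfer (metis minus_diff_eq uea_ideal.lie uea_ideal_uminus)

text \<open>
  The ring homomorphism induced by a Lie homomorphism; as for \<^const>\<open>tensor_lift\<close>, the value
  is meaningless for other maps.
\<close>

definition uea_lift :: "('g::lie_ring \<Rightarrow> 'a::{ring, monoid_mult}) \<Rightarrow> 'g uea \<Rightarrow> 'a" where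
  "uea_lift f x = word_eval f (rep_uea x)"

lemma uea_abs_cases: obtains p where "x = abs_uea p"
  using Quotient_abs_rep[OF Quotient_uea, of x, symmetric] by blast

lemma uea_lift:
  assumes "\<And>x y. f (x + y) = f x + f y" "\<And>x y. f (lie x y) = f x * f y - f y * f x"
  shows uea_lift_of: "uea_lift f (uea_of x) = f x"
    and uea_lift_one: "uea_lift f 1 = 1"
    and uea_lift_add: "uea_lift f (u + v) = uea_lift f u + uea_lift f v"
    and uea_lift_mult: "uea_lift f (u * v) = uea_lift f u * uea_lift f v"
proof -
  have abs: "uea_lift f (abs_uea p) = word_eval f p" for p
  proof -
    have "rep_uea (abs_uea p) - p \<in> uea_ideal"
      using Quotient_rep_abs[OF Quotient_uea, of p] by (simp add: uea_ideal.zero)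
    from word_eval_ideal[OF assms this] show ?thesis
      by (simp add: uea_lift_def word_eval_def zlift_diff)
  qed
  show "uea_lift f (uea_of x) = f x"
    by (simp add: uea_of.abs_eq abs) (simp add: word_eval_def)
  show "uea_lift f 1 = 1"
    unfolding one_uea.abs_eq abs word_eval_def single_one[symmetric] zlift_of
    by (simp add: zero_word_def)
  show "uea_lift f (u + v) = uea_lift f u + uea_lift f v"
    by (cases u rule: uea_abs_cases, cases v rule: uea_abs_cases)
      (simp add: plus_uea.abs_eq abs, simp add: word_eval_def zlift_add)
  show "uea_lift f (u * v) = uea_lift f u * uea_lift f v"
    by (cases u rule: uea_abs_cases, cases v rule: uea_abs_cases)
      (simp add: times_uea.abs_eq abs word_eval_mult)
qed

datatype 'a op = Op (unop: 'a)

instantiation op :: (ring_1) ring_1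
begin

definition "0 = Op 0"
definition "1 = Op 1"
definition "x + y = Op (unop x + unop y)"
definition "- x = Op (- unop x)"
definition "x - y = Op (unop x - unop y)"
definition "x * y = Op (unop y * unop x)"

instance
  by standard (simp_all add: zero_op_def one_op_def plus_op_def uminus_op_def minus_op_def
      times_op_def algebra_simps op.expand)

end

definition Delta0 :: "'g::lie_ring uea \<Rightarrow> ('g uea, 'g uea) tensor" where
  "Delta0 = uea_lift (\<lambda>x. uea_of x \<otimes> 1 + 1 \<otimes> uea_of x)"

definition S0 :: "'g::lie_ring uea \<Rightarrow> 'g uea" where
  "S0 u = unop (uea_lift (\<lambda>x. Op (- uea_of x)) u)"

definition eps0 :: "'g::lie_ring uea \<Rightarrow> int" where
  "eps0 = uea_lift (\<lambda>_. 0)"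

lemma Delta0_lie_hom:
  fixes x y :: "'g::lie_ring"
  defines "f \<equiv> \<lambda>x::'g. uea_of x \<otimes> 1 + 1 \<otimes> uea_of x"
  shows "f (x + y) = f x + f y" "f (lie x y) = f x * f y - f y * f x"
proof -
  have minus: "(a - a') \<otimes> b = a \<otimes> b - a' \<otimes> b" "b \<otimes> (a - a') = b \<otimes> a - b \<otimes> a'"
    for a a' b :: "'g uea"
    using tensor_add_left[of "a - a'" a' b] tensor_add_right[of b "a - a'" a']
    by (simp_all add: algebra_simps)
  show "f (x + y) = f x + f y"
    by (simp add: f_def uea_of_add tensor_add_left tensor_add_right)
  show "f (lie x y) = f x * f y - f y * f x"
    by (simp add: f_def uea_of_lie minus distrib_left distrib_right tensor_mult_pure)
qed

lemmas Delta0_simps = uea_lift[OF Delta0_lie_hom, folded Delta0_def]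

lemma S0_simps:
  fixes x :: "'g::lie_ring" and u v :: "'g uea"
  shows "S0 (uea_of x) = - uea_of x" "S0 (1 :: 'g uea) = 1" "S0 (u + v) = S0 u + S0 v" "S0 (u * v) = S0 v * S0 u"
proof -
  let ?f = "\<lambda>x. Op (- uea_of x)"
  have f: "?f (x + y) = ?f x + ?f y" "?f (lie x y) = ?f x * ?f y - ?f y * ?f x" for x y :: 'g
    by (simp_all add: plus_op_def times_op_def minus_op_def uea_of_add uea_of_lie)
  show "S0 (uea_of x) = - uea_of x" "S0 (1 :: 'g uea) = 1" "S0 (u + v) = S0 u + S0 v" "S0 (u * v) = S0 v * S0 u"
    by (simp_all add: S0_def uea_lift[where f = ?f, OF f] plus_op_def times_op_def one_op_def)
qed

lemma eps0_simps:
  "eps0 (uea_of x) = 0" "eps0 1 = 1" "eps0 (u + v) = eps0 u + eps0 v" "eps0 (u * v) = eps0 u * eps0 v"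
  by (simp_all add: eps0_def uea_lift)


section \<open>Power series in \<open>t\<close> and completed tensor products\<close>

text \<open>
  \<open>A[[t]]\<close> is \<open>'a fps\<close> with \<open>t\<close> = \<^const>\<open>fps_X\<close>, and the \<open>t\<close>-adic completion of
  \<open>A[[t]] \<otimes> B[[t]]\<close> over \<open>\<int>[[t]]\<close> is \<open>(A \<otimes> B)[[t]]\<close>.
\<close>

definition fps_map :: "('a::zero \<Rightarrow> 'b::zero) \<Rightarrow> 'a fps \<Rightarrow> 'b fps" where
  "fps_map f x = Abs_fps (\<lambda>n. f (fps_nth x n))"

definition ctensor ::
  "'a::ab_group_add fps \<Rightarrow> 'b::ab_group_add fps \<Rightarrow> ('a, 'b) tensor fps" (infix "\<otimes>\<^sub>t" 75) where
  "a \<otimes>\<^sub>t b = Abs_fps (\<lambda>N. \<Sum>i\<le>N. fps_nth a i \<otimes> fps_nth b (N - i))"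

definition zt_scale :: "int fps \<Rightarrow> 'a::ab_group_add fps \<Rightarrow> 'a fps" where
  "zt_scale c x = Abs_fps (\<lambda>N. \<Sum>i\<le>N. zmul (fps_nth c i) (fps_nth x (N - i)))"

text \<open>Such maps are automatically \<open>t\<close>-adically continuous.\<close>

definition zt_linear :: "('a::ab_group_add fps \<Rightarrow> 'b::ab_group_add fps) \<Rightarrow> bool" where
  "zt_linear f \<longleftrightarrow>
     (\<forall>x y. f (x + y) = f x + f y) \<and> (\<forall>c x. f (zt_scale c x) = zt_scale c (f x))"

text \<open>
  The \<open>\<int>[[t]]\<close>-linear map on the completed tensor product induced by a \<open>\<int>[[t]]\<close>-bilinear map
  \<open>\<Phi>\<close>, sending \<open>\<Sum>\<^sub>n x\<^sub>n t\<^sup>n\<close> to \<open>\<Sum>\<^sub>n \<Phi>(x\<^sub>n) t\<^sup>n\<close>.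
\<close>

definition ctensor_lift ::
  "('a::ab_group_add fps \<Rightarrow> 'b::ab_group_add fps \<Rightarrow> 'c::ab_group_add fps) \<Rightarrow>
   ('a, 'b) tensor fps \<Rightarrow> 'c fps" where
  "ctensor_lift \<Phi> x = Abs_fps (\<lambda>N. \<Sum>n\<le>N.
     fps_nth (tensor_lift (\<lambda>a b. \<Phi> (fps_const a) (fps_const b)) (fps_nth x n)) (N - n))"

text \<open>
  Hopf algebra structures over \<open>\<int>[[t]]\<close> on \<open>A[[t]]\<close> whose product and unit are the
  undeformed ones, i.e. those of the ring of power series over \<open>A\<close>.
\<close>

definition zt_hopf_algebra ::
  "('a::ring_1 fps \<Rightarrow> ('a, 'a) tensor fps) \<Rightarrow> ('a fps \<Rightarrow> 'a fps) \<Rightarrow> ('a fps \<Rightarrow> int fps) \<Rightarrow> bool" where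
  "zt_hopf_algebra \<Delta> S \<epsilon> \<longleftrightarrow>
     zt_linear \<Delta> \<and> \<Delta> 1 = 1 \<and> (\<forall>x y. \<Delta> (x * y) = \<Delta> x * \<Delta> y) \<and>
     zt_linear \<epsilon> \<and> \<epsilon> 1 = 1 \<and> (\<forall>x y. \<epsilon> (x * y) = \<epsilon> x * \<epsilon> y) \<and>
     zt_linear S \<and>
     (\<forall>x. ctensor_lift (\<lambda>a b. fps_map tensor_assoc (\<Delta> a \<otimes>\<^sub>t b)) (\<Delta> x)
        = ctensor_lift (\<lambda>a b. a \<otimes>\<^sub>t \<Delta> b) (\<Delta> x)) \<and>
     (\<forall>x. ctensor_lift (\<lambda>a b. zt_scale (\<epsilon> a) b) (\<Delta> x) = x) \<and>
     (\<forall>x. ctensor_lift (\<lambda>a b. zt_scale (\<epsilon> b) a) (\<Delta> x) = x) \<and>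
     (\<forall>x. ctensor_lift (\<lambda>a b. S a * b) (\<Delta> x) = zt_scale (\<epsilon> x) 1) \<and>
     (\<forall>x. ctensor_lift (\<lambda>a b. a * S b) (\<Delta> x) = zt_scale (\<epsilon> x) 1)"


section \<open>Quantization by a twist with rational coefficients\<close>

text \<open>Extension of scalars of an abelian group \<open>A\<close> is the tensor product \<open>\<rat> \<otimes> A\<close>.\<close>

type_synonym 'a ratl = "(rat, 'a) tensor"

definition to_ratl :: "'a::ab_group_add fps \<Rightarrow> 'a ratl fps" where
  "to_ratl = fps_map (\<lambda>x. 1 \<otimes> x)"

definition map_ratl :: "('a::ab_group_add \<Rightarrow> 'b::ab_group_add) \<Rightarrow> 'a ratl fps \<Rightarrow> 'b ratl fps" where
  "map_ratl f = fps_map (tensor_map id f)"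

definition ring_inv :: "'a::{one, times} \<Rightarrow> 'a" where
  "ring_inv u = (THE v. u * v = 1 \<and> v * u = 1)"

text \<open>
  The defining equations are
  \<open>(F \<otimes> 1)(\<Delta>\<^sub>0 \<otimes> Id)(F) = (1 \<otimes> F)(Id \<otimes> \<Delta>\<^sub>0)(F)\<close> and \<open>(\<epsilon>\<^sub>0 \<otimes> Id)(F) = 1 = (Id \<otimes> \<epsilon>\<^sub>0)(F)\<close>.
\<close>

definition drinfeld_twist :: "('g::lie_ring uea, 'g uea) tensor ratl fps \<Rightarrow> bool" where
  "drinfeld_twist F \<longleftrightarrow>
     (\<exists>G. F * G = 1 \<and> G * F = 1) \<and>
     map_ratl (\<lambda>x. tensor_assoc (x \<otimes> 1)) F * map_ratl (\<lambda>x. tensor_assoc (tensor_map Delta0 id x)) F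
       = map_ratl (\<lambda>x. 1 \<otimes> x) F * map_ratl (tensor_map id Delta0) F \<and>
     map_ratl (tensor_lift (\<lambda>a b. of_int (eps0 a) * b)) F = 1 \<and>
     map_ratl (tensor_lift (\<lambda>a b. a * of_int (eps0 b))) F = 1"

definition twist_w :: "('g::lie_ring uea, 'g uea) tensor ratl fps \<Rightarrow> 'g uea ratl fps" where
  "twist_w F = map_ratl (tensor_lift (\<lambda>a b. a * S0 b)) F"

text \<open>
  The twisted structure lives over \<open>\<rat>[[t]]\<close>; a quantization over \<open>\<int>[[t]]\<close> is an integral form
  of it, on \<open>U(g)[[t]]\<close> with its undeformed product.
\<close>

definition quantization ::
  "('g::lie_ring uea, 'g uea) tensor ratl fps \<Rightarrow>
   ('g uea fps \<Rightarrow> ('g uea, 'g uea) tensor fps) \<Rightarrow> ('g uea fps \<Rightarrow> 'g uea fps) \<Rightarrow>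
   ('g uea fps \<Rightarrow> int fps) \<Rightarrow> bool" where
  "quantization F \<Delta> S \<epsilon> \<longleftrightarrow>
     zt_hopf_algebra \<Delta> S \<epsilon> \<and>
     (\<forall>a. to_ratl (\<Delta> a) = F * to_ratl (fps_map Delta0 a) * ring_inv F) \<and>
     (\<forall>a. to_ratl (S a) = twist_w F * to_ratl (fps_map S0 a) * ring_inv (twist_w F)) \<and>
     \<epsilon> = fps_map eps0"


section \<open>The Lie rings \<open>W\<^sup>+\<close> and \<open>S\<^sup>+\<close>\<close>

text \<open>
  The type \<open>'n\<close> indexes the variables. An element \<open>\<Sum> a\<^sub>i \<partial>\<^sub>i\<close> of \<open>T\<close> is the vector of its
  coefficients, and \<^term>\<open>Poly_Mapping.single \<alpha> d\<close> is \<open>x\<^sup>\<alpha> d\<close> for \<open>\<alpha> \<in> \<int>\<^sup>n\<close>, \<open>d \<in> T\<close>.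
\<close>

type_synonym 'n vfield = "(int ^ 'n) \<Rightarrow>\<^sub>0 (int ^ 'n)"

definition tpair :: "int ^ 'n \<Rightarrow> int ^ 'n \<Rightarrow> int" where
  "tpair d \<beta> = (\<Sum>i\<in>UNIV. d $ i * \<beta> $ i)"

definition vbracket1 :: "int ^ 'n::finite \<Rightarrow> int ^ 'n \<Rightarrow> int ^ 'n \<Rightarrow> int ^ 'n \<Rightarrow> 'n vfield" where
  "vbracket1 \<alpha> d \<beta> d' = Poly_Mapping.single (\<alpha> + \<beta>) (tpair d \<beta> *s d' - tpair d' \<alpha> *s d)"

definition vbracket :: "'n::finite vfield \<Rightarrow> 'n vfield \<Rightarrow> 'n vfield" where
  "vbracket u v = (\<Sum>\<alpha>\<in>Poly_Mapping.keys u. \<Sum>\<beta>\<in>Poly_Mapping.keys v.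
     vbracket1 \<alpha> (Poly_Mapping.lookup u \<alpha>) \<beta> (Poly_Mapping.lookup v \<beta>))"

text \<open>
  \<open>W\<^sup>+\<close> is spanned by the \<open>x\<^sup>\<beta> D\<^sub>i = x\<^sup>\<beta>\<^sup>-\<^sup>\<epsilon>\<^sup>i \<partial>\<^sub>i\<close> with \<open>\<beta> \<ge> 0\<close>; an exponent \<open>\<alpha>\<close> of
  \<open>x\<^sup>\<alpha> \<partial>\<^sub>i\<close> may thus have \<open>i\<close>-th coordinate \<open>-1\<close>.
\<close>

definition Wplus :: "'n::finite vfield set" where
  "Wplus = {w. \<forall>\<alpha> i. Poly_Mapping.lookup w \<alpha> $ i \<noteq> 0 \<longrightarrow> (\<forall>j. 0 \<le> (\<alpha> + axis i 1) $ j)}"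

text \<open>The coefficient \<open>a\<^sub>i\<close> in \<open>w = \<Sum> a\<^sub>i D\<^sub>i\<close>, and the partial derivative \<open>D\<^sub>i\<close>.\<close>

definition vcoeff :: "'n::finite \<Rightarrow> 'n vfield \<Rightarrow> (int ^ 'n \<Rightarrow>\<^sub>0 int)" where
  "vcoeff i w =
     (\<Sum>\<alpha>\<in>Poly_Mapping.keys w. Poly_Mapping.single (\<alpha> + axis i 1) (Poly_Mapping.lookup w \<alpha> $ i))"

definition partial_deriv :: "'n::finite \<Rightarrow> (int ^ 'n \<Rightarrow>\<^sub>0 int) \<Rightarrow> (int ^ 'n \<Rightarrow>\<^sub>0 int)" where
  "partial_deriv i p =
     (\<Sum>\<beta>\<in>Poly_Mapping.keys p. Poly_Mapping.single (\<beta> - axis i 1) (\<beta> $ i * Poly_Mapping.lookup p \<beta>))"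

definition divergence :: "'n::finite vfield \<Rightarrow> (int ^ 'n \<Rightarrow>\<^sub>0 int)" where
  "divergence w = (\<Sum>i\<in>UNIV. partial_deriv i (vcoeff i w))"

definition Splus :: "'n::finite vfield set" where
  "Splus = {w \<in> Wplus. divergence w = 0}"


lemma lookup_vcoeff: "Poly_Mapping.lookup (vcoeff i w) \<beta> = Poly_Mapping.lookup w (\<beta> - axis i 1) $ i"
proof -
  have "Poly_Mapping.lookup (vcoeff i w) \<beta>
    = (\<Sum>\<alpha>\<in>Poly_Mapping.keys w. if \<alpha> = \<beta> - axis i 1 then Poly_Mapping.lookup w \<alpha> $ i else 0)"
    unfolding vcoeff_def lookup_sum lookup_single when_def
    by (rule sum.cong) (auto simp: algebra_simps)
  then show ?thesis by (simp add: in_keys_iff)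
qed

lemma lookup_partial_deriv:
  "Poly_Mapping.lookup (partial_deriv i p) \<gamma> = (\<gamma> $ i + 1) * Poly_Mapping.lookup p (\<gamma> + axis i 1)"
proof -
  have "Poly_Mapping.lookup (partial_deriv i p) \<gamma>
    = (\<Sum>\<beta>\<in>Poly_Mapping.keys p. if \<beta> = \<gamma> + axis i 1 then \<beta> $ i * Poly_Mapping.lookup p \<beta> else 0)"
    unfolding partial_deriv_def lookup_sum lookup_single when_def
    by (rule sum.cong) (auto simp: algebra_simps)
  then show ?thesis by (simp add: in_keys_iff axis_def)
qed

lemma lookup_divergence:
  "Poly_Mapping.lookup (divergence w) \<gamma> = tpair (Poly_Mapping.lookup w \<gamma>) (\<gamma> + 1)"
  by (simp add: divergence_def lookup_sum lookup_partial_deriv lookup_vcoeff tpair_def mult.commute)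

lemma Splus_iff:
  "w \<in> Splus \<longleftrightarrow> w \<in> Wplus \<and> (\<forall>\<gamma>. tpair (Poly_Mapping.lookup w \<gamma>) (\<gamma> + 1) = 0)"
  by (simp add: Splus_def poly_mapping_eq_iff fun_eq_iff lookup_divergence)

lemma tpair_linear:
  "tpair (d + d') \<beta> = tpair d \<beta> + tpair d' \<beta>" "tpair (d - d') \<beta> = tpair d \<beta> - tpair d' \<beta>"
  "tpair (c *s d) \<beta> = c * tpair d \<beta>" "tpair (- d) \<beta> = - tpair d \<beta>" "tpair 0 \<beta> = 0"
  "tpair d (\<beta> + \<beta>') = tpair d \<beta> + tpair d \<beta>'"
  by (simp_all add: tpair_def sum.distrib sum_subtractf sum_negf sum_distrib_left algebra_simps)

lemma Splus_0: "0 \<in> Splus"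
  by (simp add: Splus_iff Wplus_def tpair_linear)

lemma Wplus_add: "u \<in> Wplus \<Longrightarrow> v \<in> Wplus \<Longrightarrow> u + v \<in> Wplus"
  unfolding Wplus_def mem_Collect_eq lookup_add vector_add_component[of "Poly_Mapping.lookup u _"]
  by (metis add_0)

lemma Splus_add: "u \<in> Splus \<Longrightarrow> v \<in> Splus \<Longrightarrow> u + v \<in> Splus"
  by (simp add: Splus_iff Wplus_add lookup_add tpair_linear(1))

lemma Splus_uminus: "u \<in> Splus \<Longrightarrow> - u \<in> Splus"
  by (simp add: Splus_iff Wplus_def tpair_linear(4))

lemma Splus_sum: "(\<And>x. x \<in> A \<Longrightarrow> f x \<in> Splus) \<Longrightarrow> sum f A \<in> Splus"
  by (induction A rule: infinite_finite_induct) (auto intro: Splus_0 Splus_add)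

lemma Splus_component: "w \<in> Splus \<Longrightarrow> Poly_Mapping.single \<alpha> (Poly_Mapping.lookup w \<alpha>) \<in> Splus"
  by (auto simp: Splus_iff Wplus_def lookup_single when_def tpair_linear(5))

lemma single_Splus:
  "Poly_Mapping.single \<alpha> d \<in> Splus \<longleftrightarrow>
     (\<forall>i j. d $ i \<noteq> 0 \<longrightarrow> 0 \<le> (\<alpha> + axis i 1) $ j) \<and> tpair d (\<alpha> + 1) = 0"
  by (auto simp: Splus_iff Wplus_def lookup_single when_def tpair_linear(5))

lemma vbracket1_0 [simp]: "vbracket1 \<alpha> 0 \<beta> d = 0" "vbracket1 \<alpha> d \<beta> 0 = 0"
  by (simp_all add: vbracket1_def tpair_linear)

lemma vbracket1_add:
  "vbracket1 \<alpha> (d + d') \<beta> e = vbracket1 \<alpha> d \<beta> e + vbracket1 \<alpha> d' \<beta> e"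
  "vbracket1 \<alpha> d \<beta> (e + e') = vbracket1 \<alpha> d \<beta> e + vbracket1 \<alpha> d \<beta> e'"
  by (simp_all add: vbracket1_def tpair_linear single_add[symmetric] vec_eq_iff algebra_simps)

lemma vbracket_superset:
  assumes "finite A" "Poly_Mapping.keys u \<subseteq> A" "finite B" "Poly_Mapping.keys v \<subseteq> B"
  shows "vbracket u v = (\<Sum>\<alpha>\<in>A. \<Sum>\<beta>\<in>B.
    vbracket1 \<alpha> (Poly_Mapping.lookup u \<alpha>) \<beta> (Poly_Mapping.lookup v \<beta>))"
proof -
  have "vbracket u v = (\<Sum>\<alpha>\<in>Poly_Mapping.keys u. \<Sum>\<beta>\<in>B.
      vbracket1 \<alpha> (Poly_Mapping.lookup u \<alpha>) \<beta> (Poly_Mapping.lookup v \<beta>))"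
    unfolding vbracket_def using assms
    by (intro sum.cong refl sum.mono_neutral_left) (auto simp: in_keys_iff)
  also have "\<dots> = (\<Sum>\<alpha>\<in>A. \<Sum>\<beta>\<in>B.
      vbracket1 \<alpha> (Poly_Mapping.lookup u \<alpha>) \<beta> (Poly_Mapping.lookup v \<beta>))"
    using assms by (intro sum.mono_neutral_left) (auto simp: in_keys_iff)
  finally show ?thesis .
qed

lemma vbracket_add:
  "vbracket (u + u') v = vbracket u v + vbracket u' v"
  "vbracket v (u + u') = vbracket v u + vbracket v u'"
proof -
  let ?A = "Poly_Mapping.keys u \<union> Poly_Mapping.keys u'"
  let ?B = "Poly_Mapping.keys v"
  have *: "finite ?A" "finite ?B" "Poly_Mapping.keys u \<subseteq> ?A" "Poly_Mapping.keys u' \<subseteq> ?A"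
    "Poly_Mapping.keys (u + u') \<subseteq> ?A" "?B \<subseteq> ?B"
    by (auto simp: Poly_Mapping.keys_add)
  show "vbracket (u + u') v = vbracket u v + vbracket u' v"
    by (simp add: vbracket_superset[OF *(1,5,2,6)] vbracket_superset[OF *(1,3,2,6)]
        vbracket_superset[OF *(1,4,2,6)] lookup_add vbracket1_add sum.distrib)
  show "vbracket v (u + u') = vbracket v u + vbracket v u'"
    by (simp add: vbracket_superset[OF *(2,6,1,5)] vbracket_superset[OF *(2,6,1,3)]
        vbracket_superset[OF *(2,6,1,4)] lookup_add vbracket1_add sum.distrib)
qed

lemma vbracket_0 [simp]: "vbracket 0 v = 0" "vbracket v 0 = 0"
  by (simp_all add: vbracket_def)

lemma vbracket_single:
  "vbracket (Poly_Mapping.single \<alpha> d) (Poly_Mapping.single \<beta> d')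
     = Poly_Mapping.single (\<alpha> + \<beta>) (tpair d \<beta> *s d' - tpair d' \<alpha> *s d)"
  by (simp add: vbracket_superset[of "{\<alpha>}" _ "{\<beta>}"] flip: vbracket1_def)

lemma vfield_induct [case_names zero single add]:
  fixes w :: "'n::finite vfield"
  assumes "P 0" "\<And>\<alpha> d. P (Poly_Mapping.single \<alpha> d)" "\<And>u v. P u \<Longrightarrow> P v \<Longrightarrow> P (u + v)"
  shows "P w"
proof -
  have "P (\<Sum>\<alpha>\<in>A. Poly_Mapping.single \<alpha> (Poly_Mapping.lookup w \<alpha>))" for A
    by (induction A rule: infinite_finite_induct) (auto intro: assms)
  moreover have "(\<Sum>\<alpha>\<in>Poly_Mapping.keys w. Poly_Mapping.single \<alpha> (Poly_Mapping.lookup w \<alpha>)) = w"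
    by (rule poly_mapping_eqI) (simp add: lookup_sum lookup_single when_def in_keys_iff)
  ultimately show ?thesis by metis
qed

lemma vbracket_anti: "vbracket u v = - vbracket v u"
proof (induction u rule: vfield_induct)
  case (single \<alpha> d)
  show ?case
    by (induction v rule: vfield_induct)
      (simp_all add: vbracket_single vbracket_add add.commute single_uminus[symmetric])
qed (simp_all add: vbracket_add)

lemma vbracket_self: "vbracket u u = 0"
proof (induction u rule: vfield_induct)
  case (add u v)
  then show ?case using vbracket_anti[of u v] by (simp add: vbracket_add)
qed (simp_all add: vbracket_single)

lemma vbracket_jacobi:
  "vbracket u (vbracket v w) + vbracket v (vbracket w u) + vbracket w (vbracket u v) = 0"
proof (induction u rule: vfield_induct)
  case (single \<alpha> d)
  show ?case
  proof (induction v rule: vfield_induct)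
    case (single \<beta> d')
    show ?case
    proof (induction w rule: vfield_induct)
      case (single \<gamma> d'')
      have exps: "\<beta> + (\<gamma> + \<alpha>) = \<alpha> + (\<beta> + \<gamma>)" "\<gamma> + (\<alpha> + \<beta>) = \<alpha> + (\<beta> + \<gamma>)"
        by (simp_all add: ac_simps)
      show ?case
        unfolding vbracket_single exps single_add[symmetric]
        by (simp add: tpair_linear vec_eq_iff algebra_simps)
    next
      case (add u v)
      from arg_cong2[OF add, of "(+)"] show ?case by (simp add: vbracket_add ac_simps)
    qed simp
  next
    case (add u v)
    from arg_cong2[OF add, of "(+)"] show ?case by (simp add: vbracket_add ac_simps)
  qed simp
next
  case (add u v)
  from arg_cong2[OF add, of "(+)"] show ?case by (simp add: vbracket_add ac_simps)
qed simp

lemma vbracket_single_Splus: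
  assumes "Poly_Mapping.single \<alpha> d \<in> Splus" "Poly_Mapping.single \<beta> d' \<in> Splus"
  shows "Poly_Mapping.single (\<alpha> + \<beta>) (tpair d \<beta> *s d' - tpair d' \<alpha> *s d) \<in> Splus"
  unfolding single_Splus
proof (intro conjI allI impI)
  have d: "0 \<le> \<alpha> $ j + (if i = j then 1 else 0)" if "d $ i \<noteq> 0" for i j
  proof -
    have "0 \<le> (\<alpha> + axis i 1) $ j"
      using assms(1) that unfolding single_Splus by blast
    then show ?thesis by (cases "i = j") (auto simp: axis_def)
  qed
  have d': "0 \<le> \<beta> $ j + (if i = j then 1 else 0)" if "d' $ i \<noteq> 0" for i j
  proof -
    have "0 \<le> (\<beta> + axis i 1) $ j"
      using assms(2) that unfolding single_Splus by blast
    then show ?thesis by (cases "i = j") (auto simp: axis_def)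
  qed
  have tpair_one: "tpair f \<gamma> = f $ j * \<gamma> $ j" if "\<And>l. l \<noteq> j \<Longrightarrow> f $ l = 0"
    for f \<gamma> :: "int ^ 'a" and j
    unfolding tpair_def by (subst sum.remove[of _ j]) (auto simp: that intro!: sum.neutral)
  fix i j
  assume c: "(tpair d \<beta> *s d' - tpair d' \<alpha> *s d) $ i \<noteq> 0"
  then have "d \<noteq> 0" "d' \<noteq> 0" by (auto simp: tpair_linear)
  then obtain p p' where p: "d $ p \<noteq> 0" "d' $ p' \<noteq> 0" by (auto simp: vec_eq_iff)
  have ge: "\<alpha> $ j \<ge> -1" "\<beta> $ j \<ge> -1"
    using d[OF p(1), of j] d'[OF p(2), of j] by (auto split: if_splits)
  have supp: "d $ l = 0" if "\<alpha> $ j = -1" "l \<noteq> j" for l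
    using d[of l j] that by auto
  have supp': "d' $ l = 0" if "\<beta> $ j = -1" "l \<noteq> j" for l
    using d'[of l j] that by auto
  have "0 \<le> \<alpha> $ j + \<beta> $ j + (if i = j then 1 else 0)"
  proof (rule ccontr)
    assume neg: "\<not> ?thesis"
    consider "\<alpha> $ j = -1" "\<beta> $ j = -1" | "\<alpha> $ j = -1" "\<beta> $ j = 0" "i \<noteq> j"
      | "\<alpha> $ j = 0" "\<beta> $ j = -1" "i \<noteq> j"
      using neg ge by (auto split: if_splits) linarith+
    then show False
    proof cases
      case 1
      have "tpair d \<beta> = - d $ j" "tpair d' \<alpha> = - d' $ j"
        using tpair_one[of j d \<beta>] tpair_one[of j d' \<alpha>] supp supp' 1 by auto
      then show False using c supp[of i] supp'[of i] 1 by (cases "i = j") auto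
    next
      case 2
      have "tpair d \<beta> = 0" using tpair_one[of j d \<beta>] supp 2 by auto
      then show False using c supp[of i] 2 by auto
    next
      case 3
      have "tpair d' \<alpha> = 0" using tpair_one[of j d' \<alpha>] supp' 3 by auto
      then show False using c supp'[of i] 3 by auto
    qed
  qed
  then show "0 \<le> (\<alpha> + \<beta> + axis i 1) $ j" by (auto simp: axis_def)
next
  have "tpair d (\<alpha> + 1) = 0" "tpair d' (\<beta> + 1) = 0"
    using assms by (simp_all add: single_Splus)
  then have "tpair d (\<alpha> + \<beta> + 1) = tpair d \<beta>" "tpair d' (\<alpha> + \<beta> + 1) = tpair d' \<alpha>"
    by (simp_all add: tpair_linear(6))
  then show "tpair (tpair d \<beta> *s d' - tpair d' \<alpha> *s d) (\<alpha> + \<beta> + 1) = 0"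
    by (simp add: tpair_linear(2,3))
qed

lemma vbracket_Splus:
  assumes "u \<in> Splus" "v \<in> Splus"
  shows "vbracket u v \<in> Splus"
  unfolding vbracket_def vbracket1_def
  by (intro Splus_sum vbracket_single_Splus Splus_component assms)

typedef (overloaded) 'n splus = "Splus :: 'n::finite vfield set"
  using Splus_0 by blast

setup_lifting type_definition_splus

instantiation splus :: (finite) lie_ring
begin

lift_definition zero_splus :: "'a splus" is 0
  by (rule Splus_0)

lift_definition plus_splus :: "'a splus \<Rightarrow> 'a splus \<Rightarrow> 'a splus" is "(+)"
  by (rule Splus_add)

lift_definition uminus_splus :: "'a splus \<Rightarrow> 'a splus" is uminus
  by (rule Splus_uminus)

lift_definition minus_splus :: "'a splus \<Rightarrow> 'a splus \<Rightarrow> 'a splus" is "(-)"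
  by (metis Splus_add Splus_uminus diff_conv_add_uminus)

lift_definition lie_splus :: "'a splus \<Rightarrow> 'a splus \<Rightarrow> 'a splus" is vbracket
  by (rule vbracket_Splus)

instance
proof
  fix x y z :: "'a splus"
  show "x + y + z = x + (y + z)" by transfer (rule add.assoc)
  show "x + y = y + x" by transfer (rule add.commute)
  show "0 + x = x" by transfer simp
  show "- x + x = 0" by transfer simp
  show "x - y = x + - y" by transfer simp
  show "lie (x + y) z = lie x z + lie y z" by transfer (rule vbracket_add)
  show "lie x (y + z) = lie x y + lie x z" by transfer (rule vbracket_add)
  show "lie x x = 0" by transfer (rule vbracket_self)
  show "lie x (lie y z) + lie y (lie z x) + lie z (lie x y) = 0"
    by transfer (rule vbracket_jacobi)
qed

end


section \<open>The ingredients of the formulas\<close>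

definition falling :: "'a::ring_1 \<Rightarrow> nat \<Rightarrow> 'a" where
  "falling x s = prod_list (map (\<lambda>j. x - of_nat j) [0..<s])"

definition rising :: "int \<Rightarrow> 'a::ring_1 \<Rightarrow> nat \<Rightarrow> 'a" where
  "rising a x s = prod_list (map (\<lambda>j. x + of_int a + of_nat j) [0..<s])"

definition zpow :: "'a::monoid_mult \<Rightarrow> int \<Rightarrow> 'a" where
  "zpow u z = (if 0 \<le> z then u ^ nat z else ring_inv u ^ nat (- z))"

text \<open>
  The image in the enveloping ring of the element \<open>x\<^sup>\<alpha> d\<close> of \<open>S\<^sup>+\<close>, meaningful only if
  \<^term>\<open>Poly_Mapping.single \<alpha> d \<in> Splus\<close>.
\<close>

definition xd :: "int ^ 'n \<Rightarrow> int ^ 'n \<Rightarrow> 'n::finite splus uea" where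
  "xd \<alpha> d = uea_of (Abs_splus (Poly_Mapping.single \<alpha> d))"

definition hT :: "'n::finite \<Rightarrow> 'n \<Rightarrow> int ^ 'n" where
  "hT a b = axis a 1 - axis b 1"

definition eT :: "'n::finite \<Rightarrow> 'n \<Rightarrow> int ^ 'n" where
  "eT a b = axis a 1 - 2 *s axis b 1"

definition hU :: "'n::finite \<Rightarrow> 'n \<Rightarrow> 'n splus uea" where
  "hU a b = xd 0 (hT a b)"

definition eU :: "'n::finite \<Rightarrow> 'n \<Rightarrow> 'n splus uea" where
  "eU a b = xd (axis a 1) (eT a b)"

lemma tpair_axis: "tpair (axis a 1) \<beta> = \<beta> $ a"
proof -
  have "tpair (axis a 1) \<beta> = (\<Sum>i\<in>UNIV. if i = a then \<beta> $ i else 0)"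
    unfolding tpair_def axis_def by (rule sum.cong) auto
  then show ?thesis by simp
qed

lemma single_h_Splus: "a \<noteq> b \<Longrightarrow> Poly_Mapping.single 0 (hT a b) \<in> Splus"
  unfolding single_Splus hT_def by (simp add: tpair_linear(2) tpair_axis, auto simp: axis_def)

lemma single_e_Splus: "a \<noteq> b \<Longrightarrow> Poly_Mapping.single (axis a 1) (eT a b) \<in> Splus"
  unfolding single_Splus eT_def by (simp add: tpair_linear(2,3) tpair_axis, auto simp: axis_def)

definition twistF :: "'n::finite \<Rightarrow> 'n \<Rightarrow> ('n splus uea, 'n splus uea) tensor ratl fps" where
  "twistF a b = Abs_fps (\<lambda>s. ((-1) ^ s / fact s) \<otimes> (falling (hU a b) s \<otimes> eU a b ^ s))"

text \<open>The division in \<open>coefA\<close> is exact.\<close>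

definition coefA :: "int ^ 'n \<Rightarrow> 'n \<Rightarrow> 'n \<Rightarrow> int \<Rightarrow> int" where
  "coefA \<alpha> a b l =
     (if l < 0 then 0 else (\<Prod>j<nat l. \<alpha> $ a - 2 * \<alpha> $ b + int j) div fact (nat l))"

lemma coefA_exact:
  "0 \<le> l \<Longrightarrow> fact (nat l) * coefA \<alpha> a b l = (\<Prod>j<nat l. \<alpha> $ a - 2 * \<alpha> $ b + int j)"
  using fact_dvd_pochhammer[of "nat l" "\<alpha> $ a - 2 * \<alpha> $ b"]
  by (simp add: coefA_def pochhammer_prod atLeast0LessThan)

definition coefB :: "int ^ 'n \<Rightarrow> int ^ 'n \<Rightarrow> 'n::finite \<Rightarrow> 'n \<Rightarrow> int \<Rightarrow> int" where
  "coefB \<alpha> d a b l = tpair d (axis a 1) * coefA \<alpha> a b (l - 1)"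

text \<open>\<open>dlr\<close> is \<open>\<partial>(m, m'; k, k')\<close> with lower indices \<open>l\<close>, \<open>r\<close>, formed from \<open>\<partial> = d\<close>.\<close>

definition dlr ::
  "int ^ 'n \<Rightarrow> int ^ 'n \<Rightarrow> 'n::finite \<Rightarrow> 'n \<Rightarrow> 'n \<Rightarrow> 'n \<Rightarrow> nat \<Rightarrow> nat \<Rightarrow> int ^ 'n" where
  "dlr \<alpha> d m m' k k' l r =
     (coefA \<alpha> m m' (int r) * coefA \<alpha> k k' (int l)) *s d
     - (coefA \<alpha> m m' (int r) * coefB \<alpha> d k k' (int l)) *s eT k k'
     - (coefA \<alpha> k k' (int l) * coefB \<alpha> d m m' (int r)) *s eT m m'"

definition shift :: "int ^ 'n \<Rightarrow> 'n::finite \<Rightarrow> 'n \<Rightarrow> nat \<Rightarrow> nat \<Rightarrow> int ^ 'n" where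
  "shift \<alpha> m k l r = \<alpha> + int l *s axis k 1 + int r *s axis m 1"

end

theory Submission
  imports Defs
begin

text \<open>
  Write \<open>h = h(k, k')\<close>, \<open>e = e(k, k')\<close>, \<open>g = h(m, m')\<close>, \<open>f = e(m, m')\<close>. Then \<open>[h, e] = e\<close>, and
  \<open>F(k, k') = (1 - 1 \<otimes> e t)\<^bsup>h \<otimes> 1\<^esup>\<close>
  as a binomial series. The two pairs \<open>(h, e)\<close> and \<open>(g, f)\<close> commute, so the cocycle identity for
  the product reduces to the one for each factor, which is the Vandermonde identity. If
  \<open>[h, X] = c X\<close>, conjugation by \<open>F(k, k')\<close> takes \<open>X \<otimes> 1\<close> to \<open>X \<otimes> (1 - e t)\<^sup>c\<close>, and moving powers of \<open>e\<close>
  past \<open>X\<close> expresses the conjugate of \<open>1 \<otimes> X\<close> through the divided powers \<open>(ad e)\<^sup>l X / l!\<close>. On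
  \<open>S\<^sup>+\<close> these divided powers are integral; this is what produces the coefficients \<open>A\<close> and \<open>B\<close>. The
  antipode is treated in the same way, the element \<open>w\<close> of \<open>F(k, k')\<close> being \<open>exp (h e t)\<close>.

  Thus the rational twisted structure maps preserve the integral power series on generators, hence
  everywhere. Integral forms exist and are unique because \<open>U\<close>, \<open>U \<otimes> U\<close> and \<open>U \<otimes> U \<otimes> U\<close> embed into
  their rationalizations: by Poincare-Birkhoff-Witt over the integers \<open>U\<close> is an additive retract
  of a free abelian group, and retracts are stable under tensor products.
\<close>

section \<open>Additive maps\<close>

text \<open>The denominators of the twist are the obstacle: the twisted maps exist only over the
  rationals, and \<open>1 \<otimes> a\<close> determines \<open>a\<close> only in a torsion-free
  group, so torsion must be excluded in three tensor powers of U. Being a retract of a free group is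
  easier to obtain than a basis: it needs a map back from formal monomials but not their
  independence in U, and it passes to tensor products by tensoring both maps. Hopf axioms and
  explicit formulas are kept apart. The axioms are proved for any invertible counital cocycle that
  keeps generators integral; the formulas serve to verify that integrality and are read off at the
  end. Dividing by factorials in U is avoided: a sequence with [e, X_l] = (l + 1) X_(l+1) plays the
  role of the divided powers. In S^+ the bracket with e(k, k') adds the k-th unit vector to the
  exponent and at step l multiplies by alpha_k - 2 alpha_k' + l, since e(k, k') pairs to 1 with that
  vector. The product of these factors over l! is the binomial coefficient A; the second term of the
  bracket feeds B.\<close>

lemma additive_zmul: "Modules.additive f \<Longrightarrow> f (zmul n x) = zmul n (f x)"
  by (induction n rule: int_induct[where k = 0])
    (simp_all add: zmul_Suc zmul_pred additive.add additive.diff additive.zero)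

lemma additive_comp: "Modules.additive f \<Longrightarrow> Modules.additive g \<Longrightarrow> Modules.additive (\<lambda>x. f (g x))"
  by (simp add: Modules.additive_def)

lemma zlift_cong: "(\<And>x. x \<in> Poly_Mapping.keys p \<Longrightarrow> f x = g x) \<Longrightarrow> zlift f p = zlift g p"
  by (simp add: zlift_def)

lemma zmul_int [simp]: "zmul n (m :: int) = n * m"
  by (induction n rule: int_induct[where k = 0]) (simp_all add: zmul_Suc zmul_pred algebra_simps)

text \<open>Target ring for representations of the enveloping ring. On the trivial group 0 = 1,
  hence the classes \<open>ring\<close> and \<open>monoid_mult\<close> and not
  \<open>ring_1\<close>.\<close>

typedef (overloaded) 'a aend = "{f :: 'a::ab_group_add \<Rightarrow> 'a. Modules.additive f}"
  by (rule exI[of _ "\<lambda>x. x"]) (simp add: Modules.additive_def)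

setup_lifting type_definition_aend

instantiation aend :: (ab_group_add) "{ring, monoid_mult}"
begin

lift_definition zero_aend :: "'a aend" is "\<lambda>x. 0"
  by (simp add: Modules.additive_def)

lift_definition one_aend :: "'a aend" is "\<lambda>x. x"
  by (simp add: Modules.additive_def)

lift_definition plus_aend :: "'a aend \<Rightarrow> 'a aend \<Rightarrow> 'a aend" is "\<lambda>f g x. f x + g x"
  by (simp add: Modules.additive_def ac_simps)

lift_definition minus_aend :: "'a aend \<Rightarrow> 'a aend \<Rightarrow> 'a aend" is "\<lambda>f g x. f x - g x"
  by (simp add: Modules.additive_def algebra_simps)

lift_definition uminus_aend :: "'a aend \<Rightarrow> 'a aend" is "\<lambda>f x. - f x"
  by (simp add: Modules.additive_def)

lift_definition times_aend :: "'a aend \<Rightarrow> 'a aend \<Rightarrow> 'a aend" is "\<lambda>f g x. f (g x)"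
  by (rule additive_comp)

instance
  by standard (transfer; auto simp: Modules.additive_def fun_eq_iff algebra_simps)+

end

lemma uea_induct [case_names of zero one diff mult]:
  fixes u :: "'g::lie_ring uea"
  assumes "\<And>x. P (uea_of x)" "P 0" "P 1" "\<And>u v. P u \<Longrightarrow> P v \<Longrightarrow> P (u - v)"
    "\<And>u v. P u \<Longrightarrow> P v \<Longrightarrow> P (u * v)"
  shows "P u"
proof -
  have word: "P (abs_uea (frag_of (Word xs)))" for xs
  proof (induction xs)
    case Nil
    have "frag_of (Word []) = (1 :: 'g word \<Rightarrow>\<^sub>0 int)"
      by (simp flip: zero_word_def)
    then show ?case using assms(3) by (simp add: one_uea.abs_eq)
  next
    case (Cons x xs)
    have "frag_of (Word (x # xs)) = letter x * frag_of (Word xs)"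
      by (simp add: frag_of_mult plus_word_def)
    then show ?case using assms(5)[OF assms(1)[of x] Cons]
      by (simp add: times_uea.abs_eq uea_of.abs_eq)
  qed
  have "P (abs_uea p)" for p
  proof (induction p rule: free_ab_induct)
    case zero
    then show ?case using assms(2) by (simp add: zero_uea.abs_eq)
  next
    case (of w)
    then show ?case using word[of "letters w"] by simp
  next
    case (diff p q)
    then show ?case using assms(4)[OF diff] by (simp add: minus_uea.abs_eq)
  qed
  then show ?thesis by (cases u rule: uea_abs_cases) simp
qed

section \<open>The Poincare-Birkhoff-Witt retraction\<close>

lemma lie_swap: "lie x y = - lie y (x :: 'g::lie_ring)"
proof -
  have "lie (x + y) (x + y) = lie x y + lie y x"
    unfolding lie_add_left lie_add_right by (simp add: lie_self add.commute)
  then show ?thesis by (simp add: lie_self eq_neg_iff_add_eq_0)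
qed

lemma lie_minus: "lie (x - x') y = lie x y - lie x' (y :: 'g::lie_ring)" "lie y (x - x') = lie y x - lie y x'"
  using lie_add_left[of "x - x'" x' y] lie_add_right[of y "x - x'" x'] by (simp_all add: algebra_simps)

lemma lie_uminus_right: "lie y (- x) = - lie y (x :: 'g::lie_ring)"
  using lie_minus(2)[of y x x] lie_minus(2)[of y 0 x] by simp

text \<open>An additive basis indexed by natural numbers, whose order is used to sort monomials;
  \<open>c\<close> takes coordinates. \<open>B\<close> may be any set of numbers, so that pivot
  positions can serve as indices.\<close>

locale lie_basis =
  fixes B :: "nat set" and b :: "nat \<Rightarrow> 'g::lie_ring" and c :: "'g \<Rightarrow> (nat \<Rightarrow>\<^sub>0 int)"
  assumes c_add: "c (x + y) = c x + c y"
    and c_keys: "Poly_Mapping.keys (c x) \<subseteq> B"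
    and c_b: "i \<in> B \<Longrightarrow> c (b i) = frag_of i"
    and b_c: "zlift b (c x) = x"
begin

lemma basis_induct [case_names zero basis diff]:
  assumes "P 0" "\<And>i. i \<in> B \<Longrightarrow> P (b i)" "\<And>x y. P x \<Longrightarrow> P y \<Longrightarrow> P (x - y)"
  shows "P x"
proof -
  have "P (zlift b (c x))"
    by (rule frag_induction[OF c_keys]) (auto simp: zlift_diff assms)
  then show ?thesis by (simp add: b_c)
qed


text \<open>
  The action of Serre's proof: \<open>x\<^sub>i z\<^sub>M = z\<^sub>i\<^sub>M\<close> if \<open>i \<le> min M\<close>, and \<open>x\<^sub>i z\<^sub>M = x\<^sub>j (x\<^sub>i z\<^sub>N) + [x\<^sub>i, x\<^sub>j] z\<^sub>N\<close>
  if \<open>M = jN\<close> with \<open>j = min M < i\<close>. As \<open>x\<^sub>i z\<^sub>N - z\<^sub>i\<^sub>N\<close> has degree at most that of \<open>N\<close> and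
  \<open>x\<^sub>j z\<^sub>i\<^sub>N = z\<^sub>j\<^sub>i\<^sub>N\<close>, recursion on a bound \<open>n\<close> for the degree suffices. The operator \<open>rho x\<close> is zero
  on monomials with indices outside \<open>B\<close>.
\<close>

primrec act_le :: "nat \<Rightarrow> nat \<Rightarrow> nat multiset \<Rightarrow> (nat multiset \<Rightarrow>\<^sub>0 int)" where
  "act_le 0 i M = frag_of (add_mset i M)"
| "act_le (Suc n) i M =
    (if \<forall>j\<in>#M. i \<le> j then frag_of (add_mset i M)
     else let j = Min_mset M; N = M - {#j#} in
       frag_of (add_mset i M)
       + zlift (act_le n j) (act_le n i N - frag_of (add_mset i N))
       + zlift (\<lambda>k. act_le n k N) (c (lie (b i) (b j))))"

definition "act i M = act_le (size M) i M"

definition span :: "nat \<Rightarrow> (nat multiset \<Rightarrow>\<^sub>0 int) set" where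
  "span n = {v. \<forall>M\<in>Poly_Mapping.keys v. size M \<le> n \<and> set_mset M \<subseteq> B}"

lemma span_0 [simp]: "0 \<in> span n"
  by (simp add: span_def)

lemma span_add: "u \<in> span n \<Longrightarrow> v \<in> span n \<Longrightarrow> u + v \<in> span n"
  using Poly_Mapping.keys_add[of u v] by (auto simp: span_def)

lemma span_diff: "u \<in> span n \<Longrightarrow> v \<in> span n \<Longrightarrow> u - v \<in> span n"
  using Poly_Mapping.keys_diff[of u v] by (auto simp: span_def)

lemma span_frag: "size M \<le> n \<Longrightarrow> set_mset M \<subseteq> B \<Longrightarrow> frag_of M \<in> span n"
  by (auto simp: span_def)

lemma span_mono: "v \<in> span n \<Longrightarrow> n \<le> k \<Longrightarrow> v \<in> span k"
  by (auto simp: span_def)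

lemma zlift_span:
  assumes "\<And>x. x \<in> Poly_Mapping.keys p \<Longrightarrow> f x \<in> span n"
  shows "zlift f p \<in> span n"
proof -
  have "zlift f q \<in> span n" if "Poly_Mapping.keys q \<subseteq> Poly_Mapping.keys p" for q
    using that by (rule frag_induction) (auto simp: assms zlift_diff span_diff)
  then show ?thesis by blast
qed

lemma span_induct [consumes 1, case_names frag diff]:
  assumes "v \<in> span n" "\<And>M. size M \<le> n \<Longrightarrow> set_mset M \<subseteq> B \<Longrightarrow> P (frag_of M)"
    "P 0" "\<And>u v. P u \<Longrightarrow> P v \<Longrightarrow> P (u - v)"
  shows "P v"
  using assms(1) unfolding span_def mem_Collect_eq
  by (intro frag_induction[of v "{M. size M \<le> n \<and> set_mset M \<subseteq> B}" P]) (auto intro: assms(2-))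

lemma Min_mset_split:
  assumes "\<not> (\<forall>j\<in>#M. i \<le> j)" "set_mset M \<subseteq> B"
  obtains j N where "M = add_mset j N" "j = Min_mset M" "N = M - {#j#}" "j \<in> B" "set_mset N \<subseteq> B"
    "j < i" "\<forall>k\<in>#N. j \<le> k"
proof -
  let ?j = "Min_mset M"
  from assms obtain k where k: "k \<in># M" "k < i" by auto
  then have j: "?j \<in># M" by (metis Min_in finite_set_mset empty_iff)
  moreover have "?j \<le> k" using k by simp
  moreover have "?j \<le> l" if "l \<in># M - {#?j#}" for l using in_diffD[OF that] by simp
  moreover have "set_mset (M - {#?j#}) \<subseteq> B" using assms(2) by (auto dest: in_diffD)
  ultimately show ?thesis using that[of ?j "M - {#?j#}"] k assms(2)
    by (metis insert_DiffM le_less_trans subsetD)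
qed

text \<open>Subtracting its leading monomial brings x_i z_N down to the degree of N, and x_j raises
  that by one, to the degree of M; the bracket term is no larger.\<close>

lemma act_le_low:
  "size M \<le> n \<Longrightarrow> set_mset M \<subseteq> B \<Longrightarrow> i \<in> B \<Longrightarrow> act_le n i M - frag_of (add_mset i M) \<in> span (size M)"
proof (induction n arbitrary: i M)
  case 0
  then show ?case by simp
next
  case (Suc n)
  show ?case
  proof (cases "\<forall>j\<in>#M. i \<le> j")
    case False
    then obtain j N where M: "M = add_mset j N" "j = Min_mset M" "N = M - {#j#}"
      "j \<in> B" "set_mset N \<subseteq> B"
      using Min_mset_split Suc.prems(2) by metis
    have sN: "size N \<le> n" "Suc (size N) = size M" using M(1) Suc.prems(1) by auto
    have act: "act_le n k L \<in> span (size M)" if "k \<in> B" "size L \<le> size N" "set_mset L \<subseteq> B" for k L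
    proof -
      have "act_le n k L - frag_of (add_mset k L) \<in> span (size L)"
        using Suc.IH[of L k] that sN by simp
      then have "act_le n k L - frag_of (add_mset k L) + frag_of (add_mset k L) \<in> span (size M)"
        using that sN(2)
        by (intro span_add[OF span_mono[where n = "size L"] span_frag]) auto
      then show ?thesis by simp
    qed
    have "zlift (act_le n j) (act_le n i N - frag_of (add_mset i N)) \<in> span (size M)"
      using Suc.IH[OF sN(1) M(5) Suc.prems(3)]
      by (intro zlift_span act M(4)) (auto simp: span_def)
    moreover have "zlift (\<lambda>k. act_le n k N) (c (lie (b i) (b j))) \<in> span (size M)"
      using c_keys M(5) by (intro zlift_span act) auto
    ultimately show ?thesis using False
      by (simp add: Let_def span_add flip: M(2,3))
  qed simp
qed

text \<open>By \<open>act_le_low\<close> the recursion never calls \<open>act_le n\<close> beyond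
  degree n, so the bound can be raised without effect. This frees \<open>act\<close> from its bound
  in \<open>act_step\<close>.\<close>

lemma act_le_stable:
  "size M \<le> n \<Longrightarrow> set_mset M \<subseteq> B \<Longrightarrow> i \<in> B \<Longrightarrow> act_le (Suc n) i M = act_le n i M"
proof (induction n arbitrary: i M)
  case 0
  then show ?case by simp
next
  case (Suc n)
  show ?case
  proof (cases "\<forall>j\<in>#M. i \<le> j")
    case False
    then obtain j N where M: "M = add_mset j N" "j = Min_mset M" "N = M - {#j#}"
      "j \<in> B" "set_mset N \<subseteq> B"
      using Min_mset_split Suc.prems(2) by metis
    have sN: "size N \<le> n" using M(1) Suc.prems(1) by auto
    have 1: "act_le (Suc n) k L = act_le n k L" if "k \<in> B" "size L \<le> size N" "set_mset L \<subseteq> B" for k L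
      using Suc.IH[of L k] that sN by simp
    have "zlift (act_le (Suc n) j) (act_le n i N - frag_of (add_mset i N)) =
        zlift (act_le n j) (act_le n i N - frag_of (add_mset i N))"
      using act_le_low[OF sN M(5) Suc.prems(3)]
      by (intro zlift_cong 1 M(4)) (auto simp: span_def)
    moreover have "zlift (\<lambda>k. act_le (Suc n) k N) (c (lie (b i) (b j)))
        = zlift (\<lambda>k. act_le n k N) (c (lie (b i) (b j)))"
      using c_keys M(5) by (intro zlift_cong 1) auto
    ultimately show ?thesis using False 1[OF Suc.prems(3) order_refl M(5)]
      unfolding act_le.simps(2)[of "Suc n" i M] act_le.simps(2)[of n i M] Let_def M(2)[symmetric] M(3)[symmetric]
      by (simp only: if_False)
  qed simp
qed

lemma act_le_eq_act: "size M \<le> n \<Longrightarrow> set_mset M \<subseteq> B \<Longrightarrow> i \<in> B \<Longrightarrow> act_le n i M = act i M"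
proof (induction n rule: dec_induct)
  case (step n)
  then show ?case using act_le_stable[of M n i] by simp
qed (simp add: act_def)

lemma act_min: "\<forall>j\<in>#M. i \<le> j \<Longrightarrow> act i M = frag_of (add_mset i M)"
  by (cases "size M") (simp_all add: act_def)

lemma act_low: "set_mset M \<subseteq> B \<Longrightarrow> i \<in> B \<Longrightarrow> act i M - frag_of (add_mset i M) \<in> span (size M)"
  unfolding act_def by (rule act_le_low) simp_all

lemma act_step:
  assumes "i \<in> B" "j \<in> B" "set_mset N \<subseteq> B" "j < i" "\<forall>k\<in>#N. j \<le> k"
  shows "act i (add_mset j N) = zlift (act j) (act i N) + zlift (\<lambda>k. act k N) (c (lie (b i) (b j)))"
proof -
  let ?M = "add_mset j N"
  have "Min_mset ?M = j" using assms(5) by (auto intro!: Min_eqI)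
  then have j: "Min_mset ?M = j" "?M - {#j#} = N" by simp_all
  have "\<not> (\<forall>j\<in>#?M. i \<le> j)" using assms by auto
  then have "act i ?M = frag_of (add_mset i ?M)
     + zlift (act_le (size N) j) (act i N - frag_of (add_mset i N))
     + zlift (\<lambda>k. act_le (size N) k N) (c (lie (b i) (b j)))"
    unfolding act_def size_add_mset act_le.simps(2) Let_def j by (simp only: if_False)
  also have "zlift (act_le (size N) j) (act i N - frag_of (add_mset i N))
    = zlift (act j) (act i N - frag_of (add_mset i N))"
    using act_low[OF assms(3,1)] by (intro zlift_cong act_le_eq_act assms) (auto simp: span_def)
  also have "zlift (\<lambda>k. act_le (size N) k N) (c (lie (b i) (b j))) = zlift (\<lambda>k. act k N) (c (lie (b i) (b j)))"
    using c_keys assms(3) by (intro zlift_cong act_le_eq_act) auto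
  \<comment> \<open>The monomial split off in \<open>act_le\<close> is x_j z_iN, because j is
    minimal; this undoes the subtraction inside the first \<open>zlift\<close>.\<close>
  also have "frag_of (add_mset i ?M) = act j (add_mset i N)"
    using assms by (subst act_min) (auto simp: add_mset_commute)
  finally show ?thesis by (simp add: zlift_diff)
qed

section \<open>The representation on formal ordered monomials\<close>

definition rho :: "'g \<Rightarrow> (nat multiset \<Rightarrow>\<^sub>0 int) \<Rightarrow> (nat multiset \<Rightarrow>\<^sub>0 int)" where
  "rho x = zlift (\<lambda>M. if set_mset M \<subseteq> B then zlift (\<lambda>i. act i M) (c x) else 0)"

lemma rho_add: "rho x (u + v) = rho x u + rho x v"
  by (simp add: rho_def zlift_add)

lemma rho_diff: "rho x (u - v) = rho x u - rho x v"
  by (simp add: rho_def zlift_diff)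

lemma rho_0 [simp]: "rho x 0 = 0"
  by (simp add: rho_def)

lemma rho_frag: "set_mset M \<subseteq> B \<Longrightarrow> rho x (frag_of M) = zlift (\<lambda>i. act i M) (c x)"
  by (simp add: rho_def)

lemma rho_bad: "\<not> set_mset M \<subseteq> B \<Longrightarrow> rho x (frag_of M) = 0"
  by (simp add: rho_def)

lemma rho_basis: "set_mset M \<subseteq> B \<Longrightarrow> i \<in> B \<Longrightarrow> rho (b i) (frag_of M) = act i M"
  by (simp add: rho_frag c_b)

lemma rho_basis_span: "v \<in> span n \<Longrightarrow> j \<in> B \<Longrightarrow> rho (b j) v = zlift (act j) v"
  by (induction v rule: span_induct) (simp_all add: rho_basis rho_diff zlift_diff)

lemma rho_add_left: "rho (x + y) v = rho x v + rho y v"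
proof (induction v rule: free_ab_induct)
  case (of M)
  show ?case by (cases "set_mset M \<subseteq> B") (simp_all add: rho_frag rho_bad c_add zlift_add)
qed (simp_all add: rho_diff)

lemma rho_diff_left: "rho (x - y) v = rho x v - rho y v"
  using rho_add_left[of "x - y" y v] by (simp add: algebra_simps)

lemma rho_0_left [simp]: "rho 0 v = 0"
  using rho_diff_left[of 0 0 v] by simp

lemma act_span: "set_mset M \<subseteq> B \<Longrightarrow> i \<in> B \<Longrightarrow> act i M \<in> span (Suc (size M))"
  using span_add[OF span_mono[OF act_low[of M i]] span_frag[of "add_mset i M"]] by simp

lemma rho_span: "v \<in> span n \<Longrightarrow> rho x v \<in> span (Suc n)"
proof (induction v rule: span_induct)
  case (frag M)
  then show ?case using c_keys
    by (subst rho_frag) (auto intro!: zlift_span span_mono[OF act_span])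
qed (simp_all add: rho_diff span_diff)

lemma rho_comm_min:
  assumes "i \<in> B" "j \<in> B" "set_mset N \<subseteq> B" "j < i" "\<forall>k\<in>#N. j \<le> k"
  shows "rho (b i) (rho (b j) (frag_of N)) = rho (b j) (rho (b i) (frag_of N)) + rho (lie (b i) (b j)) (frag_of N)"
proof -
  have "rho (b i) (rho (b j) (frag_of N)) = act i (add_mset j N)"
    using assms by (simp add: rho_basis act_min)
  moreover have "rho (b j) (rho (b i) (frag_of N)) = zlift (act j) (act i N)"
    using assms by (simp add: rho_basis rho_basis_span[OF act_span])
  ultimately show ?thesis using act_step[OF assms] assms(3) by (simp add: rho_frag)
qed

lemma rho_minus_left: "rho (- x) v = - rho x v"
  using rho_diff_left[of 0 x v] by simp

text \<open>Induction on the degree. For i > j the relation is built into \<open>act\<close> if j is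
  at most min N. Otherwise z_N = x_k z_P with k minimal; pulling x_k to the left of x_i x_j and of
  x_j x_i leaves brackets acting on shorter monomials, and the Jacobi identity matches them.\<close>

lemma rho_lie_frag:
  "set_mset N \<subseteq> B \<Longrightarrow> rho x (rho y (frag_of N)) - rho y (rho x (frag_of N)) = rho (lie x y) (frag_of N)"
proof (induction "size N" arbitrary: N x y rule: less_induct)
  case less
  have IH: "rho x (rho y v) = rho y (rho x v) + rho (lie x y) v" if "v \<in> span n" "n < size N" for x y v n
    using that
  proof (induction v rule: span_induct)
    case (frag M)
    then show ?case using less.hyps[of M x y] by (simp add: algebra_simps)
  qed (simp_all add: rho_diff)
  have lt: "rho (b i) (rho (b j) (frag_of N)) - rho (b j) (rho (b i) (frag_of N)) = rho (lie (b i) (b j)) (frag_of N)"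
    if ij: "i \<in> B" "j \<in> B" "j < i" for i j
  proof (cases "\<forall>k\<in>#N. j \<le> k")
    case True
    then show ?thesis using rho_comm_min[OF ij(1,2) less.prems ij(3)] by simp
  next
    case False
    then obtain k P where P: "N = add_mset k P" "k \<in> B" "set_mset P \<subseteq> B" "k < j" "\<forall>l\<in>#P. k \<le> l"
      using Min_mset_split less.prems by metis
    have sP: "frag_of P \<in> span (size P)" "size P < size N" using P by (auto intro: span_frag)
    have N: "frag_of N = rho (b k) (frag_of P)"
      using P by (simp add: rho_basis act_min)
    have main: "rho (b i) (rho (b j) (frag_of N)) = rho (b k) (rho (b i) (rho (b j) (frag_of P)))
       + rho (lie (b i) (b k)) (rho (b j) (frag_of P)) + rho (lie (b j) (b k)) (rho (b i) (frag_of P))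
       + rho (lie (b i) (lie (b j) (b k))) (frag_of P)"
      if "i \<in> B" "j \<in> B" "k < i" "k < j" for i j
    proof -
      \<comment> \<open>x_j z_P has the degree of N, which the induction hypothesis does not reach.
        Its leading monomial z_jP still has all indices at least k < i, so there the commutator of
        x_i and x_k is right by construction; the remainder \<open>w\<close> has lower
        degree.\<close>
      define w where "w = act j P - frag_of (add_mset j P)"
      have w: "w \<in> span (size P)" "rho (b j) (frag_of P) = frag_of (add_mset j P) + w"
        using act_low[OF P(3) that(2)] by (simp_all add: w_def rho_basis P that)
      have 1: "rho (b j) (frag_of N) = rho (b k) (rho (b j) (frag_of P)) + rho (lie (b j) (b k)) (frag_of P)"
        unfolding N using that P by (intro rho_comm_min) auto
      have 2: "rho (b i) (rho (b k) (frag_of (add_mset j P)))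
          = rho (b k) (rho (b i) (frag_of (add_mset j P))) + rho (lie (b i) (b k)) (frag_of (add_mset j P))"
        using that P by (intro rho_comm_min) auto
      have 3: "rho (b i) (rho (b k) (rho (b j) (frag_of P)))
          = rho (b k) (rho (b i) (rho (b j) (frag_of P))) + rho (lie (b i) (b k)) (rho (b j) (frag_of P))"
        using 2 IH[OF w(1) sP(2), of "b i" "b k"] unfolding w(2) rho_add by (simp add: algebra_simps)
      show ?thesis
        unfolding 1 rho_add 3 using IH[OF sP, of "b i" "lie (b j) (b k)"] by (simp add: algebra_simps)
    qed
    have jac: "lie (b i) (lie (b j) (b k)) - lie (b j) (lie (b i) (b k)) = lie (lie (b i) (b j)) (b k)"
      using lie_jacobi[of "b i" "b j" "b k"]
      by (simp add: lie_swap[of "lie (b i) (b j)" "b k"] lie_swap[of "b i" "b k"] lie_uminus_right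
          eq_neg_iff_add_eq_0 algebra_simps)
    have 4: "rho (lie (b i) (b j)) (frag_of N) = rho (b k) (rho (lie (b i) (b j)) (frag_of P))
        + rho (lie (lie (b i) (b j)) (b k)) (frag_of P)"
      unfolding N using IH[OF sP] .
    have 5: "rho (b i) (rho (b j) (frag_of P)) - rho (b j) (rho (b i) (frag_of P)) = rho (lie (b i) (b j)) (frag_of P)"
      using IH[OF sP, of "b i" "b j"] by simp
    have "rho (b i) (rho (b j) (frag_of N)) - rho (b j) (rho (b i) (frag_of N))
       = rho (b k) (rho (b i) (rho (b j) (frag_of P)) - rho (b j) (rho (b i) (frag_of P)))
       + rho (lie (b i) (lie (b j) (b k)) - lie (b j) (lie (b i) (b k))) (frag_of P)"
      using main[of i j] main[of j i] ij P(4) by (simp add: rho_diff rho_diff_left)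
    also have "\<dots> = rho (lie (b i) (b j)) (frag_of N)"
      unfolding jac 4 5 ..
    finally show ?thesis .
  qed
  have basis: "rho (b i) (rho (b j) (frag_of N)) - rho (b j) (rho (b i) (frag_of N)) = rho (lie (b i) (b j)) (frag_of N)"
    if "i \<in> B" "j \<in> B" for i j
  proof (cases i j rule: linorder_cases)
    case less
    then show ?thesis using lt[of j i] lie_swap[of "b i" "b j"] that by (simp add: rho_minus_left) (metis minus_diff_eq)
  next
    case equal
    then show ?thesis by (simp add: lie_self)
  next
    case greater
    then show ?thesis using lt that by simp
  qed
  have half: "rho x (rho (b j) (frag_of N)) - rho (b j) (rho x (frag_of N)) = rho (lie x (b j)) (frag_of N)"
    if "j \<in> B" for j
  proof (induction x rule: basis_induct)
    case zero
    show ?case using lie_minus(1)[of 0 0 "b j"] by simp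
  next
    case (diff x y)
    then show ?case by (simp add: rho_diff rho_diff_left lie_minus algebra_simps)
  qed (simp add: basis that)
  show ?case
  proof (induction y rule: basis_induct)
    case zero
    show ?case using lie_minus(2)[of x 0 0] by simp
  next
    case (diff y y')
    then show ?case by (simp add: rho_diff rho_diff_left lie_minus algebra_simps)
  qed (simp add: half)
qed

lemma rho_lie: "rho (lie x y) v = rho x (rho y v) - rho y (rho x v)"
proof (induction v rule: free_ab_induct)
  case (of M)
  show ?case by (cases "set_mset M \<subseteq> B") (simp_all add: rho_lie_frag rho_bad)
qed (simp_all add: rho_diff)


section \<open>Comparison with ordered products in the enveloping ring\<close>

definition monom :: "(nat multiset \<Rightarrow>\<^sub>0 int) \<Rightarrow> 'g uea" where
  "monom = zlift (\<lambda>M. prod_list (map (\<lambda>i. uea_of (b i)) (sorted_list_of_multiset M)))"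

lemma monom_diff: "monom (u - v) = monom u - monom v"
  by (simp add: monom_def zlift_diff)

lemma monom_add: "monom (u + v) = monom u + monom v"
  by (simp add: monom_def zlift_add)

lemma monom_min: "\<forall>j\<in>#M. i \<le> j \<Longrightarrow> monom (frag_of (add_mset i M)) = uea_of (b i) * monom (frag_of M)"
  by (simp add: monom_def insort_is_Cons)

text \<open>Every rule that defines \<open>act\<close> is a relation between ordered products in U,
  so formal monomials map to U compatibly with left multiplication. Started at the empty monomial,
  this makes \<open>monom\<close> a left inverse of u -> u z_0, where z_0 is that monomial.\<close>

lemma monom_rho_frag: "set_mset M \<subseteq> B \<Longrightarrow> monom (rho x (frag_of M)) = uea_of x * monom (frag_of M)"
proof (induction "size M" arbitrary: x M rule: less_induct)
  case less
  have basis: "monom (rho (b i) (frag_of M)) = uea_of (b i) * monom (frag_of M)" if i: "i \<in> B" for i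
  proof (cases "\<forall>j\<in>#M. i \<le> j")
    case True
    then show ?thesis using i less.prems by (simp add: rho_basis act_min monom_min)
  next
    case False
    then obtain j N where M: "M = add_mset j N" "j \<in> B" "set_mset N \<subseteq> B" "j < i" "\<forall>l\<in>#N. j \<le> l"
      using Min_mset_split less.prems by metis
    have IH: "monom (rho x v) = uea_of x * monom v" if "v \<in> span (size N)" for x v
      using that
    proof (induction v rule: span_induct)
      case (frag L)
      then show ?case using less.hyps[of L x] M(1) by simp
    qed (simp_all add: rho_diff monom_diff right_diff_distrib, simp add: monom_def)
    have N: "frag_of N \<in> span (size N)" using M by (simp add: span_frag)
    define w where "w = act i N - frag_of (add_mset i N)"
    have w: "w \<in> span (size N)" "rho (b i) (frag_of N) = frag_of (add_mset i N) + w"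
      using act_low[OF M(3) i] by (simp_all add: w_def rho_basis M i)
    have "monom (rho (b j) (frag_of (add_mset i N))) = uea_of (b j) * monom (frag_of (add_mset i N))"
      using M i by (subst rho_basis) (auto simp: act_min monom_min)
    then have 1: "monom (rho (b j) (rho (b i) (frag_of N))) = uea_of (b j) * (uea_of (b i) * monom (frag_of N))"
      using IH[OF w(1)] IH[OF N, of "b i"]
      unfolding w(2) rho_add monom_add by (simp flip: distrib_left)
    have 2: "rho (b i) (frag_of M) = rho (b i) (rho (b j) (frag_of N))"
      using M by (simp add: rho_basis act_min)
    show ?thesis
      unfolding 2 rho_comm_min[OF i M(2,3,4,5)] monom_add 1 IH[OF N]
      using M by (simp add: monom_min uea_of_lie algebra_simps)
  qed
  show ?case
  proof (induction x rule: basis_induct)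
    case zero
    then show ?case using uea_of_add[of 0 "0::'g"] by (simp add: monom_def)
  next
    case (diff x y)
    have "uea_of (x - y) = uea_of x - uea_of y" using uea_of_add[of "x - y" y] by simp
    then show ?case using diff by (simp add: rho_diff_left monom_diff left_diff_distrib)
  qed (rule basis)
qed

lift_definition rho_end :: "'g \<Rightarrow> (nat multiset \<Rightarrow>\<^sub>0 int) aend" is rho
  by (simp add: Modules.additive_def rho_add)

lemma rho_end_hom:
  "rho_end (x + y) = rho_end x + rho_end y" "rho_end (lie x y) = rho_end x * rho_end y - rho_end y * rho_end x"
  by (transfer, simp add: fun_eq_iff rho_add_left rho_lie)+

lemmas rep_simps = uea_lift[where f = rho_end, OF rho_end_hom]

definition uact :: "'g uea \<Rightarrow> (nat multiset \<Rightarrow>\<^sub>0 int) \<Rightarrow> (nat multiset \<Rightarrow>\<^sub>0 int)" where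
  "uact u = Rep_aend (uea_lift rho_end u)"

lemma uact_simps: "uact (uea_of x) v = rho x v" "uact 1 v = v" "uact (u + u') v = uact u v + uact u' v"
  "uact (u * u') v = uact u (uact u' v)"
  by (simp_all add: uact_def rep_simps rho_end.rep_eq one_aend.rep_eq plus_aend.rep_eq times_aend.rep_eq)

lemma uact_diff: "uact (u - u') v = uact u v - uact u' v"
  using uact_simps(3)[of "u - u'" u' v] by simp

text \<open>The span condition is carried along because on monomials with indices outside
  \<open>B\<close> the operator \<open>rho\<close> is zero and does not match left
  multiplication.\<close>

lemma monom_uact: "v \<in> (\<Union>n. span n) \<Longrightarrow> uact u v \<in> (\<Union>n. span n) \<and> monom (uact u v) = u * monom v"
proof (induction u arbitrary: v rule: uea_induct)
  case (of x)
  then obtain n where v: "v \<in> span n" by blast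
  then have "rho x v \<in> span (Suc n)" by (rule rho_span)
  moreover from v have "monom (rho x v) = uea_of x * monom v"
    by (induction v rule: span_induct)
      (simp_all add: monom_rho_frag rho_diff monom_diff right_diff_distrib, simp add: monom_def)
  ultimately show ?case by (auto simp: uact_simps)
next
  case zero
  then show ?case using uact_diff[of 0 0 v] by (auto simp: monom_def)
next
  case (diff u u')
  then obtain n n' where "uact u v \<in> span n" "uact u' v \<in> span n'" by blast
  then have "uact (u - u') v \<in> span (max n n')"
    unfolding uact_diff by (intro span_diff) (erule span_mono, simp)+
  then show ?case using diff by (auto simp: uact_diff monom_diff left_diff_distrib)
next
  case (mult u u')
  then show ?case by (simp add: uact_simps mult.assoc)
qed (simp_all add: uact_simps)

lemma monom_uact_1: "monom (uact u (frag_of {#})) = u"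
proof -
  have "frag_of {#} \<in> span 0" by (rule span_frag) auto
  then have "monom (uact u (frag_of {#})) = u * monom (frag_of {#})"
    using monom_uact by blast
  then show ?thesis unfolding monom_def zlift_of by simp
qed

end

section \<open>Retracts of free abelian groups\<close>

definition free_retract :: "('a::ab_group_add \<Rightarrow> ('x \<Rightarrow>\<^sub>0 int)) \<Rightarrow> (('x \<Rightarrow>\<^sub>0 int) \<Rightarrow> 'a) \<Rightarrow> bool" where
  "free_retract f g \<longleftrightarrow> Modules.additive f \<and> Modules.additive g \<and> (\<forall>a. g (f a) = a)"

lemma (in lie_basis) free_retract_uea: "free_retract (\<lambda>u. uact u (frag_of {#})) monom"
  using monom_uact_1
  by (simp only: free_retract_def Modules.additive_def uact_simps monom_add simp_thms)

text \<open>The tensor product of two free groups is free on pairs of generators, \<open>pr\<close>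
  being the bilinear map behind this; the retraction is then the tensor product of the given
  ones.\<close>

lemma free_retract_tensor:
  fixes f :: "'a::ab_group_add \<Rightarrow> ('x \<Rightarrow>\<^sub>0 int)" and f' :: "'b::ab_group_add \<Rightarrow> ('y \<Rightarrow>\<^sub>0 int)"
  assumes "free_retract f g" "free_retract f' g'"
  shows "\<exists>(F :: ('a, 'b) tensor \<Rightarrow> ('x \<times> 'y \<Rightarrow>\<^sub>0 int)) G. free_retract F G"
proof -
  define pr :: "('x \<Rightarrow>\<^sub>0 int) \<Rightarrow> ('y \<Rightarrow>\<^sub>0 int) \<Rightarrow> ('x \<times> 'y \<Rightarrow>\<^sub>0 int)" where
    "pr p q = zlift (\<lambda>x. zlift (\<lambda>y. frag_of (x, y)) q) p" for p q
  define G where "G = zlift (\<lambda>(x, y). g (frag_of x) \<otimes> g' (frag_of y))"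
  have add: "Modules.additive f" "Modules.additive g" "Modules.additive f'" "Modules.additive g'"
    and inv: "g (f a) = a" "g' (f' b) = b" for a b
    using assms by (auto simp: free_retract_def)
  have pr: "pr (p + p') q = pr p q + pr p' q" "pr p (q + q') = pr p q + pr p q'" for p p' q q'
    by (simp_all add: pr_def zlift_add) (simp add: zlift_def zmul_add_right sum.distrib)
  have bi: "biadditive (\<lambda>a b. pr (f a) (f' b))"
    by (rule biadditiveI) (simp_all add: additive.add[OF add(1)] additive.add[OF add(3)] pr)
  have neg: "(a - a') \<otimes> b = a \<otimes> b - a' \<otimes> b" "b' \<otimes> (d - d') = b' \<otimes> d - b' \<otimes> d'"
    for a a' b' :: 'a and b d d' :: 'b
    using tensor_add_left[of "a - a'" a' b] tensor_add_right[of b' "d - d'" d']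
    by (simp_all add: algebra_simps)
  have pr': "pr (p - p') q = pr p q - pr p' q" "pr p (q - q') = pr p q - pr p q'" for p p' q q'
    using pr(1)[of "p - p'" p' q] by simp (use pr(2)[of p "q - q'" q'] in simp)
  have G0: "G (pr p q) = g p \<otimes> g' q" for p q
  proof (induction p rule: free_ab_induct)
    case zero
    show ?case using additive.zero[OF add(2)] by (simp add: pr_def G_def)
  next
    case (of x)
    show ?case
    proof (induction q rule: free_ab_induct)
      case zero
      show ?case using additive.zero[OF add(4)] by (simp add: pr_def G_def)
    next
      case (diff q q')
      then show ?case by (simp add: pr' G_def zlift_diff additive.diff[OF add(4)] neg)
    qed (simp add: pr_def G_def)
  next
    case (diff p p')
    then show ?case by (simp add: pr' G_def zlift_diff additive.diff[OF add(2)] neg)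
  qed
  have "G (tensor_lift (\<lambda>a b. pr (f a) (f' b)) x) = x" for x
    by (induction x rule: tensor_induct)
      (simp_all add: bi G0 inv, simp_all add: G_def zlift_diff)
  then have "free_retract (tensor_lift (\<lambda>a b. pr (f a) (f' b))) G"
    by (simp add: free_retract_def Modules.additive_def bi) (simp add: G_def zlift_add)
  then show ?thesis by blast
qed

text \<open>Each coordinate of \<open>f\<close> extends to a functional on the rationalization, so
  the coordinates of \<open>a\<close> can be recovered from \<open>1 \<otimes> a\<close>.\<close>

lemma free_retract_ratl_inj:
  fixes a a' :: "'a::ab_group_add" and f :: "'a \<Rightarrow> ('x \<Rightarrow>\<^sub>0 int)"
  assumes "free_retract f g" "(1::rat) \<otimes> a = 1 \<otimes> a'"
  shows "a = a'"
proof -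
  have add: "Modules.additive f" and inv: "\<And>a. g (f a) = a"
    using assms by (auto simp: free_retract_def)
  have "Poly_Mapping.lookup (f a) x = Poly_Mapping.lookup (f a') x" for x
  proof -
    let ?f = "\<lambda>(q::rat) a. q * rat_of_int (Poly_Mapping.lookup (f a) x)"
    have "biadditive ?f"
      by (rule biadditiveI) (simp_all add: additive.add[OF add] lookup_add algebra_simps)
    from tensor_lift_pure[OF this, of 1 a] tensor_lift_pure[OF this, of 1 a'] assms(2)
    show ?thesis by simp
  qed
  then have "f a = f a'" by (rule poly_mapping_eqI)
  then show ?thesis using inv by metis
qed

text \<open>
  Echelon basis: \<open>b p\<close> has last nonzero coordinate \<open>p\<close>, with the least positive value possible there.
\<close>

lemma lie_basis_exists:
  fixes e :: "nat \<Rightarrow> 'g::lie_ring \<Rightarrow> int"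
  assumes add: "\<And>k. Modules.additive (e k)" and fin: "\<And>x. finite {k. e k x \<noteq> 0}"
    and inj: "\<And>x. (\<And>k. e k x = 0) \<Longrightarrow> x = 0"
  shows "\<exists>B (b :: nat \<Rightarrow> 'g) c. lie_basis B b c"
proof -
  define low where "low p x \<longleftrightarrow> (\<forall>k>p. e k x = 0)" for p x
  define B where "B = {p. \<exists>x. low p x \<and> e p x > 0}"
  define b where "b p = (ARG_MIN (\<lambda>x. nat (e p x)) x. low p x \<and> e p x > 0)" for p
  have b: "low p (b p)" "e p (b p) > 0" "\<And>x. low p x \<Longrightarrow> e p x > 0 \<Longrightarrow> e p (b p) \<le> e p x" if "p \<in> B" for p
  proof -
    from that obtain x where x: "low p x \<and> e p x > 0" by (auto simp: B_def)
    show 1: "low p (b p)" "e p (b p) > 0"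
      using arg_min_natI[of "\<lambda>x. low p x \<and> e p x > 0", OF x] unfolding b_def by auto
    show "e p (b p) \<le> e p x" if "low p x" "e p x > 0" for x
      using arg_min_nat_le[of "\<lambda>x. low p x \<and> e p x > 0" x "\<lambda>x. nat (e p x)"] that
      unfolding b_def by auto
  qed
  have e_diff: "e k (x - y) = e k x - e k y" for k x y using additive.diff[OF add] .
  have e_zmul: "e k (zmul n x) = n * e k x" for k n x using additive_zmul[OF add] by simp
  have e_minus: "e k (- x) = - e k x" for k x using additive.minus[OF add] .
  have low_diff: "low p (x - zmul n y)" if "low p x" "low p y" for p x y n
    using that by (simp add: low_def e_diff e_zmul)
  have ex: "\<exists>c. Poly_Mapping.keys c \<subseteq> B \<and> zlift b c = x" if "\<forall>k\<ge>p. e k x = 0" for p x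
    using that
  proof (induction p arbitrary: x)
    case 0
    then have "x = 0" by (intro inj) simp
    then show ?case by (intro exI[of _ 0]) simp
  next
    case (Suc p)
    then have low: "low p x" by (simp add: low_def Suc_le_eq)
    show ?case
    proof (cases "e p x = 0")
      case True
      with low show ?thesis by (intro Suc.IH) (auto simp: low_def le_less)
    next
      case False
      have p: "p \<in> B"
      proof (cases "e p x > 0")
        case False
        with \<open>e p x \<noteq> 0\<close> have "low p (- x)" "e p (- x) > 0" using low by (auto simp: low_def e_minus)
        then show ?thesis by (auto simp: B_def)
      qed (use low in \<open>auto simp: B_def\<close>)
      let ?n = "e p x div e p (b p)"
      let ?y = "x - zmul ?n (b p)"
      have y: "low p ?y" using low b(1)[OF p] by (rule low_diff)
      have "e p ?y = e p x mod e p (b p)"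
        by (simp add: e_diff e_zmul minus_div_mult_eq_mod)
      \<comment> \<open>A positive remainder would be a smaller pivot at p, against the choice of
        \<open>b p\<close>.\<close>
      then have "e p ?y = 0"
        using b(2,3)[OF p] y pos_mod_bound[of "e p (b p)" "e p x"] pos_mod_sign[of "e p (b p)" "e p x"]
        by (metis le_less not_le)
      with y obtain c where c: "Poly_Mapping.keys c \<subseteq> B" "zlift b c = ?y"
        using Suc.IH[of ?y] by (auto simp: low_def le_less)
      let ?c = "c + Poly_Mapping.single p ?n"
      have "Poly_Mapping.keys ?c \<subseteq> B"
        using c(1) p Poly_Mapping.keys_add[of c "Poly_Mapping.single p ?n"]
        by (auto split: if_splits)
      moreover have "zlift b (Poly_Mapping.single p ?n) = zmul ?n (b p)"
        by (simp add: zlift_def)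
      then have "zlift b ?c = x" by (simp add: zlift_add c(2))
      ultimately show ?thesis by blast
    qed
  qed
  have uniq: "c = 0" if c: "Poly_Mapping.keys c \<subseteq> B" "zlift b c = 0" for c
  proof (rule ccontr)
    assume "c \<noteq> 0"
    then have ne: "Poly_Mapping.keys c \<noteq> {}" by simp
    \<comment> \<open>Only the top index contributes to coordinate p, and its pivot is
      positive.\<close>
    define p where "p = Max (Poly_Mapping.keys c)"
    have p: "p \<in> Poly_Mapping.keys c" unfolding p_def by (rule Max_in) (use ne in auto)
    have "0 = e p (zlift b c)" using c(2) additive.zero[OF add] by simp
    also have "\<dots> = (\<Sum>k\<in>Poly_Mapping.keys c. Poly_Mapping.lookup c k * e p (b k))"
      by (simp add: zlift_def additive.sum[OF add] e_zmul)
    also have "\<dots> = (\<Sum>k\<in>{p}. Poly_Mapping.lookup c k * e p (b k))"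
    proof (rule sum.mono_neutral_right)
      show "\<forall>k\<in>Poly_Mapping.keys c - {p}. Poly_Mapping.lookup c k * e p (b k) = 0"
      proof
        fix k assume k: "k \<in> Poly_Mapping.keys c - {p}"
        then have "k < p" using Max_ge[of "Poly_Mapping.keys c" k] by (simp add: p_def less_le)
        moreover have "low k (b k)" using k c(1) by (intro b) auto
        ultimately show "Poly_Mapping.lookup c k * e p (b k) = 0" by (simp add: low_def)
      qed
    qed (use p in auto)
    finally show False using p b(2)[of p] c(1) by (auto simp: in_keys_iff)
  qed
  have all: "\<exists>c. Poly_Mapping.keys c \<subseteq> B \<and> zlift b c = x" for x
  proof -
    obtain p where "\<forall>k\<in>{k. e k x \<noteq> 0}. k < p" using finite_nat_set_iff_bounded[THEN iffD1, OF fin] by blast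
    then have "\<forall>k\<ge>p. e k x = 0" by (meson mem_Collect_eq not_le)
    then show ?thesis by (rule ex)
  qed
  then obtain c where c: "\<And>x. Poly_Mapping.keys (c x) \<subseteq> B" "\<And>x. zlift b (c x) = x" by metis
  have eq: "c x = q" if "Poly_Mapping.keys q \<subseteq> B" "zlift b q = x" for q x
  proof -
    have "Poly_Mapping.keys (c x - q) \<subseteq> B" using Poly_Mapping.keys_diff[of "c x" q] that c by blast
    then have "c x - q = 0" using that c by (intro uniq) (simp_all add: zlift_diff)
    then show ?thesis by simp
  qed
  have "lie_basis B b c"
  proof
    show "c (x + y) = c x + c y" for x y
      using Poly_Mapping.keys_add[of "c x" "c y"] c by (intro eq) (auto simp: zlift_add)
    show "c (b i) = frag_of i" if "i \<in> B" for i
      using that by (intro eq) auto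
  qed (rule c)+
  then show ?thesis by blast
qed

lemma splus_lie_basis: "\<exists>B (b :: nat \<Rightarrow> 'n::finite splus) c. lie_basis B b c"
proof -
  \<comment> \<open>Coefficients numbered by pairs of exponent and component. Off the range of
    \<open>to_nat\<close> the value of \<open>from_nat\<close> is arbitrary; without the guard
    infinitely many coordinates might be nonzero.\<close>
  define e :: "nat \<Rightarrow> 'n splus \<Rightarrow> int" where
    "e k w = (if k \<in> range (to_nat :: (int ^ 'n) \<times> 'n \<Rightarrow> nat)
      then Poly_Mapping.lookup (Rep_splus w) (fst (from_nat k :: (int ^ 'n) \<times> 'n)) $ snd (from_nat k :: (int ^ 'n) \<times> 'n) else 0)" for k w
  have e: "e (to_nat (\<alpha>, i)) w = Poly_Mapping.lookup (Rep_splus w) \<alpha> $ i" for \<alpha> i w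
    by (simp add: e_def)
  show ?thesis
  proof (rule lie_basis_exists[of e])
    show "Modules.additive (e k)" for k
      by (simp add: Modules.additive_def e_def plus_splus.rep_eq lookup_add)
    show "finite {k. e k w \<noteq> 0}" for w
    proof (rule finite_subset)
      show "{k. e k w \<noteq> 0} \<subseteq> to_nat ` (Poly_Mapping.keys (Rep_splus w) \<times> (UNIV :: 'n set))"
        by (auto simp: e_def in_keys_iff split: if_splits intro!: imageI)
    qed simp
    show "w = 0" if "\<And>k. e k w = 0" for w
    proof -
      have "Rep_splus w = 0"
        by (rule poly_mapping_eqI) (simp add: vec_eq_iff that flip: e)
      then show ?thesis by (simp add: zero_splus.rep_eq flip: Rep_splus_inject)
    qed
  qed
qed

section \<open>Injectivity of the rationalization for tensor powers of U\<close>

definition ratl_inj :: "'a::ab_group_add itself \<Rightarrow> bool" where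
  "ratl_inj _ \<longleftrightarrow> inj (\<lambda>a :: 'a. (1::rat) \<otimes> a)"

lemma ratl_inj_splus:
  "ratl_inj TYPE('n::finite splus uea)"
  "ratl_inj TYPE(('n splus uea, 'n splus uea) tensor)"
  "ratl_inj TYPE(('n splus uea, ('n splus uea, 'n splus uea) tensor) tensor)"
proof -
  obtain B and b :: "nat \<Rightarrow> 'n splus" and c where "lie_basis B b c" using splus_lie_basis by blast
  then interpret lie_basis B b c .
  note 1 = free_retract_uea
  obtain F G where 2: "free_retract (F :: ('n splus uea, 'n splus uea) tensor \<Rightarrow> (nat multiset \<times> nat multiset \<Rightarrow>\<^sub>0 int)) G"
    using free_retract_tensor[OF 1 1] by auto
  obtain F' G' where 3: "free_retract (F' :: ('n splus uea, ('n splus uea, 'n splus uea) tensor) tensor \<Rightarrow>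
      (nat multiset \<times> nat multiset \<times> nat multiset \<Rightarrow>\<^sub>0 int)) G'"
    using free_retract_tensor[OF 1 2] by auto
  show "ratl_inj TYPE('n::finite splus uea)"
    "ratl_inj TYPE(('n splus uea, 'n splus uea) tensor)"
    "ratl_inj TYPE(('n splus uea, ('n splus uea, 'n splus uea) tensor) tensor)"
    unfolding ratl_inj_def
    by (rule injI, erule free_retract_ratl_inj[rotated], fact 1 2 3)+
qed

section \<open>Calculus of biadditive maps and tensor products\<close>

lemma biadditive_additive:
  assumes "biadditive f"
  shows "Modules.additive (f a)" "Modules.additive (\<lambda>a. f a b)"
  using assms by (simp_all add: biadditive_def Modules.additive_def)

lemma biadditive_tensor: "biadditive (\<otimes>)"
  by (rule biadditiveI) (simp_all add: tensor_add_left tensor_add_right)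

lemma biadditive_times: "biadditive ((*) :: 'a::ring \<Rightarrow> 'a \<Rightarrow> 'a)"
  by (rule biadditiveI) (simp_all add: distrib_left distrib_right)

lemma biadditive_zmul: "biadditive zmul"
  by (rule biadditiveI) (simp_all add: zmul_add zmul_add_right)

lemma biadditive_comp:
  "biadditive \<beta> \<Longrightarrow> Modules.additive f \<Longrightarrow> Modules.additive g \<Longrightarrow> biadditive (\<lambda>a b. \<beta> (f a) (g b))"
  by (simp add: biadditive_def Modules.additive_def)

lemma additive_tensor_lift: "biadditive f \<Longrightarrow> Modules.additive (tensor_lift f)"
  by (simp add: Modules.additive_def)

lemma tensor_diff_pure: "(a - a') \<otimes> b = a \<otimes> b - a' \<otimes> b" "a \<otimes> (b - b') = a \<otimes> b - a \<otimes> b'"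
  using additive.diff[OF biadditive_additive(2)[OF biadditive_tensor]]
    additive.diff[OF biadditive_additive(1)[OF biadditive_tensor]] by blast+

lemma tensor_uminus_pure: "(- a) \<otimes> b = - (a \<otimes> b)" "a \<otimes> (- b) = - (a \<otimes> b)"
  using tensor_diff_pure(1)[of 0 a b] tensor_diff_pure(2)[of a 0 b] by simp_all

lemma tensor_sum_pure: "sum f A \<otimes> b = (\<Sum>i\<in>A. f i \<otimes> b)" "a \<otimes> sum g A = (\<Sum>i\<in>A. a \<otimes> g i)"
  using additive.sum[OF biadditive_additive(2)[OF biadditive_tensor]]
    additive.sum[OF biadditive_additive(1)[OF biadditive_tensor]] by blast+

lemma tensor_zmul: "zmul n a \<otimes> b = zmul n (a \<otimes> b)" "a \<otimes> zmul n b = zmul n (a \<otimes> b)"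
  using additive_zmul[OF biadditive_additive(2)[OF biadditive_tensor]]
    additive_zmul[OF biadditive_additive(1)[OF biadditive_tensor]] by blast+

lemma zmul_of_int: "zmul n (a::'a::ring_1) = of_int n * a"
  by (induction n rule: int_induct[where k = 0]) (simp_all add: zmul_Suc zmul_pred algebra_simps)

lemma additive_tensor_eqI:
  assumes "Modules.additive f" "Modules.additive g" "\<And>a b. f (a \<otimes> b) = g (a \<otimes> b)"
  shows "f x = g x"
  by (induction x rule: tensor_induct)
    (simp_all add: assms additive.zero[OF assms(1)] additive.zero[OF assms(2)] additive.diff[OF assms(1)] additive.diff[OF assms(2)])

lemma additive_tensor_map:
  "Modules.additive f \<Longrightarrow> Modules.additive g \<Longrightarrow> Modules.additive (tensor_map f g)"
  unfolding tensor_map_def by (rule additive_tensor_lift[OF biadditive_comp[OF biadditive_tensor]])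

lemma tensor_map_pure [simp]:
  "Modules.additive f \<Longrightarrow> Modules.additive g \<Longrightarrow> tensor_map f g (a \<otimes> b) = f a \<otimes> g b"
  unfolding tensor_map_def by (rule tensor_lift_pure[OF biadditive_comp[OF biadditive_tensor]])

lemma additive_id [simp]: "Modules.additive id" "Modules.additive (\<lambda>x. x)"
  by (simp_all add: Modules.additive_def)

section \<open>Bilinear products of power series\<close>

text \<open>The Cauchy product along an arbitrary pairing. Products of series, the completed tensor
  product, scaling by integer series and, over the rationals, the actions \<open>lact\<close> and
  \<open>ract\<close> are instances, so associativity and linearity are proved once.\<close>

definition fps_bil :: "('a \<Rightarrow> 'b \<Rightarrow> 'c::comm_monoid_add) \<Rightarrow> 'a fps \<Rightarrow> 'b fps \<Rightarrow> 'c fps" where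
  "fps_bil \<beta> x y = Abs_fps (\<lambda>n. \<Sum>i\<le>n. \<beta> (fps_nth x i) (fps_nth y (n - i)))"

lemma fps_times_bil: "(*) = fps_bil (*)"
  by (simp add: fun_eq_iff fps_eq_iff fps_bil_def fps_mult_nth atLeast0AtMost)

lemma ctensor_bil: "(\<otimes>\<^sub>t) = fps_bil (\<otimes>)"
  by (simp add: fun_eq_iff ctensor_def fps_bil_def)

lemma zt_scale_bil: "zt_scale = fps_bil zmul"
  by (simp add: fun_eq_iff zt_scale_def fps_bil_def)

lemma fps_bil_assoc:
  assumes "\<And>a b c. \<beta>1 (\<beta>2 a b) c = \<beta>3 a (\<beta>4 b c)"
    and "\<And>c. Modules.additive (\<lambda>a. \<beta>1 a c)" "\<And>a. Modules.additive (\<beta>3 a)"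
  shows "fps_bil \<beta>1 (fps_bil \<beta>2 x y) z = fps_bil \<beta>3 x (fps_bil \<beta>4 y z)"
proof (rule fps_ext)
  fix n
  let ?f = "\<lambda>i j k. \<beta>3 (fps_nth x i) (\<beta>4 (fps_nth y j) (fps_nth z k))"
  have "fps_nth (fps_bil \<beta>1 (fps_bil \<beta>2 x y) z) n = (\<Sum>j=0..n. \<Sum>i=0..j. ?f i (j - i) (n - j))"
    by (simp add: fps_bil_def atLeast0AtMost additive.sum[OF assms(2)] assms(1))
  also have "\<dots> = (\<Sum>j=0..n. \<Sum>i=0..n - j. ?f j i (n - j - i))"
    by (rule fps_mult_assoc_lemma)
  also have "\<dots> = fps_nth (fps_bil \<beta>3 x (fps_bil \<beta>4 y z)) n"
    by (simp add: fps_bil_def atLeast0AtMost additive.sum[OF assms(3)])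
  finally show "fps_nth (fps_bil \<beta>1 (fps_bil \<beta>2 x y) z) n = fps_nth (fps_bil \<beta>3 x (fps_bil \<beta>4 y z)) n" .
qed

lemma fps_map_bil:
  assumes "Modules.additive f" "\<And>a b. f (\<beta> a b) = \<beta>' (g a) (h b)"
  shows "fps_map f (fps_bil \<beta> x y) = fps_bil \<beta>' (fps_map g x) (fps_map h y)"
  by (simp add: fps_eq_iff fps_map_def fps_bil_def additive.sum[OF assms(1)] assms(2))

lemma fps_bil_const:
  assumes "biadditive \<beta>"
  shows "fps_nth (fps_bil \<beta> (fps_const a) y) n = \<beta> a (fps_nth y n)"
    "fps_nth (fps_bil \<beta> x (fps_const b)) n = \<beta> (fps_nth x n) b"
proof -
  note 0 = additive.zero[OF biadditive_additive(1)[OF assms]] additive.zero[OF biadditive_additive(2)[OF assms]]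
  have "fps_nth (fps_bil \<beta> (fps_const a) y) n = (\<Sum>i\<in>{0}. \<beta> (fps_nth (fps_const a) i) (fps_nth y (n - i)))"
    unfolding fps_bil_def fps_nth_Abs_fps by (rule sum.mono_neutral_right) (auto simp: 0)
  then show "fps_nth (fps_bil \<beta> (fps_const a) y) n = \<beta> a (fps_nth y n)" by simp
  have "fps_nth (fps_bil \<beta> x (fps_const b)) n = (\<Sum>i\<in>{n}. \<beta> (fps_nth x i) (fps_nth (fps_const b) (n - i)))"
    unfolding fps_bil_def fps_nth_Abs_fps by (rule sum.mono_neutral_right) (auto simp: 0)
  then show "fps_nth (fps_bil \<beta> x (fps_const b)) n = \<beta> (fps_nth x n) b" by simp
qed

lemma fps_bil_const_const: "biadditive \<beta> \<Longrightarrow> fps_bil \<beta> (fps_const a) (fps_const b) = fps_const (\<beta> a b)"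
  by (rule fps_ext) (simp add: fps_bil_const additive.zero[OF biadditive_additive(1)]
      additive.zero[OF biadditive_additive(2)[of \<beta>]])

lemma biadditive_fps_bil:
  assumes "biadditive \<beta>"
  shows "biadditive (fps_bil \<beta>)"
  using assms by (intro biadditiveI) (simp_all add: fps_eq_iff fps_bil_def biadditive_def sum.distrib)

lemma fps_map_nth [simp]: "fps_nth (fps_map f x) n = f (fps_nth x n)"
  by (simp add: fps_map_def)

lemma additive_fps_map: "Modules.additive f \<Longrightarrow> Modules.additive (fps_map f)"
  by (simp add: Modules.additive_def fps_eq_iff)

lemma fps_map_const [simp]: "Modules.additive f \<Longrightarrow> fps_map f (fps_const a) = fps_const (f a)"
  by (simp add: fps_eq_iff additive.zero)

section \<open>Linear maps over power series in \<open>t\<close>\<close>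

text \<open>Linearity over power series in explicit form: convolution with additive maps,
  \<open>\<psi> k\<close> giving the t^k part of the image of a constant. Each coefficient of the
  value depends on finitely many others, so such a map is determined by its values on
  constants.\<close>

definition tlin :: "('a::ab_group_add fps \<Rightarrow> 'b::ab_group_add fps) \<Rightarrow> bool" where
  "tlin \<Psi> \<longleftrightarrow> (\<exists>\<psi>. (\<forall>k. Modules.additive (\<psi> k)) \<and>
     (\<forall>x n. fps_nth (\<Psi> x) n = (\<Sum>i\<le>n. \<psi> (n - i) (fps_nth x i))))"

lemma sum_Kronecker_le: "(\<Sum>i\<le>n. if i = (k::nat) then f i else 0) = (if k \<le> n then f k else 0)"
  by (subst sum.delta) auto

lemma tlin_nth:
  assumes "tlin \<Psi>"
  shows "fps_nth (\<Psi> x) n = (\<Sum>i\<le>n. fps_nth (\<Psi> (fps_const (fps_nth x i))) (n - i))"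
proof -
  obtain \<psi> where add: "\<And>k. Modules.additive (\<psi> k)"
    and \<psi>: "\<And>x n. fps_nth (\<Psi> x) n = (\<Sum>i\<le>n. \<psi> (n - i) (fps_nth x i))"
    using assms unfolding tlin_def by blast
  have const: "fps_nth (\<Psi> (fps_const a)) k = \<psi> k a" for a k
  proof -
    have "(\<Sum>i\<le>k. \<psi> (k - i) (fps_nth (fps_const a) i)) = (\<Sum>i\<in>{0}. \<psi> (k - i) (fps_nth (fps_const a) i))"
      by (rule sum.mono_neutral_right) (auto simp: additive.zero[OF add])
    then show ?thesis by (simp add: \<psi>)
  qed
  show ?thesis unfolding const by (rule \<psi>)
qed

lemma tlin_additive: "tlin \<Psi> \<Longrightarrow> Modules.additive \<Psi>"
  unfolding tlin_def
  by (elim exE conjE) (simp add: Modules.additive_def fps_eq_iff sum.distrib)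

lemma tlin_eqI:
  assumes "tlin \<Psi>" "tlin \<Psi>'" "\<And>a. \<Psi> (fps_const a) = \<Psi>' (fps_const a)"
  shows "\<Psi> x = \<Psi>' x"
  by (rule fps_ext) (simp add: tlin_nth[OF assms(1), of x] tlin_nth[OF assms(2), of x] assms(3))

lemma tlin_const_additive: "tlin \<Psi> \<Longrightarrow> Modules.additive (\<lambda>a. \<Psi> (fps_const a))"
  using tlin_additive[of \<Psi>] unfolding Modules.additive_def by (metis fps_const_add)

lemma tlin_tensor_eqI:
  assumes "tlin \<Psi>" "tlin \<Psi>'" "\<And>a b. \<Psi> (fps_const (a \<otimes> b)) = \<Psi>' (fps_const (a \<otimes> b))"
  shows "\<Psi> x = \<Psi>' x"
proof (rule tlin_eqI[OF assms(1,2)])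
  note add = tlin_const_additive[OF assms(1)] tlin_const_additive[OF assms(2)]
  show "\<Psi> (fps_const z) = \<Psi>' (fps_const z)" for z
    by (rule additive_tensor_eqI[OF add assms(3)])
qed

lemma tlin_extend:
  assumes "Modules.additive \<delta>"
  shows "tlin (\<lambda>x. Abs_fps (\<lambda>N. \<Sum>n\<le>N. fps_nth (\<delta> (fps_nth x n)) (N - n)))"
  unfolding tlin_def
  by (rule exI[of _ "\<lambda>k a. fps_nth (\<delta> a) k"])
    (use assms in \<open>simp add: Modules.additive_def\<close>)

lemma tlin_fps_map: "Modules.additive f \<Longrightarrow> tlin (fps_map f)"
  unfolding tlin_def
proof (intro exI[of _ "\<lambda>k a. if k = 0 then f a else 0"] conjI allI)
  fix x :: "'a fps" and n
  have "(\<Sum>i\<le>n. if n - i = 0 then f (fps_nth x i) else 0) = (\<Sum>i\<le>n. if i = n then f (fps_nth x i) else 0)"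
    by (rule sum.cong) auto
  then show "fps_nth (fps_map f x) n = (\<Sum>i\<le>n. if n - i = 0 then f (fps_nth x i) else 0)"
    by (simp add: sum_Kronecker_le)
qed (auto simp: Modules.additive_def)

lemma tlin_bil_left:
  assumes "biadditive \<beta>"
  shows "tlin (\<lambda>x. fps_bil \<beta> x y)"
  unfolding tlin_def
  by (rule exI[of _ "\<lambda>k a. \<beta> a (fps_nth y k)"])
    (simp add: biadditive_additive[OF assms] fps_bil_def)

lemma tlin_bil_right:
  assumes "biadditive \<beta>"
  shows "tlin (fps_bil \<beta> x)"
  unfolding tlin_def
proof (intro exI[of _ "\<lambda>k a. \<beta> (fps_nth x k) a"] conjI allI)
  fix y :: "'b fps" and n
  show "fps_nth (fps_bil \<beta> x y) n = (\<Sum>i\<le>n. \<beta> (fps_nth x (n - i)) (fps_nth y i))"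
    unfolding fps_bil_def fps_nth_Abs_fps
    by (rule sum.reindex_bij_witness[of _ "\<lambda>i. n - i" "\<lambda>i. n - i"]) auto
qed (simp add: biadditive_additive[OF assms])

lemma tlin_comp:
  assumes "tlin \<Psi>" "tlin \<Psi>'"
  shows "tlin (\<lambda>x. \<Psi> (\<Psi>' x))"
proof -
  let ?p = "\<lambda>k a. fps_nth (\<Psi> (fps_const a)) k" and ?p' = "\<lambda>k a. fps_nth (\<Psi>' (fps_const a)) k"
  have add: "Modules.additive (?p k)" "Modules.additive (?p' k)" for k
    using tlin_const_additive[OF assms(1)] tlin_const_additive[OF assms(2)]
    by (simp_all add: Modules.additive_def)
  have "fps_nth (\<Psi> (\<Psi>' x)) n = (\<Sum>i\<le>n. \<Sum>j\<le>n - i. ?p (n - i - j) (?p' j (fps_nth x i)))" for x n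
  proof -
    have "fps_nth (\<Psi> (\<Psi>' x)) n = (\<Sum>j=0..n. \<Sum>i=0..j. ?p (n - j) (?p' (j - i) (fps_nth x i)))"
      by (simp add: tlin_nth[OF assms(1), of "\<Psi>' x"] tlin_nth[OF assms(2), of x] additive.sum[OF add(1)] atLeast0AtMost)
    also have "\<dots> = (\<Sum>j=0..n. \<Sum>i=0..n - j. ?p (n - j - i) (?p' i (fps_nth x j)))"
      by (rule fps_mult_assoc_lemma[of "\<lambda>i j k. ?p k (?p' j (fps_nth x i))"])
    finally show ?thesis by (simp add: atLeast0AtMost)
  qed
  moreover have "Modules.additive (\<lambda>a. \<Sum>j\<le>k. ?p (k - j) (?p' j a))" for k
    using additive_comp[OF add] by (simp add: Modules.additive_def sum.distrib)
  ultimately show ?thesis unfolding tlin_def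
    by (intro exI[of _ "\<lambda>k a. \<Sum>j\<le>k. ?p (k - j) (?p' j a)"]) auto
qed

lemma tlin_bil_comp_left: "biadditive \<beta> \<Longrightarrow> tlin \<Psi> \<Longrightarrow> tlin (\<lambda>x. fps_bil \<beta> (\<Psi> x) y)"
  by (rule tlin_comp[OF tlin_bil_left])

lemma tlin_bil_comp_right: "biadditive \<beta> \<Longrightarrow> tlin \<Psi> \<Longrightarrow> tlin (\<lambda>x. fps_bil \<beta> y (\<Psi> x))"
  by (rule tlin_comp[OF tlin_bil_right])

lemma tlin_zt_scale:
  assumes "tlin \<Psi>"
  shows "\<Psi> (zt_scale c x) = zt_scale c (\<Psi> x)"
proof -
  have "\<Psi> (fps_bil zmul c (fps_const a)) = fps_bil zmul c (\<Psi> (fps_const a))" for a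
  proof (rule fps_ext)
    fix n
    have "fps_nth (\<Psi> (fps_bil zmul c (fps_const a))) n
      = (\<Sum>i\<le>n. zmul (fps_nth c i) (fps_nth (\<Psi> (fps_const a)) (n - i)))"
      unfolding tlin_nth[OF assms, of "fps_bil zmul c (fps_const a)"]
    proof (rule sum.cong)
      fix i
      have "Modules.additive (\<lambda>a. fps_nth (\<Psi> (fps_const a)) (n - i))"
        using tlin_const_additive[OF assms] by (simp add: Modules.additive_def)
      from additive_zmul[OF this]
      show "fps_nth (\<Psi> (fps_const (fps_nth (fps_bil zmul c (fps_const a)) i))) (n - i) =
           zmul (fps_nth c i) (fps_nth (\<Psi> (fps_const a)) (n - i))"
        by (simp add: fps_bil_const[OF biadditive_zmul])
    qed simp
    then show "fps_nth (\<Psi> (fps_bil zmul c (fps_const a))) n = fps_nth (fps_bil zmul c (\<Psi> (fps_const a))) n"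
      by (simp add: fps_bil_def)
  qed
  from tlin_eqI[OF tlin_comp[OF assms tlin_bil_right[OF biadditive_zmul]]
      tlin_bil_comp_right[OF biadditive_zmul assms] this]
  show ?thesis unfolding zt_scale_bil .
qed

lemma tlin_zt_linear: "tlin \<Psi> \<Longrightarrow> zt_linear \<Psi>"
  unfolding zt_linear_def using tlin_zt_scale additive.add[OF tlin_additive] by blast

lemma ctensor_lift_tlin:
  assumes "biadditive (\<lambda>a b. \<Phi> (fps_const a) (fps_const b))"
  shows "tlin (ctensor_lift \<Phi>)"
  using tlin_extend[OF additive_tensor_lift[OF assms]] by (simp add: ctensor_lift_def [abs_def])

lemma ctensor_lift_const:
  assumes "biadditive (\<lambda>a b. \<Phi> (fps_const a) (fps_const b))"
  shows "ctensor_lift \<Phi> (fps_const (a \<otimes> b)) = \<Phi> (fps_const a) (fps_const b)"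
proof (rule fps_ext)
  fix N
  have "fps_nth (ctensor_lift \<Phi> (fps_const (a \<otimes> b))) N =
    (\<Sum>n\<in>{0}. fps_nth (tensor_lift (\<lambda>a b. \<Phi> (fps_const a) (fps_const b)) (fps_nth (fps_const (a \<otimes> b)) n)) (N - n))"
    unfolding ctensor_lift_def fps_nth_Abs_fps
    by (rule sum.mono_neutral_right) (auto simp: assms)
  then show "fps_nth (ctensor_lift \<Phi> (fps_const (a \<otimes> b))) N = fps_nth (\<Phi> (fps_const a) (fps_const b)) N"
    by (simp add: assms)
qed

text \<open>The infinite sum of the \<open>Y l\<close>, provided that \<open>Y l\<close> is
  divisible by t^l: terms with l > n then do not reach coefficient n. For other families the
  truncation has no such meaning.\<close>

definition fsum :: "(nat \<Rightarrow> 'a::comm_monoid_add fps) \<Rightarrow> 'a fps" where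
  "fsum Y = Abs_fps (\<lambda>n. \<Sum>l\<le>n. fps_nth (Y l) n)"

lemma fsum_nth:
  assumes "\<And>l i. i < l \<Longrightarrow> fps_nth (Y l) i = 0" "n \<le> N"
  shows "fps_nth (fsum Y) n = (\<Sum>l\<le>N. fps_nth (Y l) n)"
  unfolding fsum_def fps_nth_Abs_fps
  by (rule sum.mono_neutral_left) (use assms in auto)

lemma tlin_fsum:
  assumes "tlin \<Psi>" "\<And>l i. i < l \<Longrightarrow> fps_nth (Y l) i = 0"
  shows "\<Psi> (fsum Y) = fsum (\<lambda>l. \<Psi> (Y l))"
proof (rule fps_ext)
  fix n
  have add: "Modules.additive (\<lambda>a. fps_nth (\<Psi> (fps_const a)) k)" for k
    using tlin_const_additive[OF assms(1)] by (simp add: Modules.additive_def)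
  have "fps_nth (\<Psi> (fsum Y)) n = (\<Sum>i\<le>n. \<Sum>l\<le>n. fps_nth (\<Psi> (fps_const (fps_nth (Y l) i))) (n - i))"
    by (simp add: tlin_nth[OF assms(1), of "fsum Y"] fsum_nth[where N = n] assms(2) additive.sum[OF add])
  also have "\<dots> = (\<Sum>l\<le>n. \<Sum>i\<le>n. fps_nth (\<Psi> (fps_const (fps_nth (Y l) i))) (n - i))"
    by (rule sum.swap)
  also have "\<dots> = fps_nth (fsum (\<lambda>l. \<Psi> (Y l))) n"
    by (simp add: fsum_def tlin_nth[OF assms(1), of "Y _"])
  finally show "fps_nth (\<Psi> (fsum Y)) n = fps_nth (fsum (\<lambda>l. \<Psi> (Y l))) n" .
qed

section \<open>Extension of scalars to the rationals\<close>

definition rbil :: "('a::ab_group_add \<Rightarrow> 'b::ab_group_add \<Rightarrow> 'c::ab_group_add) \<Rightarrow> 'a ratl \<Rightarrow> 'b ratl \<Rightarrow> 'c ratl" where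
  "rbil \<beta> x y = tensor_lift (\<lambda>p a. tensor_lift (\<lambda>q b. (p * q) \<otimes> \<beta> a b) y) x"

lemma rbil_biadditive:
  fixes p :: rat
  assumes "biadditive \<beta>"
  shows "biadditive (\<lambda>q b. (p * q) \<otimes> \<beta> a b)" "biadditive (\<lambda>(p :: rat) a. tensor_lift (\<lambda>q b. (p * q) \<otimes> \<beta> a b) y)"
  using assms
  by (auto intro!: biadditiveI simp: biadditive_def distrib_left distrib_right tensor_add_left tensor_add_right
      tensor_lift_fun_add)

lemma rbil_pure [simp]: "biadditive \<beta> \<Longrightarrow> rbil \<beta> (p \<otimes> a) (q \<otimes> b) = (p * q) \<otimes> \<beta> a b"
  unfolding rbil_def
  by (subst tensor_lift_pure[OF rbil_biadditive(2)], assumption, rule tensor_lift_pure[OF rbil_biadditive(1)])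

lemma biadditive_rbil: "biadditive \<beta> \<Longrightarrow> biadditive (rbil \<beta>)"
  by (rule biadditiveI) (simp_all add: rbil_def rbil_biadditive tensor_lift_fun_add)

lemma times_ratl: "((*) :: 'a::{ring,monoid_mult} ratl \<Rightarrow> 'a ratl \<Rightarrow> 'a ratl) = rbil (*)"
  by (simp add: fun_eq_iff times_tensor_def rbil_def)

lemma additive_ratl_map: "Modules.additive f \<Longrightarrow> Modules.additive (tensor_map (id :: rat \<Rightarrow> rat) f)"
  by (simp add: additive_tensor_map)

lemma biadditive_tensor_eqI:
  assumes "biadditive f" "biadditive g" "\<And>a b c d. f (a \<otimes> b) (c \<otimes> d) = g (a \<otimes> b) (c \<otimes> d)"
  shows "f x y = g x y"
proof (rule additive_tensor_eqI[of "f x" "g x"])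
  show "f x (c \<otimes> d) = g x (c \<otimes> d)" for c d
    by (rule additive_tensor_eqI[of "\<lambda>x. f x (c \<otimes> d)" "\<lambda>x. g x (c \<otimes> d)"])
      (simp_all add: biadditive_additive[OF assms(1)] biadditive_additive[OF assms(2)] assms(3))
qed (simp_all add: biadditive_additive[OF assms(1)] biadditive_additive[OF assms(2)])

lemma rbil_assoc:
  assumes "\<And>a b c. \<beta>1 (\<beta>2 a b) c = \<beta>3 a (\<beta>4 b c)"
    and bi: "biadditive \<beta>1" "biadditive \<beta>2" "biadditive \<beta>3" "biadditive \<beta>4"
  shows "rbil \<beta>1 (rbil \<beta>2 x y) z = rbil \<beta>3 x (rbil \<beta>4 y z)"
proof (rule biadditive_tensor_eqI[of "\<lambda>x y. rbil \<beta>1 (rbil \<beta>2 x y) z" "\<lambda>x y. rbil \<beta>3 x (rbil \<beta>4 y z)"])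
  note add = bi[THEN biadditive_rbil, THEN biadditive_additive(1)]
  show "biadditive (\<lambda>x y. rbil \<beta>1 (rbil \<beta>2 x y) z)" "biadditive (\<lambda>x y. rbil \<beta>3 x (rbil \<beta>4 y z))"
    using bi[THEN biadditive_rbil] by (auto simp: biadditive_def)
  show "rbil \<beta>1 (rbil \<beta>2 (a \<otimes> b) (c \<otimes> d)) z = rbil \<beta>3 (a \<otimes> b) (rbil \<beta>4 (c \<otimes> d) z)" for a b c d
    by (rule additive_tensor_eqI[of "rbil \<beta>1 (rbil \<beta>2 (a \<otimes> b) (c \<otimes> d))" "\<lambda>z. rbil \<beta>3 (a \<otimes> b) (rbil \<beta>4 (c \<otimes> d) z)"])
      (simp_all add: add additive_comp[OF add(3) add(4)] bi assms(1) mult.assoc)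
qed

abbreviation rprod :: "('a::ab_group_add \<Rightarrow> 'b::ab_group_add \<Rightarrow> 'c::ab_group_add) \<Rightarrow>
   'a ratl fps \<Rightarrow> 'b ratl fps \<Rightarrow> 'c ratl fps" where
  "rprod \<beta> \<equiv> fps_bil (rbil \<beta>)"

lemma times_rprod: "((*) :: 'a::{ring,monoid_mult} ratl fps \<Rightarrow> 'a ratl fps \<Rightarrow> 'a ratl fps) = rprod (*)"
  by (simp add: fps_times_bil times_ratl)

lemma rprod_assoc:
  assumes "\<And>a b c. \<beta>1 (\<beta>2 a b) c = \<beta>3 a (\<beta>4 b c)"
    and "biadditive \<beta>1" "biadditive \<beta>2" "biadditive \<beta>3" "biadditive \<beta>4"
  shows "rprod \<beta>1 (rprod \<beta>2 x y) z = rprod \<beta>3 x (rprod \<beta>4 y z)"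
  by (rule fps_bil_assoc)
    (rule rbil_assoc[OF assms] biadditive_additive(2)[OF biadditive_rbil[OF assms(2)]]
      biadditive_additive(1)[OF biadditive_rbil[OF assms(4)]])+

lemma map_ratl_rprod:
  assumes "Modules.additive f" "Modules.additive g" "Modules.additive h" "biadditive \<beta>" "biadditive \<beta>'"
    and "\<And>a b. f (\<beta> a b) = \<beta>' (g a) (h b)"
  shows "map_ratl f (rprod \<beta> x y) = rprod \<beta>' (map_ratl g x) (map_ratl h y)"
  unfolding map_ratl_def
proof (rule fps_map_bil)
  note add = assms(1-3)[THEN additive_ratl_map]
  note bi = assms(4,5)[THEN biadditive_rbil]
  show "tensor_map id f (rbil \<beta> x y) = rbil \<beta>' (tensor_map id g x) (tensor_map id h y)" for x y
  proof (rule biadditive_tensor_eqI[OF _ biadditive_comp[OF bi(2) add(2,3)]])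
    show "biadditive (\<lambda>x y. tensor_map id f (rbil \<beta> x y))"
      using add(1) bi(1) by (simp add: biadditive_def Modules.additive_def)
  qed (simp add: assms)
qed (rule additive_ratl_map[OF assms(1)])

lemma to_ratl_rprod:
  assumes "biadditive \<beta>"
  shows "to_ratl (fps_bil \<beta> x y) = rprod \<beta> (to_ratl x) (to_ratl y)"
  unfolding to_ratl_def
  by (rule fps_map_bil) (simp_all add: assms biadditive_additive(1)[OF biadditive_tensor])

lemma additive_one_tensor: "Modules.additive (\<lambda>x. 1 \<otimes> x)"
  by (rule biadditive_additive(1)[OF biadditive_tensor])

lemma to_ratl_mult: "to_ratl (x * y) = to_ratl x * to_ratl (y :: 'a::{ring,monoid_mult} fps)"
  unfolding fps_times_bil[where 'a = 'a] times_rprod by (rule to_ratl_rprod[OF biadditive_times])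

lemma tlin_to_ratl: "tlin to_ratl"
  unfolding to_ratl_def by (rule tlin_fps_map) (rule additive_one_tensor)

lemma tlin_map_ratl: "Modules.additive f \<Longrightarrow> tlin (map_ratl f)"
  unfolding map_ratl_def by (intro tlin_fps_map additive_ratl_map)

lemma map_ratl_to_ratl: "Modules.additive f \<Longrightarrow> map_ratl f (to_ratl x) = to_ratl (fps_map f x)"
  by (simp add: fps_eq_iff map_ratl_def to_ratl_def)

lemma map_ratl_comp:
  assumes "Modules.additive f" "Modules.additive g"
  shows "map_ratl f (map_ratl g x) = map_ratl (\<lambda>a. f (g a)) x"
proof (rule fps_ext)
  note add = additive_ratl_map[OF assms(1)] additive_ratl_map[OF assms(2)]
    additive_ratl_map[OF additive_comp[OF assms]]
  show "fps_nth (map_ratl f (map_ratl g x)) n = fps_nth (map_ratl (\<lambda>a. f (g a)) x) n" for n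
    unfolding map_ratl_def fps_map_nth
    by (rule additive_tensor_eqI[OF additive_comp[OF add(1,2)] add(3)])
      (simp add: assms additive_comp[OF assms])
qed

lemma map_ratl_mult:
  assumes "Modules.additive f" "\<And>a b. f (a * b) = f a * f b"
  shows "map_ratl f (x * y) = map_ratl f x * map_ratl f y"
  unfolding times_rprod by (intro map_ratl_rprod assms biadditive_times)

lemma to_ratl_const: "to_ratl (fps_const a) = fps_const (1 \<otimes> a)"
  by (simp add: to_ratl_def additive_one_tensor)

lemma one_ratl: "(1 :: 'a::{ring,monoid_mult} ratl fps) = to_ratl (fps_const 1)"
  unfolding to_ratl_const by (simp add: one_tensor_def fps_eq_iff)

lemma map_ratl_one: "Modules.additive f \<Longrightarrow> f 1 = 1 \<Longrightarrow> map_ratl f 1 = 1"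
  unfolding one_ratl by (simp only: map_ratl_to_ratl fps_map_const)

lemma to_ratl_inj: "ratl_inj TYPE('a::ab_group_add) \<Longrightarrow> to_ratl x = to_ratl y \<Longrightarrow> x = (y :: 'a fps)"
  by (rule fps_ext) (auto simp: to_ratl_def fps_eq_iff ratl_inj_def dest: injD)

lemma rprod_const_right:
  assumes "biadditive \<beta>"
  shows "rprod \<beta> x (to_ratl (fps_const b)) = map_ratl (\<lambda>a. \<beta> a b) x"
proof (rule fps_ext)
  note add = biadditive_additive(2)[OF assms]
  show "fps_nth (rprod \<beta> x (to_ratl (fps_const b))) n = fps_nth (map_ratl (\<lambda>a. \<beta> a b) x) n" for n
    unfolding to_ratl_const fps_bil_const[OF biadditive_rbil[OF assms]] map_ratl_def fps_map_nth
    by (rule additive_tensor_eqI[OF biadditive_additive(2)[OF biadditive_rbil[OF assms]] additive_ratl_map[OF add]])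
      (simp add: assms add)
qed

lemma rprod_const_left:
  assumes "biadditive \<beta>"
  shows "rprod \<beta> (to_ratl (fps_const a)) y = map_ratl (\<beta> a) y"
proof (rule fps_ext)
  note add = biadditive_additive(1)[OF assms]
  show "fps_nth (rprod \<beta> (to_ratl (fps_const a)) y) n = fps_nth (map_ratl (\<beta> a) y) n" for n
    unfolding to_ratl_const fps_bil_const[OF biadditive_rbil[OF assms]] map_ratl_def fps_map_nth
    by (rule additive_tensor_eqI[OF biadditive_additive(1)[OF biadditive_rbil[OF assms]] additive_ratl_map[OF add]])
      (simp add: assms add)
qed

lemma ring_inv_eqI:
  fixes F G :: "'a::{ring,monoid_mult} fps"
  assumes "F * G = 1" "G * F = 1"
  shows "ring_inv F = G"
  unfolding ring_inv_def
proof (rule the_equality)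
  show "v = G" if "F * v = 1 \<and> v * F = 1" for v
    using assms that by (metis fps_one_mult mult.assoc)
qed (use assms in simp)

text \<open>
  Products of exponential generating functions are binomial convolutions, so identities between
  them reduce to identities over the integers.
\<close>

definition egf :: "(nat \<Rightarrow> 'a::ab_group_add) \<Rightarrow> 'a ratl fps" where
  "egf u = Abs_fps (\<lambda>n. (1 / fact n) \<otimes> u n)"

lemma zmul_rat: "zmul n (q :: rat) = of_int n * q"
  by (rule zmul_of_int)

lemma rprod_egf:
  assumes "biadditive \<beta>"
  shows "rprod \<beta> (egf u) (egf v) = egf (\<lambda>n. \<Sum>i\<le>n. zmul (int (n choose i)) (\<beta> (u i) (v (n - i))))"
proof (rule fps_ext)
  fix n
  have "fps_nth (rprod \<beta> (egf u) (egf v)) n = (\<Sum>i\<le>n. (1 / (fact i * fact (n - i))) \<otimes> \<beta> (u i) (v (n - i)))"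
    by (simp add: fps_bil_def egf_def assms)
  also have "\<dots> = (\<Sum>i\<le>n. (1 / fact n) \<otimes> zmul (int (n choose i)) (\<beta> (u i) (v (n - i))))"
  proof (rule sum.cong)
    fix i assume "i \<in> {..n}"
    then have "(1::rat) / (fact i * fact (n - i)) = zmul (int (n choose i)) (1 / fact n)"
      by (simp add: zmul_rat binomial_fact field_simps)
    then show "(1 / (fact i * fact (n - i)) :: rat) \<otimes> \<beta> (u i) (v (n - i)) =
         (1 / fact n) \<otimes> zmul (int (n choose i)) (\<beta> (u i) (v (n - i)))"
      by (simp only: tensor_zmul)
  qed simp
  also have "\<dots> = fps_nth (egf (\<lambda>n. \<Sum>i\<le>n. zmul (int (n choose i)) (\<beta> (u i) (v (n - i))))) n"
    by (simp add: egf_def tensor_sum_pure)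
  finally show "fps_nth (rprod \<beta> (egf u) (egf v)) n
    = fps_nth (egf (\<lambda>n. \<Sum>i\<le>n. zmul (int (n choose i)) (\<beta> (u i) (v (n - i))))) n" .
qed

lemma map_ratl_egf: "Modules.additive f \<Longrightarrow> map_ratl f (egf u) = egf (\<lambda>n. f (u n))"
  by (simp add: fps_eq_iff map_ratl_def egf_def)

lemma egf_times:
  fixes u v :: "nat \<Rightarrow> 'a::{ring,monoid_mult}"
  shows "egf u * egf v = egf (\<lambda>n. \<Sum>i\<le>n. zmul (int (n choose i)) (u i * v (n - i)))"
  unfolding times_rprod by (rule rprod_egf[OF biadditive_times])

section \<open>Ring homomorphisms and the undeformed Hopf structure\<close>

definition ring_map :: "('a::{ring,monoid_mult} \<Rightarrow> 'b::{ring,monoid_mult}) \<Rightarrow> bool" where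
  "ring_map f \<longleftrightarrow> Modules.additive f \<and> (\<forall>x y. f (x * y) = f x * f y) \<and> f 1 = 1"

lemma ring_mapD:
  assumes "ring_map f"
  shows "Modules.additive f" "f (x * y) = f x * f y" "f 1 = 1"
  using assms by (simp_all add: ring_map_def)

lemma ring_map_comp: "ring_map f \<Longrightarrow> ring_map g \<Longrightarrow> ring_map (\<lambda>x. f (g x))"
  by (simp add: ring_map_def Modules.additive_def)

lemma ring_map_uea_eqI:
  assumes "ring_map f" "ring_map g" "\<And>x. f (uea_of x) = g (uea_of x)"
  shows "f u = g u"
  by (induction u rule: uea_induct)
    (simp_all add: assms(3) ring_mapD(2,3)[OF assms(1)] ring_mapD(2,3)[OF assms(2)]
      additive.zero[OF ring_mapD(1)[OF assms(1)]] additive.zero[OF ring_mapD(1)[OF assms(2)]]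
      additive.diff[OF ring_mapD(1)[OF assms(1)]] additive.diff[OF ring_mapD(1)[OF assms(2)]])

lemma ring_map_id: "ring_map id" "ring_map (\<lambda>x. x)"
  by (simp_all add: ring_map_def)

lemma ring_mapI_tensor:
  assumes "Modules.additive f" "\<And>a b c d. f ((a \<otimes> b) * (c \<otimes> d)) = f (a \<otimes> b) * f (c \<otimes> d)" "f (1 \<otimes> 1) = 1"
  shows "ring_map f"
  unfolding ring_map_def
proof (intro conjI allI)
  show "f (x * y) = f x * f y" for x y
  proof (rule biadditive_tensor_eqI[where f = "\<lambda>x y. f (x * y)"])
    show "biadditive (\<lambda>x y. f (x * y))"
      using assms(1) by (simp add: biadditive_def Modules.additive_def distrib_left distrib_right)
    show "biadditive (\<lambda>x y. f x * f y)"
      by (rule biadditive_comp[OF biadditive_times assms(1) assms(1)])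
  qed (rule assms(2))
qed (use assms in \<open>simp_all add: one_tensor_def\<close>)

lemma ring_map_tensor_map:
  assumes "ring_map f" "ring_map g"
  shows "ring_map (tensor_map f g)"
  using assms unfolding ring_map_def
  by (intro ring_mapI_tensor[unfolded ring_map_def] additive_tensor_map)
    (simp_all add: tensor_mult_pure one_tensor_def)

lemma tensor_assoc_additive:
    "Modules.additive (tensor_assoc :: (('a::ab_group_add, 'b::ab_group_add) tensor, 'c::ab_group_add) tensor \<Rightarrow> _)"
  and tensor_assoc_pure [simp]: "tensor_assoc ((a \<otimes> b) \<otimes> c) = (a :: 'a) \<otimes> ((b :: 'b) \<otimes> (c :: 'c))"
proof -
  have bi: "biadditive (\<lambda>(a::'a) (b::'b). a \<otimes> (b \<otimes> c))" for c :: 'c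
    by (rule biadditiveI) (simp_all add: tensor_add_left tensor_add_right)
  have bi2: "biadditive (\<lambda>x (c::'c). tensor_lift (\<lambda>(a::'a) (b::'b). a \<otimes> (b \<otimes> c)) x)"
    by (rule biadditiveI) (simp_all add: tensor_add_left tensor_add_right bi tensor_lift_fun_add)
  show "Modules.additive (tensor_assoc :: (('a, 'b) tensor, 'c) tensor \<Rightarrow> _)"
    unfolding tensor_assoc_def by (rule additive_tensor_lift[OF bi2])
  show "tensor_assoc ((a \<otimes> b) \<otimes> c) = a \<otimes> (b \<otimes> c)"
    unfolding tensor_assoc_def by (subst tensor_lift_pure[OF bi2]) (rule tensor_lift_pure[OF bi])
qed

lemma ring_map_assoc: "ring_map tensor_assoc"
proof (rule ring_mapI_tensor)
  fix x y :: "('a, 'b) tensor" and c d :: 'c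
  note add = tensor_assoc_additive
  have bi: "biadditive (\<lambda>x y. tensor_assoc ((x * y) \<otimes> (c * d)))"
    "biadditive (\<lambda>x y. tensor_assoc (x \<otimes> c) * tensor_assoc (y \<otimes> d))"
    by (rule biadditiveI; simp add: distrib_left distrib_right tensor_add_left additive.add[OF add])+
  have "tensor_assoc ((x * y) \<otimes> (c * d)) = tensor_assoc (x \<otimes> c) * tensor_assoc (y \<otimes> d)"
    by (rule biadditive_tensor_eqI[OF bi]) (simp add: tensor_mult_pure)
  then show "tensor_assoc ((x \<otimes> c) * (y \<otimes> d)) = tensor_assoc (x \<otimes> c) * tensor_assoc (y \<otimes> d)"
    by (simp add: tensor_mult_pure)
qed (simp_all add: tensor_assoc_additive one_tensor_def)

lemma ring_map_tensor_one: "ring_map (\<lambda>x. x \<otimes> 1)" "ring_map (\<lambda>x. 1 \<otimes> x)"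
  by (simp_all add: ring_map_def Modules.additive_def tensor_add_left tensor_add_right tensor_mult_pure one_tensor_def)

lemma ring_map_Delta0: "ring_map Delta0"
  by (simp add: ring_map_def Modules.additive_def Delta0_simps)

lemma additive_S0: "Modules.additive S0"
  by (simp add: Modules.additive_def S0_simps)

lemma additive_eps0: "Modules.additive eps0"
  by (simp add: Modules.additive_def eps0_simps)

definition counit_left :: "('g::lie_ring uea, 'g uea) tensor \<Rightarrow> 'g uea" where
  "counit_left = tensor_lift (\<lambda>a b. of_int (eps0 a) * b)"

definition counit_right :: "('g::lie_ring uea, 'g uea) tensor \<Rightarrow> 'g uea" where
  "counit_right = tensor_lift (\<lambda>a b. a * of_int (eps0 b))"

lemma counit_pure [simp]:
  "counit_left (a \<otimes> b) = of_int (eps0 a) * b" "counit_right (a \<otimes> b) = a * of_int (eps0 b)"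
  and ring_map_counit: "ring_map (counit_left :: ('g::lie_ring uea, 'g uea) tensor \<Rightarrow> _)"
    "ring_map (counit_right :: ('g::lie_ring uea, 'g uea) tensor \<Rightarrow> _)"
proof -
  have bi: "biadditive (\<lambda>a b :: 'g uea. of_int (eps0 (a :: 'g uea)) * b)"
    "biadditive (\<lambda>a b. a * of_int (eps0 (b :: 'g uea)) :: 'g uea)"
    by (rule biadditiveI; simp add: eps0_simps distrib_left distrib_right)+
  have pure: "counit_left (a \<otimes> b) = of_int (eps0 a) * b" "counit_right (a \<otimes> b) = a * of_int (eps0 b)"
    for a b :: "'g uea"
    unfolding counit_left_def counit_right_def by (rule tensor_lift_pure[OF bi(1)] tensor_lift_pure[OF bi(2)])+
  have comm: "of_int n * a = a * of_int n" for n and a :: "'g uea" by (rule mult_of_int_commute)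
  show "ring_map (counit_left :: ('g::lie_ring uea, 'g uea) tensor \<Rightarrow> _)"
  proof (rule ring_mapI_tensor)
    show "counit_left ((a \<otimes> b) * (c \<otimes> d)) = counit_left (a \<otimes> b) * counit_left (c \<otimes> d)" for a b c d :: "'g uea"
      unfolding tensor_mult_pure pure eps0_simps of_int_mult mult.assoc
      by (simp only: mult.assoc[symmetric] comm[of _ b])
    show "Modules.additive (counit_left :: ('g uea, 'g uea) tensor \<Rightarrow> _)"
      unfolding counit_left_def by (rule additive_tensor_lift[OF bi(1)])
  qed (simp add: pure eps0_simps)
  show "ring_map (counit_right :: ('g::lie_ring uea, 'g uea) tensor \<Rightarrow> _)"
  proof (rule ring_mapI_tensor)
    show "counit_right ((a \<otimes> b) * (c \<otimes> d)) = counit_right (a \<otimes> b) * counit_right (c \<otimes> d)" for a b c d :: "'g uea"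
      unfolding tensor_mult_pure pure eps0_simps of_int_mult mult.assoc
      by (simp only: mult.assoc[symmetric] comm[of "eps0 b" c])
    show "Modules.additive (counit_right :: ('g uea, 'g uea) tensor \<Rightarrow> _)"
      unfolding counit_right_def by (rule additive_tensor_lift[OF bi(2)])
  qed (simp add: pure eps0_simps)
  show "counit_left (a \<otimes> b) = of_int (eps0 a) * b" "counit_right (a \<otimes> b) = a * of_int (eps0 b)"
    for a b :: "'a uea"
    unfolding counit_left_def counit_right_def
    by (rule tensor_lift_pure, rule biadditiveI; simp add: eps0_simps distrib_left distrib_right)+
qed

lemma counit_Delta0: "counit_left (Delta0 u) = u" "counit_right (Delta0 u) = u"
proof -
  show "counit_left (Delta0 u) = u"
    by (rule ring_map_uea_eqI[OF ring_map_comp[OF ring_map_counit(1) ring_map_Delta0] ring_map_id(2)])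
      (simp add: Delta0_simps additive.add[OF ring_mapD(1)[OF ring_map_counit(1)]] eps0_simps)
  show "counit_right (Delta0 u) = u"
    by (rule ring_map_uea_eqI[OF ring_map_comp[OF ring_map_counit(2) ring_map_Delta0] ring_map_id(2)])
      (simp add: Delta0_simps additive.add[OF ring_mapD(1)[OF ring_map_counit(2)]] eps0_simps)
qed

text \<open>The cocycle identity compares elements of a triple tensor product, which is always
  bracketed to the right; hence \<open>tensor_assoc\<close> here and in
  \<open>Delta_id\<close>.\<close>

definition emb12 :: "('g::lie_ring uea, 'g uea) tensor \<Rightarrow> ('g uea, ('g uea, 'g uea) tensor) tensor" where
  "emb12 x = tensor_assoc (x \<otimes> 1)"

definition emb23 :: "('g::lie_ring uea, 'g uea) tensor \<Rightarrow> ('g uea, ('g uea, 'g uea) tensor) tensor" where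
  "emb23 x = 1 \<otimes> x"

definition Delta_id :: "('g::lie_ring uea, 'g uea) tensor \<Rightarrow> ('g uea, ('g uea, 'g uea) tensor) tensor" where
  "Delta_id x = tensor_assoc (tensor_map Delta0 id x)"

definition id_Delta :: "('g::lie_ring uea, 'g uea) tensor \<Rightarrow> ('g uea, ('g uea, 'g uea) tensor) tensor" where
  "id_Delta x = tensor_map id Delta0 x"

lemma ring_map_emb: "ring_map emb12" "ring_map emb23" "ring_map Delta_id" "ring_map id_Delta"
proof -
  show "ring_map emb12"
    using ring_map_comp[OF ring_map_assoc ring_map_tensor_one(1)] by (simp add: emb12_def[abs_def])
  show "ring_map emb23"
    using ring_map_tensor_one(2) by (simp add: emb23_def[abs_def])
  show "ring_map Delta_id"
    using ring_map_comp[OF ring_map_assoc ring_map_tensor_map[OF ring_map_Delta0 ring_map_id(1)]]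
    by (simp add: Delta_id_def[abs_def])
  show "ring_map id_Delta"
    using ring_map_tensor_map[OF ring_map_id(1) ring_map_Delta0] by (simp add: id_Delta_def[abs_def])
qed

lemmas additive_emb = ring_map_emb[THEN ring_mapD(1)]

lemma Delta0_coassoc: "Delta_id (Delta0 u) = id_Delta (Delta0 u)"
proof (rule ring_map_uea_eqI[OF ring_map_comp[OF ring_map_emb(3) ring_map_Delta0]
    ring_map_comp[OF ring_map_emb(4) ring_map_Delta0]])
  fix x :: 'a
  note add = ring_mapD(1)[OF ring_map_Delta0] additive_id(1)
  have "Delta_id (uea_of x \<otimes> 1 + 1 \<otimes> uea_of x) =
    tensor_assoc ((uea_of x \<otimes> 1 + 1 \<otimes> uea_of x) \<otimes> 1) + tensor_assoc ((1 \<otimes> 1) \<otimes> uea_of x)"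
    unfolding Delta_id_def
    by (simp only: additive.add[OF additive_tensor_map[OF add]] tensor_map_pure[OF add] Delta0_simps
        additive.add[OF tensor_assoc_additive] id_apply one_tensor_def)
  moreover have "id_Delta (uea_of x \<otimes> 1 + 1 \<otimes> uea_of x) =
    uea_of x \<otimes> (1 \<otimes> 1) + 1 \<otimes> (uea_of x \<otimes> 1 + 1 \<otimes> uea_of x)"
    unfolding id_Delta_def
    by (simp only: additive.add[OF additive_tensor_map[OF add(2,1)]] tensor_map_pure[OF add(2,1)] Delta0_simps
        id_apply one_tensor_def)
  ultimately show "Delta_id (Delta0 (uea_of x)) = id_Delta (Delta0 (uea_of x))"
    by (simp add: Delta0_simps tensor_add_left tensor_add_right additive.add[OF tensor_assoc_additive] add.assoc)
qed

text \<open>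
  \<open>U \<otimes> U\<close> acts on \<open>U\<close> from the left by \<open>(a \<otimes> b) \<triangleright> p = a p S\<^sub>0(b)\<close> and from the right by
  \<open>p \<triangleleft> (a \<otimes> b) = S\<^sub>0(a) p b\<close>. For a twist \<open>F\<close> one has \<open>w = F \<triangleright> 1\<close> and \<open>w\<^sup>-\<^sup>1 = 1 \<triangleleft> F\<^sup>-\<^sup>1\<close>,
  and the antipode axioms become associativity of these actions.
\<close>

definition lact :: "('g::lie_ring uea, 'g uea) tensor \<Rightarrow> 'g uea \<Rightarrow> 'g uea" where
  "lact y p = tensor_lift (\<lambda>a b. a * p * S0 b) y"

definition ract :: "'g::lie_ring uea \<Rightarrow> ('g uea, 'g uea) tensor \<Rightarrow> 'g uea" where
  "ract p y = tensor_lift (\<lambda>a b. S0 a * p * b) y"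

lemma act_biadd: "biadditive (\<lambda>a b. a * p * S0 b)" "biadditive (\<lambda>a b. S0 a * p * b)" for p :: "'g::lie_ring uea"
  by (rule biadditiveI; simp add: S0_simps distrib_left distrib_right)+

lemma act_pure [simp]: "lact (a \<otimes> b) p = a * p * S0 b" "ract p (a \<otimes> b) = S0 a * p * b"
  by (simp_all add: lact_def ract_def act_biadd)

lemma biadditive_act: "biadditive lact" "biadditive ract"
  by (rule biadditiveI; simp add: lact_def ract_def act_biadd distrib_left distrib_right tensor_lift_fun_add)+

lemma act_add:
  "lact (x + y) p = lact x p + lact y p" "lact x (p + q) = lact x p + lact x q"
  "ract p (x + y) = ract p x + ract p y" "ract (p + q) x = ract p x + ract q x"
  using biadditive_act unfolding biadditive_def by blast+

lemma lact_mult: "lact (x * y) p = lact x (lact y p)"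
proof (rule biadditive_tensor_eqI[where f = "\<lambda>x y. lact (x * y) p"])
  show "biadditive (\<lambda>x y. lact (x * y) p)" "biadditive (\<lambda>x y. lact x (lact y p))"
    by (simp_all add: biadditive_def act_add distrib_left distrib_right)
qed (simp add: tensor_mult_pure S0_simps mult.assoc)

lemma ract_mult: "ract p (x * y) = ract (ract p x) y"
proof (rule biadditive_tensor_eqI[where f = "\<lambda>x y. ract p (x * y)"])
  show "biadditive (\<lambda>x y. ract p (x * y))" "biadditive (\<lambda>x y. ract (ract p x) y)"
    by (simp_all add: biadditive_def act_add distrib_left distrib_right)
qed (simp add: tensor_mult_pure S0_simps mult.assoc)

lemma act_of_int: "lact y (of_int n) = lact y 1 * of_int n" "ract (of_int n) y = of_int n * ract 1 y"
proof -
  note add = biadditive_additive(2)[OF biadditive_act(1)] biadditive_additive(1)[OF biadditive_act(2)]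
  have 1: "Modules.additive (\<lambda>y. lact y 1 * of_int n)" "Modules.additive (\<lambda>y. of_int n * ract 1 y)"
    by (simp_all add: Modules.additive_def act_add distrib_left distrib_right)
  show "lact y (of_int n) = lact y 1 * of_int n"
    by (rule additive_tensor_eqI[OF add(1) 1(1)]) (simp add: mult.assoc mult_of_int_commute)
  show "ract (of_int n) y = of_int n * ract 1 y"
    by (rule additive_tensor_eqI[OF add(2) 1(2)])
      (simp add: mult_of_int_commute[of n "S0 _"] flip: mult.assoc)
qed

text \<open>These are the antipode laws of the undeformed structure. They hold on generators by
  cancellation and extend to products because the inner action leaves an integer, which passes
  through the outer one by \<open>act_of_int\<close>.\<close>

lemma act_Delta0: "lact (Delta0 u) 1 = of_int (eps0 u)" "ract 1 (Delta0 u) = of_int (eps0 u)"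
proof -
  note add = ring_mapD(1)[OF ring_map_Delta0]
  note add' = biadditive_additive(2)[OF biadditive_act(1)] biadditive_additive(1)[OF biadditive_act(2)]
  note l = additive.diff[OF add] additive.zero[OF add] additive.diff[OF additive_eps0] additive.zero[OF additive_eps0]
    additive.diff[OF add'(1)] additive.diff[OF add'(2)] additive.zero[OF add'(1)] additive.zero[OF add'(2)]
    additive.add[OF add'(1)] additive.add[OF add'(2)]
  show "lact (Delta0 u) 1 = of_int (eps0 u)"
    by (induction u rule: uea_induct)
      (simp_all add: Delta0_simps S0_simps eps0_simps l lact_mult act_of_int, simp_all add: one_tensor_def S0_simps)
  show "ract 1 (Delta0 u) = of_int (eps0 u)"
    by (induction u rule: uea_induct)
      (simp_all add: Delta0_simps S0_simps eps0_simps l ract_mult act_of_int, simp_all add: one_tensor_def S0_simps)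
qed

lemma rprod_act_mult:
  "rprod ract p (x * y) = rprod ract (rprod ract p x) y" "rprod lact (x * y) p = rprod lact x (rprod lact y p)"
  for p :: "'g::lie_ring uea ratl fps"
  unfolding times_rprod
  by (rule rprod_assoc[symmetric], simp_all add: biadditive_act biadditive_times ract_mult)
    (rule rprod_assoc, simp_all add: biadditive_act biadditive_times lact_mult)

lemma rprod_act_one: "rprod lact x 1 = map_ratl (\<lambda>y. lact y 1) x" "rprod ract 1 x = map_ratl (ract 1) x"
  unfolding one_ratl
  by (rule rprod_const_right[OF biadditive_act(1)] rprod_const_left[OF biadditive_act(2)])+

lemma act_one_one: "lact 1 1 = (1 :: 'g::lie_ring uea)" "ract 1 1 = (1 :: 'g uea)"
  by (simp_all only: one_tensor_def act_pure S0_simps mult_1)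

section \<open>Integral power series\<close>

lemma additive_to_ratl: "Modules.additive to_ratl"
  by (rule tlin_additive[OF tlin_to_ratl])

lemma to_ratl_one: "to_ratl 1 = (1 :: 'a::{ring,monoid_mult} ratl fps)"
  by (subst one_ratl) simp

lemma to_ratl_const_mult:
  fixes x :: "'a::{ring,monoid_mult} ratl fps"
  shows "to_ratl (fps_const c) * x = map_ratl ((*) c) x" "x * to_ratl (fps_const c) = map_ratl (\<lambda>a. a * c) x"
  unfolding times_rprod
  by (rule rprod_const_left[OF biadditive_times] rprod_const_right[OF biadditive_times])+

lemma tlin_mult:
  fixes a :: "'b::{ring,monoid_mult} ratl fps"
  assumes "tlin \<Psi>"
  shows "tlin (\<lambda>x. a * \<Psi> x)" "tlin (\<lambda>x. \<Psi> x * a)"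
  unfolding times_rprod
  using assms
  by (auto intro!: tlin_bil_comp_left[where \<Psi> = \<Psi>] tlin_bil_comp_right[where \<Psi> = \<Psi>]
      biadditive_rbil[OF biadditive_times])

lemma integral_zero: "0 \<in> range to_ratl"
  by (rule range_eqI[of _ _ 0]) (simp add: additive.zero[OF additive_to_ratl])

lemma integral_diff: "x \<in> range to_ratl \<Longrightarrow> y \<in> range to_ratl \<Longrightarrow> x - y \<in> range to_ratl"
  by (auto simp: image_iff simp flip: additive.diff[OF additive_to_ratl])

lemma integral_add: "x \<in> range to_ratl \<Longrightarrow> y \<in> range to_ratl \<Longrightarrow> x + y \<in> range to_ratl"
  by (auto simp: image_iff simp flip: additive.add[OF additive_to_ratl])

lemma integral_minus: "x \<in> range to_ratl \<Longrightarrow> - x \<in> range to_ratl"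
  using integral_diff[OF integral_zero, of x] by simp

lemma integral_mult:
  "x \<in> range to_ratl \<Longrightarrow> y \<in> range to_ratl \<Longrightarrow> x * y \<in> range (to_ratl :: 'a::{ring,monoid_mult} fps \<Rightarrow> _)"
  by (auto simp: image_iff simp flip: to_ratl_mult)

text \<open>Choose integral preimages of the values at constants. Injectivity of the rationalization
  makes the choice additive, and linearity in t determines the rest.\<close>

lemma integral_extension:
  fixes \<Psi> :: "'a::ab_group_add fps \<Rightarrow> 'b::ab_group_add ratl fps"
  assumes "tlin \<Psi>" "\<And>u. \<Psi> (fps_const u) \<in> range to_ratl" "ratl_inj TYPE('b)"
  shows "\<exists>D. tlin D \<and> (\<forall>x. to_ratl (D x) = \<Psi> x)"
proof -
  obtain \<delta> where \<delta>: "\<And>u. to_ratl (\<delta> u) = \<Psi> (fps_const u)" using assms(2) unfolding image_iff by metis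
  have add: "Modules.additive \<delta>"
    unfolding Modules.additive_def
  proof (intro allI to_ratl_inj[OF assms(3)])
    show "to_ratl (\<delta> (u + v)) = to_ratl (\<delta> u + \<delta> v)" for u v
      by (simp add: \<delta> additive.add[OF tlin_const_additive[OF assms(1)]] additive.add[OF additive_to_ratl])
  qed
  define D where "D x = Abs_fps (\<lambda>N. \<Sum>n\<le>N. fps_nth (\<delta> (fps_nth x n)) (N - n))" for x
  have tlin: "tlin D" unfolding D_def[abs_def] by (rule tlin_extend[OF add])
  have D: "D (fps_const u) = \<delta> u" for u
  proof (rule fps_ext)
    fix N
    have "fps_nth (D (fps_const u)) N = (\<Sum>n\<in>{0}. fps_nth (\<delta> (fps_nth (fps_const u) n)) (N - n))"
      unfolding D_def fps_nth_Abs_fps by (rule sum.mono_neutral_right) (auto simp: additive.zero[OF add])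
    then show "fps_nth (D (fps_const u)) N = fps_nth (\<delta> u) N" by simp
  qed
  have "to_ratl (D x) = \<Psi> x" for x
    by (rule tlin_eqI[OF tlin_comp[OF tlin_to_ratl tlin] assms(1)]) (simp add: D \<delta>)
  with tlin show ?thesis by blast
qed

text \<open>The elements with integral conjugate form a subring, so generators suffice. The
  disjunction on \<open>\<phi>\<close> admits the antihomomorphism \<open>S0\<close> as well as
  \<open>Delta0\<close>.\<close>

lemma integral_conj:
  fixes \<phi> :: "'g::lie_ring uea \<Rightarrow> 'a::{ring,monoid_mult}"
  assumes inv: "a * b = 1" "b * a = 1"
    and \<phi>: "Modules.additive \<phi>" "\<phi> 1 = 1" "(\<forall>u v. \<phi> (u * v) = \<phi> u * \<phi> v) \<or> (\<forall>u v. \<phi> (u * v) = \<phi> v * \<phi> u)"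
    and gen: "\<And>x. a * to_ratl (fps_const (\<phi> (uea_of x))) * b \<in> range to_ratl"
  shows "a * to_ratl (fps_const (\<phi> u)) * b \<in> range to_ratl"
proof -
  let ?c = "\<lambda>u. a * to_ratl (fps_const (\<phi> u)) * b"
  have c_mult: "?c u * ?c v = a * to_ratl (fps_const (\<phi> u * \<phi> v)) * b" for u v
  proof -
    have "?c u * ?c v = a * to_ratl (fps_const (\<phi> u)) * (b * a) * to_ratl (fps_const (\<phi> v)) * b"
      by (simp only: mult.assoc)
    then show ?thesis by (simp only: inv fps_one_mult mult.assoc fps_const_mult[symmetric] to_ratl_mult)
  qed
  have add: "Modules.additive ?c"
    by (simp add: Modules.additive_def distrib_left distrib_right additive.add[OF \<phi>(1)]
        additive.add[OF tlin_const_additive[OF tlin_to_ratl]])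
  show ?thesis
  proof (induction u rule: uea_induct)
    case zero
    show ?case using additive.zero[OF add] integral_zero by simp
  next
    case one
    have "?c 1 = to_ratl 1" by (simp only: \<phi>(2) one_ratl[symmetric] fps_one_mult inv to_ratl_one)
    then show ?case by (metis rangeI)
  next
    case (diff u v)
    then show ?case unfolding additive.diff[OF add] by (rule integral_diff)
  next
    case (mult u v)
    have "?c (u * v) = ?c u * ?c v \<or> ?c (u * v) = ?c v * ?c u" using \<phi>(3) unfolding c_mult by auto
    then show ?case using integral_mult[OF mult(1,2)] integral_mult[OF mult(2,1)] by (elim disjE) simp_all
  qed (rule gen)
qed

text \<open>Translates the Hopf axioms, which are phrased with \<open>ctensor_lift\<close>, into
  rational formulas; the comparison is made on constant pure tensors only.\<close>

lemma ctensor_lift_ratl: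
  assumes "biadditive (\<lambda>a b. \<Phi> (fps_const a) (fps_const b))" "tlin \<Psi>"
    and "\<And>a b. to_ratl (\<Phi> (fps_const a) (fps_const b)) = \<Psi> (fps_const (a \<otimes> b))"
  shows "to_ratl (ctensor_lift \<Phi> y) = \<Psi> y"
  by (rule tlin_tensor_eqI[OF tlin_comp[OF tlin_to_ratl ctensor_lift_tlin[OF assms(1)]] assms(2)])
    (simp only: ctensor_lift_const[OF assms(1)] assms(3))

text \<open>Intended for tensoring with a fixed element on one side. Such a map is not
  multiplicative, but it is a bimodule map along the embedding \<open>i\<close>.\<close>

lemma map_ratl_bimodule:
  assumes j: "Modules.additive j" "\<And>x y. j (x * y) = i x * j y" "\<And>x y. j (x * y) = j x * i y" and i: "ring_map i"
  shows "map_ratl j (F * z * G) = map_ratl i F * map_ratl j z * map_ratl i G"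
proof -
  note l = map_ratl_rprod[where \<beta> = "(*)" and \<beta>' = "(*)", OF j(1) _ _ biadditive_times biadditive_times,
    folded times_rprod]
  have "map_ratl j (F * z * G) = map_ratl j (F * z) * map_ratl i G"
    by (rule l[OF j(1) ring_mapD(1)[OF i] j(3)])
  also have "map_ratl j (F * z) = map_ratl i F * map_ratl j z"
    by (rule l[OF ring_mapD(1)[OF i] j(1) j(2)])
  finally show ?thesis .
qed

section \<open>Integral forms of twisted Hopf algebras\<close>

text \<open>Integrality is asked of generators only, where explicit formulas are at hand. For the
  twists considered here the two elements in \<open>wv\<close> and \<open>vw\<close> are explicit
  products of exponential series.\<close>

locale integral_twist =
  fixes F G :: "('g::lie_ring uea, 'g uea) tensor ratl fps"
  assumes FG: "F * G = 1" and GF: "G * F = 1"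
    and cocycle: "map_ratl emb12 F * map_ratl Delta_id F = map_ratl emb23 F * map_ratl id_Delta F"
    and counit: "map_ratl counit_left F = 1" "map_ratl counit_right F = 1"
    and wv: "map_ratl (\<lambda>y. lact y 1) F * map_ratl (ract 1) G = 1"
    and vw: "map_ratl (ract 1) G * map_ratl (\<lambda>y. lact y 1) F = 1"
    and inj: "ratl_inj TYPE('g uea)" "ratl_inj TYPE(('g uea, 'g uea) tensor)"
      "ratl_inj TYPE(('g uea, ('g uea, 'g uea) tensor) tensor)"
    and integral_Delta: "\<And>x. F * to_ratl (fps_const (Delta0 (uea_of x))) * G \<in> range to_ratl"
    and integral_S: "\<And>x. map_ratl (\<lambda>y. lact y 1) F * to_ratl (fps_const (uea_of x)) * map_ratl (ract 1) G \<in> range to_ratl"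
begin

definition "w = map_ratl (\<lambda>y. lact y 1) F"
definition "v = map_ratl (ract 1) G"

lemma w_act: "w = rprod lact F 1" and v_act: "v = rprod ract 1 G"
  unfolding w_def v_def rprod_act_one by (rule refl)+

lemma wv': "w * v = 1" and vw': "v * w = 1"
  unfolding w_def v_def by (rule wv vw)+

lemma twist_w: "twist_w F = w"
  by (simp add: twist_w_def w_def lact_def[abs_def])

lemma inv_F: "ring_inv F = G"
  by (rule ring_inv_eqI[OF FG GF])

lemma inv_w: "ring_inv w = v"
  by (rule ring_inv_eqI[OF wv' vw'])

lemma drinfeld: "drinfeld_twist F"
  unfolding drinfeld_twist_def
  using FG GF cocycle counit
  unfolding emb12_def[abs_def] emb23_def[abs_def] Delta_id_def[abs_def] id_Delta_def[abs_def]
    counit_left_def counit_right_def by auto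

lemma integral_Delta': "F * to_ratl (fps_const (Delta0 u)) * G \<in> range to_ratl"
  by (rule integral_conj[OF FG GF ring_mapD(1)[OF ring_map_Delta0]];
      (rule integral_Delta | simp add: Delta0_simps))

lemma integral_S': "w * to_ratl (fps_const (S0 u)) * v \<in> range to_ratl"
proof (rule integral_conj[OF wv' vw' additive_S0])
  show "w * to_ratl (fps_const (S0 (uea_of x))) * v \<in> range to_ratl" for x
    using integral_minus[OF integral_S[of x]]
    by (simp add: S0_simps w_def v_def additive.minus[OF additive_to_ratl] flip: fps_const_neg)
qed (simp_all add: S0_simps)

lemma ring_map_FG:
  assumes "ring_map i"
  shows "map_ratl i F * map_ratl i G = 1" "map_ratl i G * map_ratl i F = 1"
  using assms FG GF by (simp_all add: ring_map_def map_ratl_one flip: map_ratl_mult)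

text \<open>One side is a left inverse and the other a right inverse of the same element, taken in
  its two forms given by the cocycle identity.\<close>

lemma emb_inverse:
  "map_ratl Delta_id G * map_ratl emb12 G = map_ratl id_Delta G * map_ratl emb23 G"
proof -
  note i = ring_map_FG[OF ring_map_emb(1)] ring_map_FG[OF ring_map_emb(2)]
    ring_map_FG[OF ring_map_emb(3)] ring_map_FG[OF ring_map_emb(4)]
  let ?C = "map_ratl emb12 F * map_ratl Delta_id F"
  let ?L = "map_ratl Delta_id G * map_ratl emb12 G" and ?R = "map_ratl id_Delta G * map_ratl emb23 G"
  have "?L * ?C = map_ratl Delta_id G * (map_ratl emb12 G * map_ratl emb12 F) * map_ratl Delta_id F"
    by (simp only: mult.assoc)
  then have L: "?L * ?C = 1" by (simp only: i fps_one_mult)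
  have "?C * ?R = map_ratl emb23 F * (map_ratl id_Delta F * map_ratl id_Delta G) * map_ratl emb23 G"
    unfolding cocycle by (simp only: mult.assoc)
  then have R: "?C * ?R = 1" by (simp only: i fps_one_mult)
  have "?L = ?L * (?C * ?R)" by (simp only: R fps_one_mult)
  also have "\<dots> = ?R" unfolding mult.assoc[symmetric, of ?L ?C ?R] L by (rule fps_one_mult)
  finally show ?thesis .
qed

text \<open>\<open>c\<close> is a ring homomorphism that sends \<open>F\<close>, hence also
  \<open>G\<close>, to 1, so the conjugation disappears.\<close>

lemma counit_twisted:
  assumes "ring_map c" "map_ratl c F = 1" "\<And>u. c (Delta0 u) = u"
  shows "map_ratl c (F * to_ratl (fps_map Delta0 x) * G) = to_ratl x"
proof -
  have "map_ratl c G = 1" using ring_map_FG(1)[OF assms(1)] assms(2) by (simp add: fps_one_mult)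
  then show ?thesis
    using assms by (simp add: ring_map_def map_ratl_mult map_ratl_to_ratl fps_map_def fps_nth_inverse fps_one_mult)
qed

text \<open>The scalar epsilon(x) times the unit, as a rational series. Its values are central and
  pass through both actions.\<close>

definition unit_counit :: "'g uea fps \<Rightarrow> 'g uea ratl fps" where
  "unit_counit x = to_ratl (fps_map (\<lambda>u. of_int (eps0 u)) x)"

lemma additive_of_int_eps0: "Modules.additive (\<lambda>u. of_int (eps0 u) :: 'g uea)"
  by (simp add: Modules.additive_def eps0_simps)

lemma tlin_unit_counit: "tlin unit_counit"
  unfolding unit_counit_def[abs_def] by (rule tlin_comp[OF tlin_to_ratl tlin_fps_map[OF additive_of_int_eps0]])

lemma unit_counit_const: "unit_counit (fps_const u) = to_ratl (fps_const (of_int (eps0 u)))"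
  by (simp add: unit_counit_def additive_of_int_eps0)

lemma unit_counit_comm: "p * unit_counit x = unit_counit x * p"
  by (rule tlin_eqI[OF tlin_mult(1)[OF tlin_unit_counit] tlin_mult(2)[OF tlin_unit_counit]])
    (simp add: unit_counit_const to_ratl_const_mult mult_of_int_commute[symmetric])

lemma unit_counit_scale: "to_ratl (zt_scale (fps_map eps0 x) 1) = unit_counit x"
  unfolding unit_counit_def zt_scale_bil fps_const_1_eq_1[symmetric]
  by (rule arg_cong[where f = to_ratl])
    (simp only: fps_eq_iff fps_bil_const[OF biadditive_zmul], simp add: zmul_of_int)

lemma unit_counit_act:
  "rprod ract (unit_counit x) G = unit_counit x * v" "rprod lact F (unit_counit x) = w * unit_counit x"
proof -
  have t: "tlin (\<lambda>x. rprod ract (unit_counit x) G)" "tlin (\<lambda>x. rprod lact F (unit_counit x))"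
    by (rule tlin_bil_comp_left[OF biadditive_rbil[OF biadditive_act(2)] tlin_unit_counit]
        tlin_bil_comp_right[OF biadditive_rbil[OF biadditive_act(1)] tlin_unit_counit])+
  have n: "ract (of_int n :: 'g uea) = (\<lambda>y. of_int n * ract 1 y)"
    "(\<lambda>y. lact y (of_int n :: 'g uea)) = (\<lambda>y. lact y 1 * of_int n)" for n
    by (rule ext act_of_int)+
  have l: "Modules.additive ((*) a)" "Modules.additive (\<lambda>x. x * a)" for a :: "'g uea"
    by (simp_all add: Modules.additive_def distrib_left distrib_right)
  have r: "Modules.additive (ract (1 :: 'g uea))" "Modules.additive (\<lambda>y. lact y (1 :: 'g uea))"
    by (simp_all add: Modules.additive_def act_add)
  show "rprod ract (unit_counit x) G = unit_counit x * v"
    by (rule tlin_eqI[OF t(1) tlin_mult(2)[OF tlin_unit_counit]])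
      (simp only: unit_counit_const rprod_const_left[OF biadditive_act(2)] to_ratl_const_mult v_def n(1)
        map_ratl_comp[OF l(1) r(1)])
  show "rprod lact F (unit_counit x) = w * unit_counit x"
    by (rule tlin_eqI[OF t(2) tlin_mult(1)[OF tlin_unit_counit]])
      (simp only: unit_counit_const rprod_const_right[OF biadditive_act(1)] to_ratl_const_mult w_def n(2)
        map_ratl_comp[OF l(2) r(2)])
qed

lemma Delta0_act:
  "rprod ract 1 (to_ratl (fps_map Delta0 x)) = unit_counit x" "rprod lact (to_ratl (fps_map Delta0 x)) 1 = unit_counit x"
  unfolding rprod_act_one unit_counit_def
    map_ratl_to_ratl[OF biadditive_additive(1)[OF biadditive_act(2)]]
    map_ratl_to_ratl[OF biadditive_additive(2)[OF biadditive_act(1)]]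
  by (simp_all add: fps_map_def act_Delta0)

lemma one_act: "rprod ract 1 1 = (1 :: 'g uea ratl fps)" "rprod lact 1 1 = (1 :: 'g uea ratl fps)"
  unfolding rprod_act_one
  by (simp_all add: map_ratl_one act_one_one biadditive_additive(1)[OF biadditive_act(2)]
      biadditive_additive(2)[OF biadditive_act(1)])

section \<open>Hopf axioms for an integral form of the twisted maps\<close>

context
  fixes \<Delta> :: "'g uea fps \<Rightarrow> ('g uea, 'g uea) tensor fps" and S :: "'g uea fps \<Rightarrow> 'g uea fps"
  assumes Delta: "tlin \<Delta>" "\<And>x. to_ratl (\<Delta> x) = F * to_ratl (fps_map Delta0 x) * G"
    and S: "tlin S" "\<And>x. to_ratl (S x) = w * to_ratl (fps_map S0 x) * v"
begin

text \<open>Over the rationals the two sides are the two iterated undeformed coproducts of x, each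
  conjugated by one side of the cocycle identity. Undeformed coassociativity then makes them
  equal.\<close>

lemma twisted_coassoc:
  "ctensor_lift (\<lambda>a b. fps_map tensor_assoc (\<Delta> a \<otimes>\<^sub>t b)) (\<Delta> x) = ctensor_lift (\<lambda>a b. a \<otimes>\<^sub>t \<Delta> b) (\<Delta> x)"
proof (rule to_ratl_inj[OF inj(3)])
  let ?L = "\<lambda>a (b :: 'g uea fps). fps_map tensor_assoc (\<Delta> a \<otimes>\<^sub>t b)"
  let ?R = "\<lambda>(a :: 'g uea fps) b. a \<otimes>\<^sub>t \<Delta> b"
  note addD = tlin_const_additive[OF Delta(1)]
  have addc: "Modules.additive (fps_const :: 'g uea \<Rightarrow> _)" by (simp add: Modules.additive_def)
  have "biadditive (\<lambda>a (b :: 'g uea). \<Delta> (fps_const a) \<otimes>\<^sub>t fps_const b)"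
    unfolding ctensor_bil by (rule biadditive_comp[OF biadditive_fps_bil[OF biadditive_tensor] addD addc])
  then have biL: "biadditive (\<lambda>a b. ?L (fps_const a) (fps_const b))"
    by (simp add: biadditive_def additive.add[OF additive_fps_map[OF tensor_assoc_additive]])
  have biR: "biadditive (\<lambda>(a :: 'g uea) b. ?R (fps_const a) (fps_const b))"
    unfolding ctensor_bil by (rule biadditive_comp[OF biadditive_fps_bil[OF biadditive_tensor] addc addD])
  have L: "to_ratl (ctensor_lift ?L y) = map_ratl emb12 F * map_ratl Delta_id (to_ratl y) * map_ratl emb12 G" for y
  proof (rule ctensor_lift_ratl[OF biL, where \<Psi> = "\<lambda>y. map_ratl emb12 F * map_ratl Delta_id (to_ratl y) * map_ratl emb12 G"])
    show "tlin (\<lambda>y. map_ratl emb12 F * map_ratl Delta_id (to_ratl y) * map_ratl emb12 G)"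
      by (intro tlin_mult tlin_comp[OF tlin_map_ratl] tlin_to_ratl additive_emb)
    fix a b :: "'g uea"
    define j where "j z = tensor_assoc (z \<otimes> b)" for z :: "('g uea, 'g uea) tensor"
    have addj: "Modules.additive j"
      by (simp add: j_def Modules.additive_def tensor_add_left additive.add[OF tensor_assoc_additive])
    have j: "j (x * y) = emb12 x * j y" "j (x * y) = j x * emb12 y" for x y
      by (simp_all add: j_def emb12_def tensor_mult_pure flip: ring_mapD(2)[OF ring_map_assoc])
    have "to_ratl (?L (fps_const a) (fps_const b)) = map_ratl tensor_assoc (map_ratl (\<lambda>z. z \<otimes> b) (to_ratl (\<Delta> (fps_const a))))"
      by (simp only: map_ratl_to_ratl[OF tensor_assoc_additive, symmetric]
          ctensor_bil to_ratl_rprod[OF biadditive_tensor] rprod_const_right[OF biadditive_tensor])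
    also have "\<dots> = map_ratl j (F * to_ratl (fps_const (Delta0 a)) * G)"
      by (simp add: map_ratl_comp tensor_assoc_additive biadditive_additive(2)[OF biadditive_tensor]
          j_def[abs_def] Delta(2) ring_mapD(1)[OF ring_map_Delta0])
    also have "\<dots> = map_ratl emb12 F * map_ratl Delta_id (to_ratl (fps_const (a \<otimes> b))) * map_ratl emb12 G"
      unfolding map_ratl_bimodule[of j emb12, OF addj j ring_map_emb(1)]
      by (simp add: map_ratl_to_ratl addj additive_emb j_def Delta_id_def ring_mapD(1)[OF ring_map_Delta0])
    finally show "to_ratl (?L (fps_const a) (fps_const b))
        = map_ratl emb12 F * map_ratl Delta_id (to_ratl (fps_const (a \<otimes> b))) * map_ratl emb12 G" .
  qed
  have R: "to_ratl (ctensor_lift ?R y) = map_ratl emb23 F * map_ratl id_Delta (to_ratl y) * map_ratl emb23 G" for y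
  proof (rule ctensor_lift_ratl[OF biR, where \<Psi> = "\<lambda>y. map_ratl emb23 F * map_ratl id_Delta (to_ratl y) * map_ratl emb23 G"])
    show "tlin (\<lambda>y. map_ratl emb23 F * map_ratl id_Delta (to_ratl y) * map_ratl emb23 G)"
      by (intro tlin_mult tlin_comp[OF tlin_map_ratl] tlin_to_ratl additive_emb)
    fix a b :: "'g uea"
    define j where "j z = a \<otimes> z" for z :: "('g uea, 'g uea) tensor"
    have addj: "Modules.additive j"
      by (simp add: j_def Modules.additive_def tensor_add_right)
    have j: "j (x * y) = emb23 x * j y" "j (x * y) = j x * emb23 y" for x y
      by (simp_all add: j_def emb23_def tensor_mult_pure)
    have "to_ratl (?R (fps_const a) (fps_const b)) = map_ratl j (F * to_ratl (fps_const (Delta0 b)) * G)"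
      unfolding j_def[abs_def] ctensor_bil to_ratl_rprod[OF biadditive_tensor] rprod_const_left[OF biadditive_tensor]
      by (simp add: Delta(2) ring_mapD(1)[OF ring_map_Delta0])
    also have "\<dots> = map_ratl emb23 F * map_ratl id_Delta (to_ratl (fps_const (a \<otimes> b))) * map_ratl emb23 G"
      unfolding map_ratl_bimodule[of j emb23, OF addj j ring_map_emb(2)]
      by (simp add: map_ratl_to_ratl addj additive_emb j_def id_Delta_def ring_mapD(1)[OF ring_map_Delta0])
    finally show "to_ratl (?R (fps_const a) (fps_const b))
        = map_ratl emb23 F * map_ratl id_Delta (to_ratl (fps_const (a \<otimes> b))) * map_ratl emb23 G" .
  qed
  have mm: "map_ratl i (to_ratl (\<Delta> x)) = map_ratl i F * map_ratl i (to_ratl (fps_map Delta0 x)) * map_ratl i G"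
    if "ring_map i" for i :: "('g uea, 'g uea) tensor \<Rightarrow> ('g uea, ('g uea, 'g uea) tensor) tensor"
    unfolding Delta(2) using that by (simp add: map_ratl_mult ring_map_def)
  have co: "map_ratl Delta_id (to_ratl (fps_map Delta0 x)) = map_ratl id_Delta (to_ratl (fps_map Delta0 x))"
    by (simp add: map_ratl_to_ratl additive_emb fps_map_def Delta0_coassoc)
  have "to_ratl (ctensor_lift ?L (\<Delta> x)) = (map_ratl emb12 F * map_ratl Delta_id F)
      * map_ratl Delta_id (to_ratl (fps_map Delta0 x)) * (map_ratl Delta_id G * map_ratl emb12 G)"
    unfolding L mm[OF ring_map_emb(3)] by (simp only: mult.assoc)
  also have "\<dots> = to_ratl (ctensor_lift ?R (\<Delta> x))"
    unfolding R mm[OF ring_map_emb(4)] cocycle emb_inverse co by (simp only: mult.assoc)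
  finally show "to_ratl (ctensor_lift ?L (\<Delta> x)) = to_ratl (ctensor_lift ?R (\<Delta> x))" .
qed

lemma twisted_counit:
  "ctensor_lift (\<lambda>a b. zt_scale (fps_map eps0 a) b) (\<Delta> x) = x"
  "ctensor_lift (\<lambda>a b. zt_scale (fps_map eps0 b) a) (\<Delta> x) = x"
proof -
  have scale: "zt_scale (fps_map eps0 (fps_const a)) (fps_const b) = fps_const (of_int (eps0 a) * b)"
    for a b :: "'g uea"
    by (simp add: additive_eps0 zt_scale_bil fps_bil_const_const[OF biadditive_zmul] zmul_of_int)
  note c = ring_mapD(1)[OF ring_map_counit(1)] ring_mapD(1)[OF ring_map_counit(2)]
  have "to_ratl (ctensor_lift (\<lambda>a b. zt_scale (fps_map eps0 a) b) y) = map_ratl counit_left (to_ratl y)"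
    for y :: "('g uea, 'g uea) tensor fps"
  proof (rule ctensor_lift_ratl[where \<Psi> = "\<lambda>y. map_ratl counit_left (to_ratl y)"])
    show "biadditive (\<lambda>a b. zt_scale (fps_map eps0 (fps_const (a :: 'g uea))) (fps_const (b :: 'g uea)))"
      unfolding scale by (rule biadditiveI) (simp_all add: eps0_simps distrib_left distrib_right)
    show "tlin (\<lambda>y. map_ratl counit_left (to_ratl y))"
      by (rule tlin_comp[OF tlin_map_ratl[OF c(1)] tlin_to_ratl])
  qed (simp add: scale map_ratl_to_ratl c)
  then show "ctensor_lift (\<lambda>a b. zt_scale (fps_map eps0 a) b) (\<Delta> x) = x"
    by (intro to_ratl_inj[OF inj(1)]) (simp add: Delta(2) counit_twisted ring_map_counit counit counit_Delta0)
  have "to_ratl (ctensor_lift (\<lambda>a b. zt_scale (fps_map eps0 b) a) y) = map_ratl counit_right (to_ratl y)"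
    for y :: "('g uea, 'g uea) tensor fps"
  proof (rule ctensor_lift_ratl[where \<Psi> = "\<lambda>y. map_ratl counit_right (to_ratl y)"])
    show "biadditive (\<lambda>a b. zt_scale (fps_map eps0 (fps_const (b :: 'g uea))) (fps_const (a :: 'g uea)))"
      unfolding scale by (rule biadditiveI) (simp_all add: eps0_simps distrib_left distrib_right)
    show "tlin (\<lambda>y. map_ratl counit_right (to_ratl y))"
      by (rule tlin_comp[OF tlin_map_ratl[OF c(2)] tlin_to_ratl])
  qed (simp add: scale map_ratl_to_ratl c mult_of_int_commute)
  then show "ctensor_lift (\<lambda>a b. zt_scale (fps_map eps0 b) a) (\<Delta> x) = x"
    by (intro to_ratl_inj[OF inj(1)]) (simp add: Delta(2) counit_twisted ring_map_counit counit counit_Delta0)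
qed

text \<open>\<open>S a * b\<close> is w times the right action of \<open>a \<otimes> b\<close> on v,
  and v is itself 1 acted on by \<open>G\<close>. In the left law the product \<open>G * F\<close>
  cancels, after which \<open>Delta0\<close> acts on 1 by the counit. The right law is the mirror
  image.\<close>

lemma twisted_antipode:
  "ctensor_lift (\<lambda>a b. S a * b) (\<Delta> x) = zt_scale (fps_map eps0 x) 1"
  "ctensor_lift (\<lambda>a b. a * S b) (\<Delta> x) = zt_scale (fps_map eps0 x) 1"
proof -
  note addS = tlin_const_additive[OF S(1)]
  have addc: "Modules.additive (fps_const :: 'g uea \<Rightarrow> _)" by (simp add: Modules.additive_def)
  have fin: "to_ratl (zt_scale (fps_map eps0 x) 1) = w * unit_counit x * v"
    by (simp only: unit_counit_scale unit_counit_comm mult.assoc wv' fps_one_mult)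
  have L: "to_ratl (ctensor_lift (\<lambda>a b. S a * b) y) = w * rprod ract v (to_ratl y)" for y
  proof (rule ctensor_lift_ratl[where \<Psi> = "\<lambda>y. w * rprod ract v (to_ratl y)"])
    show "biadditive (\<lambda>a b. S (fps_const a) * fps_const b)"
      by (rule biadditive_comp[OF biadditive_times addS addc])
    show "tlin (\<lambda>y. w * rprod ract v (to_ratl y))"
      by (intro tlin_mult tlin_bil_comp_right biadditive_rbil biadditive_act tlin_to_ratl)
    show "to_ratl (S (fps_const a) * fps_const b) = w * rprod ract v (to_ratl (fps_const (a \<otimes> b)))" for a b
    proof -
      have "to_ratl (S (fps_const a) * fps_const b) = w * (to_ratl (fps_const (S0 a)) * v * to_ratl (fps_const b))"
        by (simp add: to_ratl_mult S(2) additive_S0 mult.assoc)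
      then show ?thesis
        unfolding rprod_const_right[OF biadditive_act(2)] to_ratl_const_mult
        by (simp add: map_ratl_comp Modules.additive_def distrib_left distrib_right)
    qed
  qed
  have "rprod ract v (to_ratl (\<Delta> x)) = rprod ract (rprod ract 1 (G * F)) (to_ratl (fps_map Delta0 x) * G)"
    unfolding Delta(2) v_act by (simp only: rprod_act_mult mult.assoc)
  also have "\<dots> = unit_counit x * v"
    by (simp only: GF one_act rprod_act_mult(1) Delta0_act unit_counit_act)
  finally show "ctensor_lift (\<lambda>a b. S a * b) (\<Delta> x) = zt_scale (fps_map eps0 x) 1"
    by (intro to_ratl_inj[OF inj(1)]) (simp only: L fin mult.assoc)
  have R: "to_ratl (ctensor_lift (\<lambda>a b. a * S b) y) = rprod lact (to_ratl y) w * v" for y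
  proof (rule ctensor_lift_ratl[where \<Psi> = "\<lambda>y. rprod lact (to_ratl y) w * v"])
    show "biadditive (\<lambda>a b. fps_const a * S (fps_const b))"
      by (rule biadditive_comp[OF biadditive_times addc addS])
    show "tlin (\<lambda>y. rprod lact (to_ratl y) w * v)"
      by (intro tlin_mult tlin_bil_comp_left biadditive_rbil biadditive_act tlin_to_ratl)
    show "to_ratl (fps_const a * S (fps_const b)) = rprod lact (to_ratl (fps_const (a \<otimes> b))) w * v" for a b
    proof -
      have "to_ratl (fps_const a * S (fps_const b)) = to_ratl (fps_const a) * w * to_ratl (fps_const (S0 b)) * v"
        by (simp add: to_ratl_mult S(2) additive_S0 mult.assoc)
      then show ?thesis
        unfolding rprod_const_left[OF biadditive_act(1)] to_ratl_const_mult
        by (simp add: map_ratl_comp Modules.additive_def distrib_left distrib_right act_pure[abs_def])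
    qed
  qed
  have "rprod lact (to_ratl (\<Delta> x)) w = rprod lact (F * to_ratl (fps_map Delta0 x)) (rprod lact (G * F) 1)"
    unfolding Delta(2) w_act by (simp only: rprod_act_mult)
  also have "\<dots> = w * unit_counit x"
    by (simp only: GF one_act rprod_act_mult(2) Delta0_act unit_counit_act)
  finally show "ctensor_lift (\<lambda>a b. a * S b) (\<Delta> x) = zt_scale (fps_map eps0 x) 1"
    by (intro to_ratl_inj[OF inj(1)]) (simp only: R fin)
qed

lemma twisted_hom: "\<Delta> 1 = 1" "\<Delta> (x * y) = \<Delta> x * \<Delta> y"
proof -
  have one: "fps_map Delta0 1 = (1 :: ('g uea, 'g uea) tensor fps)"
    by (simp add: fps_eq_iff ring_mapD(3)[OF ring_map_Delta0] additive.zero[OF ring_mapD(1)[OF ring_map_Delta0]])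
  have mult: "fps_map Delta0 (x * y) = fps_map Delta0 x * fps_map Delta0 y"
    unfolding fps_times_bil by (rule fps_map_bil) (simp_all add: ring_mapD[OF ring_map_Delta0])
  show "\<Delta> 1 = 1"
    by (rule to_ratl_inj[OF inj(2)]) (simp only: Delta(2) one to_ratl_one fps_one_mult FG)
  have "to_ratl (\<Delta> x * \<Delta> y) = F * to_ratl (fps_map Delta0 x) * (G * F) * to_ratl (fps_map Delta0 y) * G"
    unfolding to_ratl_mult Delta(2) by (simp only: mult.assoc)
  then show "\<Delta> (x * y) = \<Delta> x * \<Delta> y"
    by (intro to_ratl_inj[OF inj(2)]) (simp only: Delta(2) mult to_ratl_mult GF fps_one_mult mult.assoc)
qed

lemma quantization_twisted: "quantization F \<Delta> S (fps_map eps0)"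
proof -
  have eps: "tlin (fps_map eps0 :: 'g uea fps \<Rightarrow> _)" "fps_map eps0 (1 :: 'g uea fps) = 1"
    "fps_map eps0 (x * y) = fps_map eps0 x * fps_map eps0 y" for x y :: "'g uea fps"
    unfolding fps_times_bil
    by (rule tlin_fps_map[OF additive_eps0], simp add: fps_eq_iff eps0_simps additive.zero[OF additive_eps0],
        rule fps_map_bil, simp_all add: eps0_simps additive_eps0)
  have "zt_hopf_algebra \<Delta> S (fps_map eps0)"
    unfolding zt_hopf_algebra_def
    by (intro conjI allI tlin_zt_linear Delta(1) S(1) eps twisted_hom twisted_coassoc twisted_counit twisted_antipode)
  then show ?thesis
    unfolding quantization_def inv_F twist_w inv_w using Delta(2) S(2) by simp
qed

end

theorem quantization_unique_existence: "\<exists>!Q. case Q of (\<Delta>, S, \<epsilon>) \<Rightarrow> quantization F \<Delta> S \<epsilon>"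
proof -
  have tlin0: "tlin (\<lambda>x. F * to_ratl (fps_map Delta0 x) * G)" "tlin (\<lambda>x. w * to_ratl (fps_map S0 x) * v)"
    by (intro tlin_mult tlin_comp[OF tlin_to_ratl] tlin_fps_map ring_mapD(1)[OF ring_map_Delta0] additive_S0)+
  obtain \<Delta> where \<Delta>: "tlin \<Delta>" "\<And>x. to_ratl (\<Delta> x) = F * to_ratl (fps_map Delta0 x) * G"
    using integral_extension[OF tlin0(1) _ inj(2)] integral_Delta'
    by (simp add: ring_mapD(1)[OF ring_map_Delta0]) blast
  obtain S where S: "tlin S" "\<And>x. to_ratl (S x) = w * to_ratl (fps_map S0 x) * v"
    using integral_extension[OF tlin0(2) _ inj(1)] integral_S'
    by (simp add: additive_S0) blast
  note q = quantization_twisted[OF \<Delta> S]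
  show ?thesis
  proof (rule ex1I[of _ "(\<Delta>, S, fps_map eps0)"])
    show "Q = (\<Delta>, S, fps_map eps0)" if "case Q of (\<Delta>, S, \<epsilon>) \<Rightarrow> quantization F \<Delta> S \<epsilon>" for Q
    proof -
      obtain \<Delta>' S' \<epsilon>' where Q: "Q = (\<Delta>', S', \<epsilon>')" by (cases Q)
      with that have q': "quantization F \<Delta>' S' \<epsilon>'" by simp
      \<comment> \<open>The defining equations fix the rationalized values at every series, so
        uniqueness is injectivity of \<open>to_ratl\<close>.\<close>
      have "\<Delta>' a = \<Delta> a" "S' a = S a" for a
        using q q' by (auto simp: quantization_def intro!: to_ratl_inj[OF inj(2)] to_ratl_inj[OF inj(1)])
      then show ?thesis using Q q' by (simp add: fun_eq_iff quantization_def)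
    qed
  qed (use q in simp)
qed

end

section \<open>Factorial powers in a noncommutative ring\<close>

lemma falling_0 [simp]: "falling x 0 = 1"
  by (simp add: falling_def)

lemma falling_Suc: "falling x (Suc s) = falling x s * (x - of_nat s)"
  by (simp add: falling_def)

lemma rising_0 [simp]: "rising a x 0 = 1"
  by (simp add: rising_def)

lemma rising_Suc: "rising a x (Suc s) = rising a x s * (x + of_int a + of_nat s)"
  by (simp add: rising_def)

text \<open>An intertwining relation passes to integer polynomials in its two arguments. With
  \<open>b = a + c\<close> it says that moving past X shifts the argument by c.\<close>

lemma falling_conj: "a * X = X * b \<Longrightarrow> falling a s * X = X * falling b s"
proof (induction s)
  case (Suc s)
  have "(a - of_nat s) * X = X * (b - of_nat s)"
    using Suc.prems by (simp add: left_diff_distrib right_diff_distrib mult_of_nat_commute[of s X])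
  then have "falling a (Suc s) * X = falling a s * X * (b - of_nat s)"
    by (simp add: falling_Suc mult.assoc)
  then show ?case using Suc by (simp add: falling_Suc mult.assoc)
qed simp

lemma rising_falling: "rising a x s = (-1) ^ s * falling (- x - of_int a) s"
proof (induction s)
  case (Suc s)
  have "x + of_int a + of_nat s = - (- x - of_int a - of_nat s)" by simp
  then show ?case unfolding rising_Suc falling_Suc Suc by (simp only: power_Suc mult_minus_right mult_minus_left mult.assoc mult_1)
qed simp

lemma rising_conj: "a * X = X * b \<Longrightarrow> rising c a s * X = X * rising c b s"
proof (induction s)
  case (Suc s)
  have "(a + of_int c + of_nat s) * X = X * (b + of_int c + of_nat s)"
    using Suc.prems
    by (simp add: distrib_left distrib_right mult_of_nat_commute[of s X] mult_of_int_commute[of c X])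
  then have "rising c a (Suc s) * X = rising c a s * X * (b + of_int c + of_nat s)"
    by (simp add: rising_Suc mult.assoc)
  then show ?case using Suc by (simp add: rising_Suc mult.assoc)
qed simp

lemma falling_comm: "x * y = y * x \<Longrightarrow> falling x s * y = y * falling x s"
  by (rule falling_conj)

lemma rising_comm: "x * y = y * x \<Longrightarrow> rising a x s * y = y * rising a x s"
  by (rule rising_conj)

lemma falling_add: "falling x (s + t) = falling x s * falling (x - of_nat s) t"
  by (induction t) (simp_all add: falling_Suc mult.assoc diff_diff_eq)

lemma rising_add: "rising a x (s + t) = rising a x s * rising a (x + of_nat s) t"
  by (induction t) (simp_all add: rising_Suc mult.assoc add_ac)

text \<open>Both are (x + 1)...(x + s), multiplied in opposite orders.\<close>

lemma rising_1_falling: "rising 1 x s = falling (x + of_nat s) s"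
proof (induction s)
  case (Suc s)
  define z where "z = x + of_nat s"
  have z: "x + of_nat (Suc s) = z + 1" "x + of_int 1 + of_nat s = z + 1"
    by (simp_all add: z_def)
  have "falling (z + 1) (1 + s) = falling (z + 1) 1 * falling (z + 1 - of_nat 1) s"
    by (rule falling_add)
  also have "\<dots> = (z + 1) * falling z s"
    by (simp add: falling_def)
  also have "\<dots> = falling z s * (z + 1)"
    by (rule falling_comm[symmetric]) (simp add: distrib_left distrib_right)
  finally show ?case unfolding z rising_Suc Suc by (simp add: z_def)
qed simp

lemma of_nat_mult_left: "of_nat c * (a * b) = a * (of_nat c * (b :: 'a::ring_1))"
  by (metis mult.assoc mult_of_nat_commute)

lemma binomial_convolution_Suc:
  fixes f :: "nat \<Rightarrow> 'a::ab_group_add"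
  shows "(\<Sum>i\<le>Suc n. zmul (int (Suc n choose i)) (f i)) =
    (\<Sum>i\<le>n. zmul (int (n choose i)) (f (Suc i))) + (\<Sum>i\<le>n. zmul (int (n choose i)) (f i))"
proof -
  have "(\<Sum>i\<le>Suc n. zmul (int (Suc n choose i)) (f i))
    = f 0 + (\<Sum>i\<le>n. zmul (int (n choose i)) (f (Suc i)) + zmul (int (n choose Suc i)) (f (Suc i)))"
    unfolding sum.atMost_Suc_shift by (simp add: zmul_add add.commute)
  also have "f 0 + (\<Sum>i\<le>n. zmul (int (n choose i)) (f (Suc i)) + zmul (int (n choose Suc i)) (f (Suc i)))
    = (\<Sum>i\<le>n. zmul (int (n choose i)) (f (Suc i))) + (\<Sum>i\<le>Suc n. zmul (int (n choose i)) (f i))"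
    unfolding sum.atMost_Suc_shift by (simp add: sum.distrib algebra_simps)
  finally show ?thesis by (simp add: binomial_eq_0)
qed

text \<open>In the i-th summand the new factor x + y - n is split as (x - i) + (y - (n - i)), which
  lengthens one factorial power or the other; Pascal's rule regroups the result.\<close>

lemma falling_Vandermonde:
  assumes "x * y = y * x"
  shows "falling (x + y) n = (\<Sum>i\<le>n. zmul (int (n choose i)) (falling x i * falling y (n - i)))"
proof (induction n)
  case (Suc n)
  have "falling x i * falling y (n - i) * (x + y - of_nat n) =
    falling x (Suc i) * falling y (n - i) + falling x i * falling y (Suc n - i)" if "i \<le> n" for i
  proof -
    have 1: "x + y - of_nat n = (x - of_nat i) + (y - of_nat (n - i))"
      using that by (simp add: of_nat_diff)
    have 2: "falling y (n - i) * (x - of_nat i) = (x - of_nat i) * falling y (n - i)"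
      by (rule falling_comm)
        (simp add: left_diff_distrib right_diff_distrib assms mult_of_nat_commute[of i y])
    have 3: "Suc n - i = Suc (n - i)" using that by simp
    show ?thesis
      unfolding 1 3 falling_Suc distrib_left mult.assoc 2 ..
  qed
  then have "falling (x + y) (Suc n) = (\<Sum>i\<le>n. zmul (int (n choose i)) (falling x (Suc i) * falling y (n - i)))
     + (\<Sum>i\<le>n. zmul (int (n choose i)) (falling x i * falling y (Suc n - i)))"
    unfolding falling_Suc[of "x + y"] Suc
    by (simp add: sum_distrib_right zmul_of_int mult.assoc distrib_left flip: sum.distrib)
  then show ?case
    unfolding binomial_convolution_Suc[of _ "\<lambda>i. falling x i * falling y (Suc n - i)"] by simp
qed simp

section \<open>Shifts by powers of \<open>t\<close>\<close>

text \<open>Multiplication by t^l, available also over coefficient groups without a unit.\<close>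

definition fps_up :: "nat \<Rightarrow> 'a::zero fps \<Rightarrow> 'a fps" where
  "fps_up l x = Abs_fps (\<lambda>n. if n < l then 0 else fps_nth x (n - l))"

lemma fps_up_nth [simp]: "fps_nth (fps_up l x) n = (if n < l then 0 else fps_nth x (n - l))"
  by (simp add: fps_up_def)

lemma fps_up_bil_left:
  assumes "biadditive \<beta>"
  shows "fps_bil \<beta> (fps_up l x) y = fps_up l (fps_bil \<beta> x y)"
proof (rule fps_ext)
  fix n
  note 0 = additive.zero[OF biadditive_additive(2)[OF assms]]
  show "fps_nth (fps_bil \<beta> (fps_up l x) y) n = fps_nth (fps_up l (fps_bil \<beta> x y)) n"
  proof (cases "n < l")
    case False
    have "fps_nth (fps_bil \<beta> (fps_up l x) y) n = (\<Sum>i\<in>{l..n}. \<beta> (fps_nth x (i - l)) (fps_nth y (n - i)))"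
      unfolding fps_bil_def fps_nth_Abs_fps by (rule sum.mono_neutral_cong_right) (auto simp: 0)
    also have "\<dots> = (\<Sum>i\<le>n - l. \<beta> (fps_nth x i) (fps_nth y (n - l - i)))"
      using False by (intro sum.reindex_bij_witness[of _ "\<lambda>i. i + l" "\<lambda>i. i - l"]) auto
    finally show ?thesis using False by (simp add: fps_bil_def)
  qed (auto simp: fps_bil_def 0 intro!: sum.neutral)
qed

lemma fps_up_bil_right:
  assumes "biadditive \<beta>"
  shows "fps_bil \<beta> x (fps_up l y) = fps_up l (fps_bil \<beta> x y)"
proof (rule fps_ext)
  fix n
  note 0 = additive.zero[OF biadditive_additive(1)[OF assms]]
  show "fps_nth (fps_bil \<beta> x (fps_up l y)) n = fps_nth (fps_up l (fps_bil \<beta> x y)) n"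
  proof (cases "n < l")
    case False
    have "fps_nth (fps_bil \<beta> x (fps_up l y)) n = (\<Sum>i\<in>{..n-l}. \<beta> (fps_nth x i) (fps_nth y (n - i - l)))"
      unfolding fps_bil_def fps_nth_Abs_fps using False by (intro sum.mono_neutral_cong_right) (auto simp: 0)
    also have "\<dots> = (\<Sum>i\<le>n - l. \<beta> (fps_nth x i) (fps_nth y (n - l - i)))"
      by (intro sum.cong) (auto simp: add.commute)
    finally show ?thesis using False by (simp add: fps_bil_def)
  qed (auto simp: fps_bil_def 0 intro!: sum.neutral)
qed

lemma fps_up_mult:
  fixes x y :: "'a::ring fps"
  shows "fps_up l x * y = fps_up l (x * y)" "x * fps_up l y = fps_up l (x * y)"
  unfolding fps_times_bil
  by (rule fps_up_bil_left[OF biadditive_times] fps_up_bil_right[OF biadditive_times])+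

lemma fps_up_X: "x * fps_X ^ l = fps_up l (x :: 'a::ring_1 fps)"
  by (rule fps_ext) (simp add: fps_X_power_mult_right_nth)

lemma to_ratl_up: "to_ratl (fps_up l x) = fps_up l (to_ratl x)"
  by (rule fps_ext) (simp add: to_ratl_def)

lemma fps_up_up: "fps_up l (fps_up r x) = fps_up (l + r) x"
  by (rule fps_ext) auto

lemma tlin_up: "tlin (fps_up l :: 'a::ab_group_add fps \<Rightarrow> 'a fps)"
  unfolding tlin_def
proof (intro exI[of _ "\<lambda>k a. if k = l then a else 0"] conjI allI)
  fix x :: "'a fps" and n
  have "(\<Sum>i\<le>n. if n - i = l then fps_nth x i else 0) = (\<Sum>i\<le>n. if i = n - l \<and> l \<le> n then fps_nth x i else 0)"
    by (rule sum.cong) auto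
  then show "fps_nth (fps_up l x) n = (\<Sum>i\<le>n. if n - i = l then fps_nth x i else 0)"
    by (cases "l \<le> n") (simp_all add: sum_Kronecker_le)
qed (auto simp: Modules.additive_def)

lemma fps_commI:
  fixes x y :: "'a::ring fps"
  assumes "\<And>i j. fps_nth x i * fps_nth y j = fps_nth y j * fps_nth x i"
  shows "x * y = y * x"
proof (rule fps_ext)
  fix n
  show "fps_nth (x * y) n = fps_nth (y * x) n"
    unfolding fps_mult_nth assms
    by (rule sum.reindex_bij_witness[of _ "\<lambda>i. n - i" "\<lambda>i. n - i"]) auto
qed

section \<open>Powers of \<open>1 - e t\<close> and the Jordanian twist\<close>

text \<open>The binomial series with exponent \<open>x \<otimes> 1\<close>. Leaving the exponent
  free makes the twist, its inverse and the integral powers of 1 - e t values of one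
  function.\<close>

definition jordan :: "'a::ring_1 \<Rightarrow> 'a \<Rightarrow> ('a, 'a) tensor ratl fps" where
  "jordan x e = egf (\<lambda>s. ((-1) ^ s * falling x s) \<otimes> e ^ s)"

text \<open>Coefficientwise this law of exponents is the Vandermonde identity. It supplies the
  inverse of the twist and the cancellations in both conjugation formulas.\<close>

lemma jordan_add:
  assumes "x * y = y * x"
  shows "jordan x e * jordan y e = jordan (x + y) e"
proof -
  have "(\<Sum>i\<le>n. zmul (int (n choose i)) (((-1) ^ i * falling x i) \<otimes> e ^ i * (((-1) ^ (n - i) * falling y (n - i)) \<otimes> e ^ (n - i))))
    = ((-1) ^ n * falling (x + y) n) \<otimes> e ^ n" for n
  proof -
    have "(-1) ^ i * falling x i * ((-1) ^ (n - i) * falling y (n - i)) = (-1) ^ n * (falling x i * falling y (n - i))"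
      if "i \<le> n" for i
    proof -
      have "(-1) ^ i * falling x i * ((-1) ^ (n - i) * falling y (n - i))
          = (-1) ^ i * (falling x i * (-1) ^ (n - i)) * falling y (n - i)" by (simp only: mult.assoc)
      also have "falling x i * (-1) ^ (n - i) = (-1) ^ (n - i) * falling x i"
        by (rule power_commuting_commutes[symmetric]) simp
      also have "(-1) ^ i * ((-1) ^ (n - i) * falling x i) * falling y (n - i)
          = (-1) ^ (i + (n - i)) * (falling x i * falling y (n - i))"
        by (simp only: mult.assoc power_add)
      finally show ?thesis using that by simp
    qed
    then have "(\<Sum>i\<le>n. zmul (int (n choose i)) (((-1) ^ i * falling x i) \<otimes> e ^ i * (((-1) ^ (n - i) * falling y (n - i)) \<otimes> e ^ (n - i))))
      = (\<Sum>i\<le>n. zmul (int (n choose i)) ((-1) ^ n * (falling x i * falling y (n - i))) \<otimes> e ^ n)"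
      by (intro sum.cong) (auto simp: tensor_mult_pure tensor_zmul simp flip: power_add)
    also have "\<dots> = ((-1) ^ n * falling (x + y) n) \<otimes> e ^ n"
      unfolding falling_Vandermonde[OF assms]
      by (simp add: sum_distrib_left zmul_of_int of_nat_mult_left flip: tensor_sum_pure)
    finally show ?thesis .
  qed
  then show ?thesis by (simp add: jordan_def egf_times)
qed

lemma falling_zero: "falling 0 s = (if s = 0 then 1 else 0)"
  by (induction s) (auto simp: falling_Suc)

lemma jordan_zero: "jordan 0 e = 1"
  by (auto simp: fps_eq_iff jordan_def egf_def falling_zero one_tensor_def)

lemma jordan_inverse: "jordan h e * jordan (- h) e = 1" "jordan (- h) e * jordan h e = 1"
  by (simp_all add: jordan_add jordan_zero)

lemma falling_one: "falling 1 s = (if s \<le> 1 then 1 else 0)"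
proof (induction s)
  case (Suc s)
  show ?case
  proof (cases "s = 1")
    case True
    then show ?thesis by (simp add: falling_Suc)
  qed (use Suc in \<open>auto simp: falling_Suc\<close>)
qed simp

abbreviation one_et :: "'a::ring_1 \<Rightarrow> 'a fps" where
  "one_et e \<equiv> 1 - fps_const e * fps_X"

lemma one_et_nth: "fps_nth (one_et e) n = (if n = 0 then 1 else if n = 1 then - e else 0)"
  by (simp add: fps_X_def fps_const_mult_left)

lemma ring_inv_one_et:
  "one_et e * ring_inv (one_et e) = 1" "ring_inv (one_et e) * one_et e = (1 :: 'a::ring_1 fps)"
proof -
  let ?g = "Abs_fps (\<lambda>n. e ^ n)"
  have 1: "one_et e * ?g = 1"
  proof (rule fps_ext)
    fix n
    show "fps_nth (one_et e * ?g) n = fps_nth 1 n"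
      by (cases n) (simp_all add: left_diff_distrib mult.assoc)
  qed
  have 2: "?g * one_et e = 1"
  proof (rule fps_ext)
    fix n
    have "?g * one_et e = ?g - ?g * fps_const e * fps_X" by (simp add: right_diff_distrib mult.assoc)
    then show "fps_nth (?g * one_et e) n = fps_nth 1 n"
      by (cases n) (simp_all add: power_commutes)
  qed
  show "one_et e * ring_inv (one_et e) = 1" "ring_inv (one_et e) * one_et e = 1"
    unfolding ring_inv_eqI[OF 1 2] by (rule 1 2)+
qed

definition emb2 :: "'b fps \<Rightarrow> ('a::ring_1, 'b::ring_1) tensor fps" where
  "emb2 p = fps_map (\<lambda>b. 1 \<otimes> b) p"

lemma emb2_ctensor: "emb2 p = 1 \<otimes>\<^sub>t p"
proof (rule fps_ext)
  show "fps_nth (emb2 p) n = fps_nth (1 \<otimes>\<^sub>t p) n" for n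
    unfolding ctensor_bil fps_const_1_eq_1[symmetric] fps_bil_const(1)[OF biadditive_tensor] by (simp add: emb2_def)
qed

lemma emb2_mult: "emb2 (p * q) = emb2 p * emb2 q"
  unfolding emb2_def fps_times_bil
  by (rule fps_map_bil) (simp_all add: tensor_mult_pure biadditive_additive(1)[OF biadditive_tensor])

lemma emb2_one: "emb2 1 = 1"
  by (simp add: emb2_def fps_eq_iff one_tensor_def)

lemma jordan_one: "jordan 1 e = to_ratl (emb2 (one_et e))"
proof (rule fps_ext)
  fix n
  have "1 \<otimes> (- (1 :: 'a) \<otimes> e) = (1::rat) \<otimes> (1 \<otimes> - e)" by (simp add: tensor_uminus_pure)
  then show "fps_nth (jordan 1 e) n = fps_nth (to_ratl (emb2 (one_et e))) n"
    unfolding to_ratl_def emb2_def fps_map_nth one_et_nth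
    by (simp add: jordan_def egf_def falling_one)
qed

text \<open>For exponent 1 the factorial powers vanish from the second on, leaving 1 - e t; the law
  of exponents extends this to all integers.\<close>

lemma jordan_of_int: "jordan (of_int z) e = to_ratl (emb2 (zpow (one_et e) z))"
proof -
  let ?g = "ring_inv (one_et e)"
  have comm: "(of_int i :: 'a) * of_int j = of_int j * of_int i" for i j
    by (rule mult_of_int_commute)
  have pos: "jordan (of_int (int n)) e = to_ratl (emb2 (one_et e ^ n))" for n
  proof (induction n)
    case (Suc n)
    have "jordan (of_int (int (Suc n))) e = jordan 1 e * jordan (of_int (int n)) e"
      by (subst jordan_add) simp_all
    then show ?case by (simp only: Suc jordan_one emb2_mult power_Suc to_ratl_mult)
  qed (simp add: jordan_zero emb2_one to_ratl_one)
  have g: "jordan (- 1) e = to_ratl (emb2 ?g)"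
  proof -
    have "to_ratl (emb2 ?g) = jordan (- 1) e * jordan 1 e * to_ratl (emb2 ?g)"
      by (simp add: jordan_inverse fps_one_mult)
    also have "\<dots> = jordan (- 1) e * to_ratl (emb2 (one_et e * ?g))"
      by (simp only: jordan_one mult.assoc emb2_mult to_ratl_mult)
    finally show ?thesis by (simp only: ring_inv_one_et emb2_one to_ratl_one fps_one_mult)
  qed
  have neg: "jordan (of_int (- int n)) e = to_ratl (emb2 (?g ^ n))" for n
  proof (induction n)
    case (Suc n)
    have "jordan (of_int (- int (Suc n))) e = jordan (- 1) e * jordan (of_int (- int n)) e"
      by (subst jordan_add) simp_all
    then show ?case by (simp only: Suc g emb2_mult power_Suc to_ratl_mult)
  qed (simp add: jordan_zero emb2_one to_ratl_one)
  show ?thesis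
  proof (cases "0 \<le> z")
    case True
    then show ?thesis using pos[of "nat z"] by (simp add: zpow_def)
  next
    case False
    then show ?thesis using neg[of "nat (- z)"] by (simp add: zpow_def)
  qed
qed

text \<open>Multiplying the two tensor factors together turns \<open>jordan_of_int\<close> into the
  ordinary binomial series.\<close>

lemma to_ratl_zpow: "to_ratl (zpow (one_et e) z) = egf (\<lambda>s. (-1) ^ s * falling (of_int z) s * e ^ s)"
proof -
  define m :: "('a, 'a) tensor \<Rightarrow> 'a" where "m = tensor_lift (*)"
  have add: "Modules.additive m" unfolding m_def by (rule additive_tensor_lift[OF biadditive_times])
  have m: "m (a \<otimes> b) = a * b" for a b unfolding m_def by (rule tensor_lift_pure[OF biadditive_times])
  have "map_ratl m (jordan (of_int z) e) = map_ratl m (to_ratl (emb2 (zpow (one_et e) z)))"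
    by (simp only: jordan_of_int)
  then show ?thesis
    by (simp add: jordan_def map_ratl_egf add m map_ratl_to_ratl emb2_def fps_map_def fps_nth_inverse)
qed

lemma zpow_comm:
  assumes "p * one_et e = one_et e * p"
  shows "p * zpow (one_et e) z = zpow (one_et e) z * p"
proof -
  let ?u = "one_et e" and ?g = "ring_inv (one_et e)"
  have "p * ?g = (?g * ?u) * p * ?g" by (simp only: ring_inv_one_et mult_1)
  also have "\<dots> = ?g * (?u * p) * ?g" by (simp only: mult.assoc)
  also have "\<dots> = ?g * p * (?u * ?g)" unfolding assms[symmetric] by (simp only: mult.assoc)
  finally have "p * ?g = ?g * p" by (simp only: ring_inv_one_et mult_1_right)
  then show ?thesis
    using assms by (simp add: zpow_def power_commuting_commutes[symmetric])
qed

lemma const_comm_one_et: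
  assumes "a * e = e * a"
  shows "fps_const a * one_et e = one_et e * fps_const a"
  by (rule fps_commI) (auto simp: one_et_nth assms)

lemma zpow_const_comm: "a * e = e * a \<Longrightarrow> fps_const a * zpow (one_et e) z = zpow (one_et e) z * fps_const a"
  by (rule zpow_comm[OF const_comm_one_et])

lemma zpow_nth_comm:
  assumes "a * e = e * a"
  shows "a * fps_nth (zpow (one_et e) z) n = fps_nth (zpow (one_et e) z) n * a"
  using arg_cong[OF zpow_const_comm[OF assms, of z], of "\<lambda>x. fps_nth x n"]
  by (simp add: fps_const_mult_left fps_const_mult_right)

lemma zpow_zpow_comm:
  assumes "f * e = e * f"
  shows "zpow (one_et e) z * zpow (one_et f) z' = zpow (one_et f) z' * zpow (one_et e) z"
  by (rule zpow_comm, rule fps_commI)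
    (auto simp: one_et_nth[of f] zpow_nth_comm[of f e] assms mult_minus_left mult_minus_right)

lemma zpow_inverse: "zpow (one_et e) (- z) * zpow (one_et e) z = 1"
proof -
  have "zpow (one_et e) z * zpow (one_et e) (- z) = 1" if "0 \<le> z" for z
    using that ring_inv_one_et[of e] by (simp add: zpow_def left_right_inverse_power)
  moreover have "zpow (one_et e) (- z) * zpow (one_et e) z = 1" if "0 \<le> z" for z
    using that ring_inv_one_et[of e] by (simp add: zpow_def left_right_inverse_power)
  ultimately show ?thesis
    by (cases "0 \<le> z") (auto dest: meta_spec[of _ "- z"])
qed

section \<open>Conjugation by the Jordanian twist\<close>

lemma const_ctensor_nth [simp]: "fps_nth (fps_const a \<otimes>\<^sub>t p) n = a \<otimes> fps_nth p n"
  unfolding ctensor_bil by (rule fps_bil_const(1)[OF biadditive_tensor])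

lemma const_ctensor_mult:
  fixes a b :: "'a::{ring,monoid_mult}" and p q :: "'b::{ring,monoid_mult} fps"
  shows "(fps_const a \<otimes>\<^sub>t p) * (fps_const b \<otimes>\<^sub>t q) = fps_const (a * b) \<otimes>\<^sub>t (p * q)"
  by (simp add: fps_eq_iff fps_mult_nth tensor_mult_pure tensor_sum_pure)

lemma emb2_eq: "emb2 p = fps_const 1 \<otimes>\<^sub>t p"
  by (simp add: emb2_ctensor)

lemma ctensor_up: "fps_const a \<otimes>\<^sub>t fps_up l p = fps_up l (fps_const a \<otimes>\<^sub>t p)"
  unfolding ctensor_bil by (rule fps_up_bil_right[OF biadditive_tensor])

lemma const_pure: "fps_const (a \<otimes> b) = fps_const a \<otimes>\<^sub>t fps_const b"
  by (simp add: ctensor_bil fps_bil_const_const[OF biadditive_tensor])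

text \<open>This cancellation of factorials turns the l-th term of a Leibniz expansion, inside an
  exponential generating function, into a shift by t^l.\<close>

lemma tensor_binomial_scalar:
  assumes "l \<le> n"
  shows "(1 / fact n :: rat) \<otimes> zmul (int (n choose l)) (zmul (fact l) z) = (1 / fact (n - l)) \<otimes> z"
proof -
  have "(1 / fact n :: rat) \<otimes> zmul (int (n choose l)) (zmul (fact l) z)
    = zmul (int (n choose l)) (zmul (fact l) (1 / fact n)) \<otimes> z"
    by (simp only: tensor_zmul)
  also have "zmul (int (n choose l)) (zmul (fact l) (1 / fact n :: rat)) = 1 / fact (n - l)"
    using assms by (simp add: zmul_rat binomial_fact field_simps)
  finally show ?thesis .
qed

lemma zmul_zmul: "zmul (a * b) z = zmul a (zmul b z)"
  by (induction a rule: int_induct[where k = 0]) (simp_all add: zmul_Suc zmul_pred zmul_add distrib_right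
      left_diff_distrib add_diff_eq[symmetric] additive.diff[OF biadditive_additive(2)[OF biadditive_zmul]])

lemma zmul_mult: "zmul n a * b = zmul n (a * b)" "a * zmul n b = zmul n (a * (b :: 'a::ring))"
  using additive_zmul[OF biadditive_additive(2)[OF biadditive_times]]
    additive_zmul[OF biadditive_additive(1)[OF biadditive_times]] by metis+

lemma of_nat_zmul: "of_nat n * (a :: 'a::ring_1) = zmul (int n) a"
  by (simp add: zmul_of_int)

lemma zmul_fact_Suc: "zmul (fact (Suc l)) z = zmul (fact l) (zmul (int (Suc l)) z)"
  by (simp only: fact_Suc zmul_zmul[symmetric] mult.commute of_nat_id)

lemma tlin_id: "tlin (\<lambda>x. x)"
proof -
  have "fps_up 0 = (\<lambda>x :: 'a fps. x)" by (simp add: fun_eq_iff fps_eq_iff)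
  then show ?thesis using tlin_up[where l = 0 and 'a = 'a] by simp
qed

text \<open>\<open>Y l\<close> stands for (- ad e)^l Y_0 / l!. Since the divided powers are given as
  a sequence, l! occurs as a factor and nothing in the ring is divided.\<close>

lemma power_adjoint_right:
  fixes e :: "'a::ring_1"
  assumes "\<And>l. Y l * e = e * Y l + of_nat (Suc l) * Y (Suc l)"
  shows "Y 0 * e ^ s = (\<Sum>l\<le>s. zmul (int (s choose l)) (zmul (fact l) (e ^ (s - l) * Y l)))"
proof (induction s)
  case (Suc s)
  define f where "f l = zmul (fact l) (e ^ (Suc s - l) * Y l)" for l
  have "zmul (fact l) (e ^ (s - l) * Y l) * e = f (Suc l) + f l" if "l \<le> s" for l
  proof -
    have "Suc s - l = Suc (s - l)" using that by simp
    then have "f l = zmul (fact l) (e ^ (s - l) * (e * Y l))"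
      by (simp add: f_def power_Suc2 mult.assoc del: power_Suc)
    moreover have "f (Suc l) = zmul (fact l) (e ^ (s - l) * (of_nat (Suc l) * Y (Suc l)))"
      by (simp only: f_def diff_Suc_Suc zmul_fact_Suc of_nat_zmul zmul_mult)
    moreover have "zmul (fact l) (e ^ (s - l) * Y l) * e = zmul (fact l) (e ^ (s - l) * (Y l * e))"
      by (simp only: zmul_mult mult.assoc)
    ultimately show ?thesis by (simp add: assms distrib_left zmul_add_right add.commute del: of_nat_Suc)
  qed
  then have "Y 0 * e ^ Suc s = (\<Sum>l\<le>s. zmul (int (s choose l)) (f (Suc l) + f l))"
    unfolding power_Suc2 mult.assoc[symmetric] Suc
    by (simp add: sum_distrib_right zmul_of_int mult.assoc)
  then show ?case
    unfolding f_def[symmetric] binomial_convolution_Suc[of s f] by (simp add: zmul_add_right sum.distrib)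
qed simp

lemma power_adjoint_left:
  fixes e :: "'a::ring_1"
  assumes "\<And>l. e * X l = X l * e + of_nat (Suc l) * X (Suc l)"
  shows "e ^ s * X 0 = (\<Sum>l\<le>s. zmul (int (s choose l)) (zmul (fact l) (X l * e ^ (s - l))))"
proof (induction s)
  case (Suc s)
  define f where "f l = zmul (fact l) (X l * e ^ (Suc s - l))" for l
  have "e * zmul (fact l) (X l * e ^ (s - l)) = f (Suc l) + f l" if "l \<le> s" for l
  proof -
    have "Suc s - l = Suc (s - l)" using that by simp
    then have "f l = zmul (fact l) (X l * e * e ^ (s - l))"
      by (simp add: f_def mult.assoc)
    moreover have "f (Suc l) = zmul (fact l) (of_nat (Suc l) * X (Suc l) * e ^ (s - l))"
      by (simp only: f_def diff_Suc_Suc zmul_fact_Suc of_nat_zmul zmul_mult)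
    moreover have "e * zmul (fact l) (X l * e ^ (s - l)) = zmul (fact l) (e * X l * e ^ (s - l))"
      by (simp only: zmul_mult mult.assoc)
    ultimately show ?thesis by (simp add: assms distrib_right zmul_add_right add.commute del: of_nat_Suc)
  qed
  moreover have "e * zmul (int c) z = zmul (int c) (e * z)" for c z
    by (simp add: zmul_of_int of_nat_mult_left)
  ultimately have "e ^ Suc s * X 0 = (\<Sum>l\<le>s. zmul (int (s choose l)) (f (Suc l) + f l))"
    unfolding power_Suc mult.assoc Suc
    by (simp add: sum_distrib_left)
  then show ?case
    unfolding f_def[symmetric] binomial_convolution_Suc[of s f] by (simp add: zmul_add_right sum.distrib)
qed simp

lemma rising_0_falling: "rising 0 h n = (-1) ^ n * falling (- h) n"
  by (simp add: rising_falling)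

text \<open>Moving X to the front changes the exponent h into h + c; multiplying by the inverse
  series leaves exponent c.\<close>

lemma jordan_left:
  assumes "h * X = X * (h + of_int c)"
  shows "jordan h e * to_ratl (fps_const (X \<otimes> 1)) * jordan (- h) e = to_ratl (fps_const X \<otimes>\<^sub>t zpow (one_et e) c)"
proof -
  have "(((-1) ^ s * falling h s) \<otimes> e ^ s) * (X \<otimes> 1) = (X \<otimes> 1) * (((-1) ^ s * falling (h + of_int c) s) \<otimes> e ^ s)" for s
  proof -
    have "(-1) ^ s * X = X * (-1) ^ s" by (rule power_commuting_commutes) simp
    then show ?thesis by (simp add: tensor_mult_pure falling_conj[OF assms] mult.assoc)
      (simp add: mult.assoc[symmetric])
  qed
  note s = this
  have add: "Modules.additive (\<lambda>y. y * (X \<otimes> 1))" "Modules.additive ((*) (X \<otimes> 1))"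
    by (simp_all add: Modules.additive_def distrib_left distrib_right)
  have "jordan h e * to_ratl (fps_const (X \<otimes> 1)) = to_ratl (fps_const (X \<otimes> 1)) * jordan (h + of_int c) e"
    unfolding to_ratl_const_mult jordan_def map_ratl_egf[OF add(1)] map_ratl_egf[OF add(2)] s ..
  then have "jordan h e * to_ratl (fps_const (X \<otimes> 1)) * jordan (- h) e
      = to_ratl (fps_const (X \<otimes> 1)) * (jordan (h + of_int c) e * jordan (- h) e)"
    by (simp only: mult.assoc)
  also have "jordan (h + of_int c) e * jordan (- h) e = jordan (of_int c) e"
    by (subst jordan_add) (simp_all add: distrib_left distrib_right mult_of_int_commute)
  finally show ?thesis
    by (simp only: jordan_of_int emb2_eq const_pure const_ctensor_mult to_ratl_mult[symmetric])
      (simp add: const_ctensor_mult)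
qed

text \<open>X is moved past \<open>jordan (- h) e\<close>. The Leibniz formula produces the divided
  powers, and the rising factorial of h of length n splits into one of h of length l and one of h +
  l. What remains has exponent - h - l and cancels against \<open>jordan h e\<close> up to (1 - e
  t)^(-l).\<close>

lemma jordan_right:
  assumes "\<And>l. e * X l = X l * e + of_nat (Suc l) * X (Suc l)"
  shows "jordan h e * to_ratl (fps_const (1 \<otimes> X 0)) * jordan (- h) e =
    to_ratl (fsum (\<lambda>l. fps_up l (fps_const ((-1) ^ l * rising 0 h l) \<otimes>\<^sub>t (zpow (one_et e) (- int l) * fps_const (X l)))))"
    (is "_ = to_ratl (fsum (\<lambda>l. fps_up l (?Y l)))")
proof -
  \<comment> \<open>\<open>power_adjoint_right\<close> moves e to the left, so each commutator has
    the opposite sign to the one in \<open>X\<close>.\<close>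
  define Y where "Y l = (-1) ^ l * X l" for l
  have "X l * e = e * X l - of_nat (Suc l) * X (Suc l)" for l using assms[of l] by simp
  then have Y: "Y l * e = e * Y l + of_nat (Suc l) * Y (Suc l)" for l
    by (cases "even l") (simp_all add: Y_def del: of_nat_Suc)
  have add: "Modules.additive ((*) (1 \<otimes> Y 0))" "Modules.additive (\<lambda>z. z * (rising 0 h l \<otimes> Y l))" for l
    by (simp_all add: Modules.additive_def distrib_left distrib_right)
  let ?T = "\<lambda>l. to_ratl (fps_const (rising 0 h l \<otimes> Y l))"
  have base: "to_ratl (fps_const (1 \<otimes> Y 0)) * jordan (- h) e = fsum (\<lambda>l. fps_up l (jordan (- h - of_nat l) e * ?T l))"
  proof (rule fps_ext)
    fix n
    have "fps_nth (to_ratl (fps_const (1 \<otimes> Y 0)) * jordan (- h) e) n = (1 / fact n) \<otimes> (rising 0 h n \<otimes> (Y 0 * e ^ n))"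
      unfolding to_ratl_const_mult jordan_def map_ratl_egf[OF add(1)]
      by (simp add: egf_def tensor_mult_pure rising_0_falling)
    also have "\<dots> = (\<Sum>l\<le>n. (1 / fact n) \<otimes> zmul (int (n choose l)) (zmul (fact l) (rising 0 h n \<otimes> (e ^ (n - l) * Y l))))"
      unfolding power_adjoint_right[of Y, OF Y] by (simp add: tensor_sum_pure tensor_zmul)
    also have "\<dots> = (\<Sum>l\<le>n. (1 / fact (n - l)) \<otimes> (rising 0 h n \<otimes> (e ^ (n - l) * Y l)))"
      by (rule sum.cong) (simp_all add: tensor_binomial_scalar)
    also have "\<dots> = fps_nth (fsum (\<lambda>l. fps_up l (jordan (- h - of_nat l) e * ?T l))) n"
      unfolding fsum_def fps_nth_Abs_fps
    proof (rule sum.cong)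
      fix l assume "l \<in> {..n}"
      then have l: "l \<le> n" by simp
      have "(-1) ^ (n - l) * falling (- h - of_nat l) (n - l) = rising 0 (h + of_nat l) (n - l)"
        by (simp add: rising_0_falling)
      moreover have "rising 0 (h + of_nat l) (n - l) * rising 0 h l = rising 0 h l * rising 0 (h + of_nat l) (n - l)"
        by (intro rising_comm rising_comm[symmetric]) (simp add: distrib_left distrib_right mult_of_nat_commute)
      moreover have "rising 0 h l * rising 0 (h + of_nat l) (n - l) = rising 0 h n"
        using l by (simp flip: rising_add)
      ultimately have 1: "(-1) ^ (n - l) * falling (- h - of_nat l) (n - l) * rising 0 h l = rising 0 h n" by simp
      show "(1 / fact (n - l)) \<otimes> (rising 0 h n \<otimes> (e ^ (n - l) * Y l)) =
          fps_nth (fps_up l (jordan (- h - of_nat l) e * ?T l)) n"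
        unfolding to_ratl_const_mult jordan_def map_ratl_egf[OF add(2)] using l
        by (simp add: egf_def tensor_mult_pure 1)
    qed simp
    finally show "fps_nth (to_ratl (fps_const (1 \<otimes> Y 0)) * jordan (- h) e) n
      = fps_nth (fsum (\<lambda>l. fps_up l (jordan (- h - of_nat l) e * ?T l))) n" .
  qed
  note tl = tlin_mult(1)[OF tlin_id, of "jordan h e"]
  have "jordan h e * to_ratl (fps_const (1 \<otimes> X 0)) * jordan (- h) e
      = fsum (\<lambda>l. jordan h e * fps_up l (jordan (- h - of_nat l) e * ?T l))"
    using base by (simp add: Y_def mult.assoc tlin_fsum[OF tl])
  also have "\<dots> = fsum (\<lambda>l. to_ratl (fps_up l (?Y l)))"
  proof (rule arg_cong[where f = fsum], rule ext)
    fix l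
    have "jordan h e * jordan (- h - of_nat l) e = jordan (of_int (- int l)) e"
      by (subst jordan_add) (simp_all add: left_diff_distrib right_diff_distrib mult_of_nat_commute)
    then have "jordan h e * (jordan (- h - of_nat l) e * ?T l) = to_ratl (emb2 (zpow (one_et e) (- int l)) * fps_const (rising 0 h l \<otimes> Y l))"
      by (simp only: jordan_of_int to_ratl_mult mult.assoc[symmetric])
    moreover have Yl: "rising 0 h l \<otimes> Y l = ((-1) ^ l * rising 0 h l) \<otimes> X l"
      by (cases "even l") (simp_all add: Y_def tensor_uminus_pure)
    have "emb2 (zpow (one_et e) (- int l)) * fps_const (rising 0 h l \<otimes> Y l)
      = ?Y l"
      unfolding Yl emb2_eq const_pure const_ctensor_mult by simp
    ultimately show "jordan h e * fps_up l (jordan (- h - of_nat l) e * ?T l)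
      = to_ratl (fps_up l (?Y l))"
      by (simp only: fps_up_mult to_ratl_up)
  qed
  finally show ?thesis by (simp add: tlin_fsum[OF tlin_to_ratl])
qed

lemma jordan_comm:
  assumes "a * g = g * a" "\<And>i. fps_nth p i * f = f * fps_nth p i"
  shows "jordan g f * to_ratl (fps_const a \<otimes>\<^sub>t p) = to_ratl (fps_const a \<otimes>\<^sub>t p) * jordan g f"
proof (rule fps_commI)
  fix i j
  have 1: "(-1) ^ i * falling g i * a = a * ((-1) ^ i * falling g i)"
    using falling_comm[OF assms(1)[symmetric], of i] by (cases "even i") simp_all
  have 2: "f ^ i * fps_nth p j = fps_nth p j * f ^ i"
    by (rule power_commuting_commutes) (simp add: assms(2))
  show "fps_nth (jordan g f) i * fps_nth (to_ratl (fps_const a \<otimes>\<^sub>t p)) j =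
    fps_nth (to_ratl (fps_const a \<otimes>\<^sub>t p)) j * fps_nth (jordan g f) i"
    by (simp add: jordan_def egf_def to_ratl_def tensor_mult_pure 1 2)
qed

lemma fsum_cong: "(\<And>l. Y l = Y' l) \<Longrightarrow> fsum Y = fsum Y'"
  by presburger

lemma tlin_mult_id:
  fixes a :: "'a::{ring,monoid_mult} ratl fps"
  shows "tlin (\<lambda>x. a * x)" "tlin (\<lambda>x. x * a)"
  by (rule tlin_mult[OF tlin_id])+

lemma tlin_mult_fps:
  fixes a :: "'a::ring fps"
  shows "tlin (\<lambda>x. a * x)" "tlin (\<lambda>x. x * a)"
  unfolding fps_times_bil by (rule tlin_bil_right[OF biadditive_times] tlin_bil_left[OF biadditive_times])+

text \<open>The inner conjugation is expanded first. Its factors in h and its powers of 1 - e t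
  commute with the outer twist, which therefore acts on \<open>X l 0\<close> alone and produces
  \<open>X l r\<close>.\<close>

theorem jordan_jordan_Delta:
  assumes comm: "h * g = g * h" "e * f = f * e" "h * f = f * h" "e * g = g * e"
    and X: "h * X 0 0 = X 0 0 * (h + of_int c)" "g * X 0 0 = X 0 0 * (g + of_int c')"
      "\<And>l. e * X l 0 = X l 0 * e + of_nat (Suc l) * X (Suc l) 0"
      "\<And>l r. f * X l r = X l r * f + of_nat (Suc r) * X l (Suc r)"
  shows "jordan g f * jordan h e * to_ratl (fps_const (X 0 0 \<otimes> 1 + 1 \<otimes> X 0 0)) * (jordan (- h) e * jordan (- g) f) =
    to_ratl (fps_const (X 0 0) \<otimes>\<^sub>t (zpow (one_et e) c * zpow (one_et f) c')
      + fsum (\<lambda>l. fsum (\<lambda>r. fps_up (r + l) (fps_const ((-1) ^ (r + l) * rising 0 h l * rising 0 g r) \<otimes>\<^sub>t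
          (zpow (one_et e) (- int l) * zpow (one_et f) (- int r) * fps_const (X l r))))))"
    (is "?F * ?Fk * to_ratl (fps_const (?a + ?b)) * (?Gk * ?G) = to_ratl (?A + fsum ?B)")
proof -
  have conj: "?F * ?Fk * z * (?Gk * ?G) = ?F * (?Fk * z * ?Gk) * ?G" for z by (simp only: mult.assoc)
  let ?u = "\<lambda>z. zpow (one_et e) z" and ?v = "\<lambda>z. zpow (one_et f) z"
  have uf: "fps_nth (?u z) i * f = f * fps_nth (?u z) i" for z i
    by (rule zpow_nth_comm[symmetric]) (simp add: comm)
  have A: "?F * (?Fk * to_ratl (fps_const ?a) * ?Gk) * ?G = to_ratl ?A"
  proof -
    have 1: "?Fk * to_ratl (fps_const ?a) * ?Gk = to_ratl (fps_const ?a) * to_ratl (fps_const 1 \<otimes>\<^sub>t ?u c)"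
      unfolding jordan_left[OF X(1)]
      by (simp only: const_pure const_ctensor_mult to_ratl_mult[symmetric]) simp
    have 2: "to_ratl (fps_const 1 \<otimes>\<^sub>t ?u c) * ?G = ?G * to_ratl (fps_const 1 \<otimes>\<^sub>t ?u c)"
      by (rule jordan_comm[symmetric]) (simp_all add: uf)
    have "?F * (?Fk * to_ratl (fps_const ?a) * ?Gk) * ?G
        = ?F * to_ratl (fps_const ?a) * (to_ratl (fps_const 1 \<otimes>\<^sub>t ?u c) * ?G)"
      unfolding 1 by (simp only: mult.assoc)
    also have "\<dots> = (?F * to_ratl (fps_const ?a) * ?G) * to_ratl (fps_const 1 \<otimes>\<^sub>t ?u c)"
      unfolding 2 by (simp only: mult.assoc)
    also have "\<dots> = to_ratl (fps_const (X 0 0) \<otimes>\<^sub>t (?v c' * ?u c))"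
      unfolding jordan_left[OF X(2)] by (simp only: const_ctensor_mult to_ratl_mult[symmetric] mult_1_right)
    finally show ?thesis by (simp only: zpow_zpow_comm[OF comm(2)[symmetric]])
  qed
  define P where "P l = fps_const ((-1) ^ l * rising 0 h l) \<otimes>\<^sub>t ?u (- int l)" for l
  define R where "R l r = fps_const ((-1) ^ r * rising 0 g r) \<otimes>\<^sub>t (?v (- int r) * fps_const (X l r))" for l r
  have P: "fps_const ((-1) ^ l * rising 0 h l) \<otimes>\<^sub>t (?u (- int l) * fps_const (X l 0)) = P l * fps_const (1 \<otimes> X l 0)" for l
    by (simp only: P_def const_pure const_ctensor_mult mult_1_right)
  have FP: "?F * to_ratl (P l) = to_ratl (P l) * ?F" for l
    unfolding P_def
  proof (rule jordan_comm)
    show "(-1) ^ l * rising 0 h l * g = g * ((-1) ^ l * rising 0 h l)"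
      using rising_comm[OF comm(1), of 0 l] by (cases "even l") simp_all
  qed (rule uf)
  have PR: "P l * R l r = fps_const ((-1) ^ (r + l) * rising 0 h l * rising 0 g r) \<otimes>\<^sub>t (?u (- int l) * ?v (- int r) * fps_const (X l r))" for l r
  proof -
    have "(-1) ^ l * rising 0 h l * ((-1) ^ r * rising 0 g r) = (-1) ^ (r + l) * rising 0 h l * rising 0 g r"
      by (cases "even l"; cases "even r") (simp_all add: power_add)
    then show ?thesis by (simp add: P_def R_def const_ctensor_mult mult.assoc)
  qed
  have "?F * (?Fk * to_ratl (fps_const ?b) * ?Gk) * ?G = ?F * to_ratl (fsum (\<lambda>l. fps_up l (P l * fps_const (1 \<otimes> X l 0)))) * ?G"
    using jordan_right[of e "\<lambda>l. X l 0" h, OF X(3)] unfolding P by simp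
  also have "\<dots> = fsum (\<lambda>l. ?F * to_ratl (fps_up l (P l * fps_const (1 \<otimes> X l 0))) * ?G)"
    by (rule tlin_fsum[OF tlin_comp[OF tlin_mult_id(2) tlin_comp[OF tlin_mult_id(1) tlin_to_ratl]]]) simp
  also have "\<dots> = fsum (\<lambda>l. to_ratl (?B l))"
  proof (rule fsum_cong)
    fix l
    have "?F * to_ratl (fps_up l (P l * fps_const (1 \<otimes> X l 0))) * ?G
        = fps_up l (to_ratl (P l) * (?F * to_ratl (fps_const (1 \<otimes> X l 0)) * ?G))"
      by (simp only: to_ratl_up fps_up_mult to_ratl_mult mult.assoc[symmetric] FP)
    also have "?F * to_ratl (fps_const (1 \<otimes> X l 0)) * ?G = to_ratl (fsum (\<lambda>r. fps_up r (R l r)))"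
      unfolding R_def by (rule jordan_right[OF X(4)])
    also have "fps_up l (to_ratl (P l) * to_ratl (fsum (\<lambda>r. fps_up r (R l r)))) = to_ratl (fps_up l (P l * fsum (\<lambda>r. fps_up r (R l r))))"
      by (simp only: to_ratl_mult to_ratl_up)
    also have "fps_up l (P l * fsum (\<lambda>r. fps_up r (R l r))) = fsum (\<lambda>r. fps_up l (P l * fps_up r (R l r)))"
      by (rule tlin_fsum[OF tlin_comp[OF tlin_up tlin_mult_fps(1)]]) simp
    also have "\<dots> = ?B l"
      by (simp only: fps_up_mult fps_up_up PR add.commute[of l])
    finally show "?F * to_ratl (fps_up l (P l * fps_const (1 \<otimes> X l 0))) * ?G = to_ratl (?B l)" .
  qed
  also have "\<dots> = to_ratl (fsum ?B)"
    by (rule tlin_fsum[OF tlin_to_ratl, symmetric]) (simp add: fsum_def)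
  finally have B: "?F * (?Fk * to_ratl (fps_const ?b) * ?Gk) * ?G = to_ratl (fsum ?B)" .
  have "to_ratl (fps_const (?a + ?b)) = to_ratl (fps_const ?a) + to_ratl (fps_const ?b)"
    by (rule additive.add[OF tlin_const_additive[OF tlin_to_ratl]])
  then show ?thesis
    unfolding conj using A B
    by (simp add: distrib_left distrib_right additive.add[OF tlin_additive[OF tlin_to_ratl]])
qed

section \<open>Conjugation by the antipode element\<close>

definition jexp :: "'a::ring_1 \<Rightarrow> 'a \<Rightarrow> 'a ratl fps" where
  "jexp h e = egf (\<lambda>s. falling h s * e ^ s)"

definition jexp_inv :: "'a::ring_1 \<Rightarrow> 'a \<Rightarrow> 'a ratl fps" where
  "jexp_inv h e = egf (\<lambda>s. (-1) ^ s * (falling h s * e ^ s))"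

lemma weight_power:
  assumes "h * e = e * (h + 1)"
  shows "h * e ^ s = e ^ s * (h + of_nat s)"
proof (induction s)
  case (Suc s)
  have "h * e ^ Suc s = e * ((h + 1) * e ^ s)" using assms by (simp add: mult.assoc[symmetric])
  also have "(h + 1) * e ^ s = e ^ s * (h + of_nat (Suc s))"
    by (simp add: distrib_left distrib_right Suc add_ac)
  finally show ?case by (simp only: power_Suc mult.assoc)
qed simp

text \<open>Since (h - s) e^s = e^s h, the factors of the falling factorial interleave with those of
  e^s. The first form identifies \<open>jexp h e\<close> with exp (h e t); the second has e on the
  left, as the conjugation needs it.\<close>

lemma falling_power:
  assumes "h * e = e * (h + 1)"
  shows "falling h s * e ^ s = (h * e) ^ s" "falling h s * e ^ s = e ^ s * rising 1 h s"
proof -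
  show "falling h s * e ^ s = (h * e) ^ s"
  proof (induction s)
    case (Suc s)
    have 1: "(h - of_nat s) * e ^ s = e ^ s * h"
      using weight_power[OF assms, of s]
      by (simp add: left_diff_distrib distrib_left mult_of_nat_commute)
    have "falling h (Suc s) * e ^ Suc s = falling h s * ((h - of_nat s) * e ^ s) * e"
      by (simp only: falling_Suc power_Suc2 mult.assoc)
    also have "\<dots> = (falling h s * e ^ s) * (h * e)" unfolding 1 by (simp only: mult.assoc)
    finally show ?case by (simp only: Suc power_Suc2)
  qed simp
  show "falling h s * e ^ s = e ^ s * rising 1 h s"
    unfolding falling_conj[OF weight_power[OF assms]] rising_1_falling ..
qed

lemma sign_pull: "a * ((-1) ^ n * b) = (-1) ^ n * (a * (b :: 'a::ring_1))"
  by (cases "even n") simp_all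

lemma egf_power_inverse:
  fixes z :: "'a::ring_1"
  shows "egf (\<lambda>s. z ^ s) * egf (\<lambda>s. (-1) ^ s * z ^ s) = 1" "egf (\<lambda>s. (-1) ^ s * z ^ s) * egf (\<lambda>s. z ^ s) = 1"
proof -
  have alt: "(\<Sum>i\<le>n. (-1) ^ i * int (n choose i)) = (if n = 0 then 1 else 0)"
    for n using choose_alternating_sum[of n, where 'a = int] by auto
  have alt': "(\<Sum>i\<le>n. (-1) ^ (n - i) * int (n choose i)) = (if n = 0 then 1 else 0)" for n
  proof -
    have "(\<Sum>i\<le>n. (-1) ^ (n - i) * int (n choose i)) = (\<Sum>i\<le>n. (-1) ^ i * int (n choose i))"
      by (rule sum.reindex_bij_witness[of _ "\<lambda>i. n - i" "\<lambda>i. n - i"]) (auto simp: binomial_symmetric[symmetric])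
    then show ?thesis by (simp add: alt)
  qed
  have "(\<Sum>i\<le>n. zmul (int (n choose i)) (z ^ i * ((-1) ^ (n - i) * z ^ (n - i)))) = of_int (\<Sum>i\<le>n. (-1) ^ (n - i) * int (n choose i)) * z ^ n" for n
    unfolding sign_pull of_int_sum sum_distrib_right
    by (rule sum.cong) (auto simp: zmul_of_int mult.assoc[symmetric] mult_of_nat_commute simp flip: power_add)
  then show "egf (\<lambda>s. z ^ s) * egf (\<lambda>s. (-1) ^ s * z ^ s) = 1"
    unfolding egf_times alt' by (auto simp: fps_eq_iff egf_def one_tensor_def)
  have "(\<Sum>i\<le>n. zmul (int (n choose i)) ((-1) ^ i * z ^ i * z ^ (n - i))) = of_int (\<Sum>i\<le>n. (-1) ^ i * int (n choose i)) * z ^ n" for n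
    unfolding of_int_sum sum_distrib_right
    by (rule sum.cong) (auto simp: zmul_of_int mult.assoc[symmetric] mult_of_nat_commute simp flip: power_add, simp add: mult.assoc flip: power_add)
  then show "egf (\<lambda>s. (-1) ^ s * z ^ s) * egf (\<lambda>s. z ^ s) = 1"
    unfolding egf_times alt by (auto simp: fps_eq_iff egf_def one_tensor_def)
qed

lemma jexp_inverse:
  assumes "h * e = e * (h + 1)"
  shows "jexp h e * jexp_inv h e = 1" "jexp_inv h e * jexp h e = 1"
  unfolding jexp_def jexp_inv_def falling_power(1)[OF assms] by (rule egf_power_inverse)+

text \<open>Multiplication by (1 - e t)^c shifts the argument of \<open>jexp h e\<close> from h to h
  - c, and moving past \<open>X 0\<close> shifts it back. Then e^n X_0 expands into divided powers,
  with \<open>jexp h e\<close> reappearing on the right, where its inverse cancels it.\<close>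

lemma jexp_conj:
  assumes he: "h * e = e * (h + 1)" and hX: "h * X 0 = X 0 * (h + of_int c)"
    and eX: "\<And>l. e * X l = X l * e + of_nat (Suc l) * X (Suc l)"
  shows "jexp h e * to_ratl (fps_const (X 0)) * jexp_inv h e =
    to_ratl (zpow (one_et e) (- c) * fsum (\<lambda>l. fps_up l (fps_const (X l * rising 1 h l))))"
proof -
  let ?T = "\<lambda>l. to_ratl (fps_const (X l * rising 1 h l))"
  \<comment> \<open>Once e^n is pulled to the left, the coefficient is a Vandermonde sum in the
    commuting arguments c and - h - 1.\<close>
  have uw: "to_ratl (zpow (one_et e) c) * jexp h e = egf (\<lambda>s. e ^ s * rising 1 (h - of_int c) s)"
  proof -
    have "(\<Sum>i\<le>n. zmul (int (n choose i)) ((-1) ^ i * falling (of_int c) i * e ^ i * (falling h (n - i) * e ^ (n - i))))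
      = e ^ n * rising 1 (h - of_int c) n" for n
    proof -
      have "(-1) ^ i * falling (of_int c) i * e ^ i * (falling h (n - i) * e ^ (n - i))
          = (-1) ^ n * (e ^ n * (falling (of_int c) i * falling (- h - 1) (n - i)))" if "i \<le> n" for i
      proof -
        have r: "rising 1 h (n - i) = (-1) ^ (n - i) * falling (- h - 1) (n - i)"
          by (simp add: rising_falling)
        have c: "falling (of_int c) i * e ^ k = e ^ k * falling (of_int c) i" for k
          by (rule falling_comm) (rule mult_of_int_commute)
        have "(-1) ^ i * falling (of_int c) i * e ^ i * (falling h (n - i) * e ^ (n - i))
          = (-1) ^ i * (falling (of_int c) i * (e ^ i * e ^ (n - i)) * rising 1 h (n - i))"
          unfolding falling_power(2)[OF he] by (simp only: mult.assoc)
        also have "e ^ i * e ^ (n - i) = e ^ n" using that by (simp flip: power_add)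
        also have "(-1) ^ i * (falling (of_int c) i * e ^ n * rising 1 h (n - i))
           = (-1) ^ i * ((-1) ^ (n - i) * (e ^ n * (falling (of_int c) i * falling (- h - 1) (n - i))))"
          unfolding r c sign_pull[of "e ^ n * falling (of_int c) i"] by (simp only: mult.assoc)
        also have "\<dots> = (-1) ^ n * (e ^ n * (falling (of_int c) i * falling (- h - 1) (n - i)))"
          using that by (simp add: mult.assoc[symmetric] flip: power_add)
        finally show ?thesis .
      qed
      then have "(\<Sum>i\<le>n. zmul (int (n choose i)) ((-1) ^ i * falling (of_int c) i * e ^ i * (falling h (n - i) * e ^ (n - i))))
        = (-1) ^ n * (e ^ n * (\<Sum>i\<le>n. zmul (int (n choose i)) (falling (of_int c) i * falling (- h - 1) (n - i))))"
        by (simp add: sum_distrib_left zmul_mult)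
      also have "(\<Sum>i\<le>n. zmul (int (n choose i)) (falling (of_int c) i * falling (- h - 1) (n - i))) = falling (of_int c + (- h - 1)) n"
        by (rule falling_Vandermonde[symmetric]) (rule mult_of_int_commute)
      also have "(-1) ^ n * (e ^ n * falling (of_int c + (- h - 1)) n) = e ^ n * rising 1 (h - of_int c) n"
      proof -
        have "of_int c + (- h - 1) = - (h - of_int c) - of_int 1" by simp
        then show ?thesis by (simp only: rising_falling[of 1] sign_pull[of "e ^ n"])
      qed
      finally show ?thesis .
    qed
    then show ?thesis by (simp add: to_ratl_zpow jexp_def egf_times)
  qed
  have add: "Modules.additive (\<lambda>y. y * X 0)" "Modules.additive ((*) (X l * rising 1 h l))" for l
    by (simp_all add: Modules.additive_def distrib_left distrib_right)
  have hX': "(h - of_int c) * X 0 = X 0 * h"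
    using hX by (simp add: left_diff_distrib distrib_left mult_of_int_commute)
  have main: "to_ratl (zpow (one_et e) c) * jexp h e * to_ratl (fps_const (X 0)) = fsum (\<lambda>l. fps_up l (?T l * jexp h e))"
  proof (rule fps_ext)
    fix n
    have "fps_nth (to_ratl (zpow (one_et e) c) * jexp h e * to_ratl (fps_const (X 0))) n
        = (1 / fact n) \<otimes> (e ^ n * X 0 * rising 1 h n)"
      unfolding uw to_ratl_const_mult map_ratl_egf[OF add(1)]
      by (simp add: egf_def mult.assoc rising_conj[OF hX'])
    also have "\<dots> = (\<Sum>l\<le>n. (1 / fact n) \<otimes> zmul (int (n choose l)) (zmul (fact l) (X l * e ^ (n - l) * rising 1 h n)))"
      unfolding power_adjoint_left[of e X, OF eX] by (simp add: tensor_sum_pure tensor_zmul sum_distrib_right zmul_mult)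
    also have "\<dots> = (\<Sum>l\<le>n. (1 / fact (n - l)) \<otimes> (X l * e ^ (n - l) * rising 1 h n))"
      by (rule sum.cong) (simp_all add: tensor_binomial_scalar)
    also have "\<dots> = fps_nth (fsum (\<lambda>l. fps_up l (?T l * jexp h e))) n"
      unfolding fsum_def fps_nth_Abs_fps
    proof (rule sum.cong)
      fix l assume "l \<in> {..n}"
      then have l: "l \<le> n" by simp
      \<comment> \<open>The second factor has its argument shifted by n - l, which is undone when
        e^(n-l) moves to the right across it.\<close>
      have "rising 1 h n = rising 1 h (n - l) * rising 1 (h + of_nat (n - l)) l"
        using rising_add[of 1 h "n - l" l] l by (simp only: le_add_diff_inverse2)
      also have "\<dots> = rising 1 (h + of_nat (n - l)) l * rising 1 h (n - l)"
        by (intro rising_comm rising_comm[symmetric]) (simp add: distrib_left distrib_right mult_of_nat_commute)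
      finally have "X l * e ^ (n - l) * rising 1 h n = X l * (e ^ (n - l) * rising 1 (h + of_nat (n - l)) l) * rising 1 h (n - l)"
        by (simp only: mult.assoc)
      also have "\<dots> = X l * rising 1 h l * (falling h (n - l) * e ^ (n - l))"
        unfolding rising_conj[OF weight_power[OF he], symmetric] falling_power(2)[OF he] by (simp only: mult.assoc)
      finally show "(1 / fact (n - l)) \<otimes> (X l * e ^ (n - l) * rising 1 h n) = fps_nth (fps_up l (?T l * jexp h e)) n"
        unfolding to_ratl_const_mult jexp_def map_ratl_egf[OF add(2)] using l by (simp add: egf_def)
    qed simp
    finally show "fps_nth (to_ratl (zpow (one_et e) c) * jexp h e * to_ratl (fps_const (X 0))) n
      = fps_nth (fsum (\<lambda>l. fps_up l (?T l * jexp h e))) n" .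
  qed
  have "jexp h e * to_ratl (fps_const (X 0)) * jexp_inv h e
      = to_ratl (zpow (one_et e) (- c) * zpow (one_et e) c) * jexp h e * to_ratl (fps_const (X 0)) * jexp_inv h e"
    unfolding zpow_inverse by (simp add: to_ratl_one fps_one_mult)
  also have "\<dots> = to_ratl (zpow (one_et e) (- c)) * (fsum (\<lambda>l. fps_up l (?T l * jexp h e)) * jexp_inv h e)"
    unfolding main[symmetric] to_ratl_mult by (simp only: mult.assoc)
  also have "fsum (\<lambda>l. fps_up l (?T l * jexp h e)) * jexp_inv h e = fsum (\<lambda>l. fps_up l (?T l * jexp h e) * jexp_inv h e)"
    by (rule tlin_fsum[OF tlin_mult_id(2)]) simp
  also have "\<dots> = fsum (\<lambda>l. to_ratl (fps_up l (fps_const (X l * rising 1 h l))))"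
    by (simp only: fps_up_mult mult.assoc jexp_inverse[OF he] fps_one_mult to_ratl_up)
  also have "\<dots> = to_ratl (fsum (\<lambda>l. fps_up l (fps_const (X l * rising 1 h l))))"
    by (rule tlin_fsum[OF tlin_to_ratl, symmetric]) simp
  finally show ?thesis by (simp only: to_ratl_mult)
qed

lemma ratl_commI:
  fixes p :: "'a::ring_1 fps"
  assumes "\<And>i. fps_nth p i * g = g * fps_nth p i" "\<And>i. fps_nth p i * f = f * fps_nth p i"
  shows "jexp g f * to_ratl p = to_ratl p * jexp g f" "jexp_inv g f * to_ratl p = to_ratl p * jexp_inv g f"
proof -
  have 1: "falling g i * f ^ i * fps_nth p j = fps_nth p j * (falling g i * f ^ i)" for i j
    using falling_comm[OF assms(1)[symmetric], of i j] power_commuting_commutes[OF assms(2)[symmetric], of i j]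
    by (simp add: mult.assoc) (simp add: mult.assoc[symmetric])
  show "jexp g f * to_ratl p = to_ratl p * jexp g f" "jexp_inv g f * to_ratl p = to_ratl p * jexp_inv g f"
    by (rule fps_commI; simp add: jexp_def jexp_inv_def egf_def to_ratl_def tensor_mult_pure 1 sign_pull mult.assoc;
        simp add: 1 mult.assoc[symmetric])+
qed

text \<open>\<open>jexp_conj\<close> is used twice, the second time on every \<open>X l 0\<close>;
  these must share one weight under g so that a single power of 1 - f t comes out in front of the
  sum.\<close>

theorem jordan_jordan_antipode:
  assumes rel: "h * e = e * (h + 1)" "g * f = f * (g + 1)"
    and comm: "h * g = g * h" "e * f = f * e" "h * f = f * h" "e * g = g * e"
    and X: "h * X 0 0 = X 0 0 * (h + of_int c)" "\<And>l. g * X l 0 = X l 0 * (g + of_int c')"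
      "\<And>l. e * X l 0 = X l 0 * e + of_nat (Suc l) * X (Suc l) 0"
      "\<And>l r. f * X l r = X l r * f + of_nat (Suc r) * X l (Suc r)"
  shows "jexp g f * jexp h e * to_ratl (fps_const (X 0 0)) * (jexp_inv h e * jexp_inv g f) =
    to_ratl (zpow (one_et e) (- c) * zpow (one_et f) (- c') *
      fsum (\<lambda>l. fsum (\<lambda>r. fps_up (r + l) (fps_const (X l r * (rising 1 g r * rising 1 h l))))))"
    (is "?w * ?wk * _ * (?vk * ?v) = to_ratl (_ * fsum ?B)")
proof -
  let ?u = "zpow (one_et e) (- c)" and ?v' = "zpow (one_et f) (- c')"
  let ?Y = "\<lambda>l. fps_up l (fps_const (X l 0) * fps_const (rising 1 h l))"
  have wu: "?w * to_ratl ?u = to_ratl ?u * ?w"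
    by (rule ratl_commI(1); rule zpow_nth_comm[symmetric]) (simp_all add: comm)
  have hv: "?v * to_ratl (fps_const (rising 1 h l)) = to_ratl (fps_const (rising 1 h l)) * ?v" for l
    by (rule ratl_commI(2)) (simp_all add: rising_comm comm)
  have "?w * ?wk * to_ratl (fps_const (X 0 0)) * (?vk * ?v) = ?w * (?wk * to_ratl (fps_const (X 0 0)) * ?vk) * ?v"
    by (simp only: mult.assoc)
  also have "\<dots> = to_ratl ?u * (?w * to_ratl (fsum ?Y) * ?v)"
    using jexp_conj[of h e "\<lambda>l. X l 0" c, OF rel(1) X(1,3)]
    by (simp add: to_ratl_mult mult.assoc[symmetric] wu)
  also have "?w * to_ratl (fsum ?Y) * ?v = fsum (\<lambda>l. ?w * to_ratl (?Y l) * ?v)"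
    by (rule tlin_fsum[OF tlin_comp[OF tlin_mult_id(2) tlin_comp[OF tlin_mult_id(1) tlin_to_ratl]]]) simp
  also have "\<dots> = fsum (\<lambda>l. to_ratl (?v' * ?B l))"
  proof (rule fsum_cong)
    fix l
    let ?r = "fps_const (rising 1 h l)" and ?R = "\<lambda>r. fps_up r (fps_const (X l r * rising 1 g r))"
    have "?w * to_ratl (?Y l) * ?v = fps_up l (?w * to_ratl (fps_const (X l 0)) * (to_ratl ?r * ?v))"
      by (simp only: to_ratl_up fps_up_mult to_ratl_mult mult.assoc)
    also have "\<dots> = fps_up l ((?w * to_ratl (fps_const (X l 0)) * ?v) * to_ratl ?r)"
      by (simp only: hv[symmetric] mult.assoc)
    also have "?w * to_ratl (fps_const (X l 0)) * ?v = to_ratl (?v' * fsum ?R)"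
      by (rule jexp_conj[OF rel(2) X(2,4)])
    also have "fps_up l (to_ratl (?v' * fsum ?R) * to_ratl ?r) = to_ratl (?v' * fps_up l (fsum ?R * ?r))"
      by (simp only: to_ratl_mult[symmetric] to_ratl_up[symmetric] fps_up_mult mult.assoc)
    also have "fps_up l (fsum ?R * ?r) = fsum (\<lambda>r. fps_up l (?R r * ?r))"
      by (rule tlin_fsum[OF tlin_comp[OF tlin_up tlin_mult_fps(2)]]) simp
    also have "\<dots> = ?B l"
      by (simp add: fps_up_mult fps_up_up add.commute[of l] mult.assoc)
    finally show "?w * to_ratl (?Y l) * ?v = to_ratl (?v' * ?B l)" .
  qed
  also have "\<dots> = to_ratl (?v' * fsum ?B)"
    by (rule tlin_fsum[OF tlin_comp[OF tlin_to_ratl tlin_mult_fps(1)], symmetric]) (simp add: fsum_def)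
  finally show ?thesis by (simp only: to_ratl_mult mult.assoc)
qed

section \<open>The Jordanian twist of an enveloping algebra\<close>

lemma S0_falling:
  shows "S0 (falling x n) = falling (S0 x) n"
proof (induction n)
  case (Suc n)
  have S0_of_nat: "S0 (of_nat n) = of_nat n"
    by (induction n) (simp_all add: S0_simps additive.zero[OF additive_S0])
  have "S0 (falling x (Suc n)) = (S0 x - of_nat n) * falling (S0 x) n"
    by (simp add: falling_Suc S0_simps additive.diff[OF additive_S0] S0_of_nat Suc)
  also have "\<dots> = falling (S0 x) n * (S0 x - of_nat n)"
    by (rule falling_comm[symmetric]) (simp add: left_diff_distrib right_diff_distrib mult_of_nat_commute)
  finally show ?case by (simp add: falling_Suc)
qed (simp add: S0_simps)

lemma S0_power: "S0 (x ^ n) = S0 x ^ n"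
  by (induction n) (simp_all add: S0_simps power_commutes)

lemma S0_sign: "S0 ((-1) ^ n * x) = (-1) ^ n * S0 x"
  by (cases "even n") (simp_all add: additive.minus[OF additive_S0])

lemma sign_sign: "(-1) ^ n * a * ((-1) ^ n * b) = a * (b :: 'a::ring_1)"
  by (cases "even n") simp_all

lemma S0_minus_power: "S0 f = - f \<Longrightarrow> S0 (f ^ i) = (-1) ^ i * f ^ i"
  unfolding S0_power by (simp add: power_minus[of f i])

lemma jordan_lact_one:
  assumes "S0 f = - f"
  shows "map_ratl (\<lambda>y. lact y 1) (jordan g f) = jexp g f"
  unfolding jordan_def map_ratl_egf[OF biadditive_additive(2)[OF biadditive_act(1)]]
  by (simp add: jexp_def S0_minus_power[OF assms] sign_sign)

text \<open>The action puts \<open>S0 (f ^ i)\<close> to the right of its argument. As f commutes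
  with h and e, it moves back next to the factor in g, so that the element w of the product twist is
  the product of the two.\<close>

lemma jordan_lact:
  assumes f: "S0 f = - f" and comm: "h * f = f * h" "e * f = f * e"
  shows "rprod lact (jordan g f) (jexp h e) = jexp g f * jexp h e"
proof -
  note Sf = S0_minus_power[OF f]
  have c: "falling h j * e ^ j * f ^ i = f ^ i * (falling h j * e ^ j)" for i j
  proof -
    have "e ^ j * f ^ i = f ^ i * e ^ j" using comm(2)
      by (metis power_commuting_commutes)
    moreover have "falling h j * f ^ i = f ^ i * falling h j" 
      by (rule falling_comm) (rule power_commuting_commutes[symmetric, OF comm(1)[symmetric]])
    ultimately show ?thesis by (simp add: mult.assoc) (simp add: mult.assoc[symmetric])
  qed
  have "lact (((-1) ^ i * falling g i) \<otimes> f ^ i) (falling h j * e ^ j) = falling g i * f ^ i * (falling h j * e ^ j)" for i j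
  proof -
    have "lact (((-1) ^ i * falling g i) \<otimes> f ^ i) (falling h j * e ^ j)
        = (-1) ^ i * falling g i * (falling h j * e ^ j * ((-1) ^ i * f ^ i))"
      by (simp add: Sf mult.assoc)
    also have "\<dots> = (-1) ^ i * falling g i * ((-1) ^ i * (f ^ i * (falling h j * e ^ j)))"
      by (simp only: sign_pull[of "falling h j * e ^ j"] c)
    finally show ?thesis unfolding sign_sign by (simp only: mult.assoc)
  qed
  then show ?thesis
    by (simp add: jordan_def jexp_def rprod_egf[OF biadditive_act(1)] egf_times)
qed

lemma S0_minus_falling: "S0 g = - g \<Longrightarrow> S0 ((-1) ^ i * falling (- g) i) = (-1) ^ i * falling g i"
  by (simp add: S0_sign S0_falling additive.minus[OF additive_S0])

lemma jordan_ract_one: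
  assumes "S0 g = - g"
  shows "map_ratl (ract 1) (jordan (- g) f) = jexp_inv g f"
  unfolding jordan_def map_ratl_egf[OF biadditive_additive(1)[OF biadditive_act(2)]]
  by (simp add: jexp_inv_def S0_minus_falling[OF assms] act_pure mult.assoc)

lemma jordan_ract:
  assumes g: "S0 g = - g" and comm: "h * g = g * h" "e * g = g * e"
  shows "rprod ract (jexp_inv h e) (jordan (- g) f) = jexp_inv h e * jexp_inv g f"
proof -
  note Sg = S0_minus_falling[OF g]
  have c: "falling g i * (falling h j * e ^ j) = falling h j * e ^ j * falling g i" for i j
  proof -
    have "falling g i * e ^ j = e ^ j * falling g i"
      by (rule falling_comm) (rule power_commuting_commutes[symmetric, OF comm(2)])
    moreover have "falling g i * falling h j = falling h j * falling g i"
      by (intro falling_comm falling_comm[symmetric]) (simp add: comm)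
    ultimately show ?thesis by (simp add: mult.assoc[symmetric]) (simp add: mult.assoc)
  qed
  have "ract ((-1) ^ j * (falling h j * e ^ j)) (((-1) ^ i * falling (- g) i) \<otimes> f ^ i)
      = (-1) ^ j * (falling h j * e ^ j) * ((-1) ^ i * (falling g i * f ^ i))" for i j
  proof -
    have "ract ((-1) ^ j * (falling h j * e ^ j)) (((-1) ^ i * falling (- g) i) \<otimes> f ^ i)
      = (-1) ^ i * falling g i * ((-1) ^ j * (falling h j * e ^ j)) * f ^ i"
      by (simp only: act_pure Sg)
    also have "\<dots> = (-1) ^ i * ((-1) ^ j * (falling g i * (falling h j * e ^ j) * f ^ i))"
      by (cases "even i"; cases "even j") (simp_all add: mult.assoc)
    also have "\<dots> = (-1) ^ j * (falling h j * e ^ j) * ((-1) ^ i * (falling g i * f ^ i))"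
      unfolding c by (cases "even i"; cases "even j") (simp_all add: mult.assoc)
    finally show ?thesis .
  qed
  then show ?thesis
    by (simp add: jordan_def jexp_inv_def rprod_egf[OF biadditive_act(2)] egf_times)
qed


text \<open>The sum stands for the factorial power of \<open>x \<otimes> 1 + 1 \<otimes> y\<close>.
  As \<open>falling\<close> asks for \<open>ring_1\<close>, which tensor products are not, the
  recursion is stated for the expanded form.\<close>

lemma falling_coproduct_Suc:
  fixes x y :: "'a::ring_1"
  shows "(\<Sum>p\<le>Suc n. zmul (int (Suc n choose p)) (falling x p \<otimes> falling y (Suc n - p))) =
    (\<Sum>p\<le>n. zmul (int (n choose p)) (falling x p \<otimes> falling y (n - p))) * ((x - of_nat n) \<otimes> 1 + 1 \<otimes> y)"
proof -
  have "(falling x p \<otimes> falling y (n - p)) * ((x - of_nat n) \<otimes> 1 + 1 \<otimes> y)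
      = falling x (Suc p) \<otimes> falling y (n - p) + falling x p \<otimes> falling y (Suc n - p)" if "p \<le> n" for p
  proof -
    have 1: "x - of_nat n = (x - of_nat p) - of_nat (n - p)" using that by (simp add: of_nat_diff)
    have 2: "Suc n - p = Suc (n - p)" using that by simp
    have 3: "(falling x p * of_nat (n - p)) \<otimes> z = falling x p \<otimes> (z * of_nat (n - p))" for z :: 'a
      by (simp only: mult_of_nat_commute[symmetric] of_nat_zmul tensor_zmul)
    show ?thesis
      unfolding 1 2
      by (simp only: distrib_left tensor_mult_pure mult_1_right falling_Suc right_diff_distrib
          tensor_diff_pure 3) simp
  qed
  then show ?thesis
    unfolding binomial_convolution_Suc[of n "\<lambda>p. falling x p \<otimes> falling y (Suc n - p)"]
    by (simp add: sum_distrib_right zmul_mult zmul_add_right sum.distrib)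
qed

text \<open>The sum depends only on \<open>x \<otimes> 1 + 1 \<otimes> y\<close>, and an integer may
  be moved across the tensor sign.\<close>

lemma falling_coproduct_shift:
  fixes x y :: "'a::ring_1"
  shows "(\<Sum>p\<le>n. zmul (int (n choose p)) (falling x p \<otimes> falling y (n - p))) =
    (\<Sum>p\<le>n. zmul (int (n choose p)) (falling (x - of_nat a) p \<otimes> falling (y + of_nat a) (n - p)))"
proof (induction n)
  case (Suc n)
  have "(of_nat a :: 'a) \<otimes> (1::'a) = 1 \<otimes> of_nat a"
    using of_nat_zmul[of a "1::'a"] by (simp add: tensor_zmul)
  then have "(x - of_nat n) \<otimes> 1 + 1 \<otimes> y = (x - of_nat a - of_nat n) \<otimes> 1 + 1 \<otimes> (y + of_nat a)"
    by (simp add: tensor_diff_pure tensor_add_right)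
  then show ?case by (simp only: falling_coproduct_Suc Suc)
qed simp

lemma Delta0_falling:
  assumes "Delta0 h = h \<otimes> 1 + 1 \<otimes> h"
  shows "Delta0 (falling h n) = (\<Sum>p\<le>n. zmul (int (n choose p)) (falling h p \<otimes> falling h (n - p)))"
proof (induction n)
  case (Suc n)
  have "Delta0 (of_nat n) = of_nat n \<otimes> 1" 
    by (induction n) (simp_all add: Delta0_simps additive.zero[OF ring_mapD(1)[OF ring_map_Delta0]]
        tensor_add_left one_tensor_def)
  then have "Delta0 (h - of_nat n) = (h - of_nat n) \<otimes> 1 + 1 \<otimes> h"
    by (simp add: additive.diff[OF ring_mapD(1)[OF ring_map_Delta0]] assms tensor_diff_pure)
  then show ?case
    unfolding falling_coproduct_Suc Suc[symmetric] falling_Suc by (simp add: Delta0_simps)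
qed (simp add: Delta0_simps one_tensor_def)

lemma Delta0_power:
  assumes "Delta0 e = e \<otimes> 1 + 1 \<otimes> e"
  shows "Delta0 (e ^ n) = (\<Sum>p\<le>n. zmul (int (n choose p)) (e ^ p \<otimes> e ^ (n - p)))"
proof (induction n)
  case (Suc n)
  have "(e ^ p \<otimes> e ^ (n - p)) * (e \<otimes> 1 + 1 \<otimes> e) = e ^ Suc p \<otimes> e ^ (n - p) + e ^ p \<otimes> e ^ (Suc n - p)"
    if "p \<le> n" for p
  proof -
    have "Suc n - p = Suc (n - p)" using that by simp
    then show ?thesis by (simp only: distrib_left tensor_mult_pure power_Suc2 mult_1_right)
  qed
  then have "Delta0 (e ^ Suc n) = (\<Sum>p\<le>n. zmul (int (n choose p)) (e ^ Suc p \<otimes> e ^ (n - p) + e ^ p \<otimes> e ^ (Suc n - p)))"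
    unfolding power_Suc2[of e] by (simp add: Delta0_simps Suc assms sum_distrib_right zmul_mult)
  then show ?case
    unfolding binomial_convolution_Suc[of n "\<lambda>p. e ^ p \<otimes> e ^ (Suc n - p)"]
    by (simp add: zmul_add_right sum.distrib)
qed (simp add: Delta0_simps one_tensor_def)

lemma sum_triangle_swap:
  "(\<Sum>i\<le>n. \<Sum>p\<le>n - i. f i p) = (\<Sum>p\<le>n. \<Sum>i\<le>n - p. f i p)" for f :: "nat \<Rightarrow> nat \<Rightarrow> 'a::comm_monoid_add"
proof -
  have "(\<Sum>i\<le>n. \<Sum>p\<le>n - i. f i p) = (\<Sum>(i, p)\<in>Sigma {..n} (\<lambda>i. {..n - i}). f i p)"
    by (simp add: sum.Sigma)
  also have "\<dots> = (\<Sum>(p, i)\<in>Sigma {..n} (\<lambda>p. {..n - p}). f i p)"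
    by (rule sum.reindex_bij_witness[of _ "\<lambda>(p, i). (i, p)" "\<lambda>(p, i). (i, p)"]) auto
  also have "\<dots> = (\<Sum>p\<le>n. \<Sum>i\<le>n - p. f i p)"
    by (simp add: sum.Sigma)
  finally show ?thesis .
qed

lemma emb12_pure [simp]: "emb12 (a \<otimes> b) = a \<otimes> (b \<otimes> 1)"
  by (simp add: emb12_def)

lemma Delta_id_pure: "Delta_id (a \<otimes> b) = tensor_assoc (Delta0 a \<otimes> b)"
  by (simp add: Delta_id_def ring_mapD(1)[OF ring_map_Delta0])

lemma id_Delta_pure: "id_Delta (a \<otimes> b) = a \<otimes> Delta0 b"
  by (simp add: id_Delta_def ring_mapD(1)[OF ring_map_Delta0])

lemma sign_left: "((-1) ^ n * a) \<otimes> b = zmul ((-1) ^ n) (a \<otimes> b)" for a :: "'a::ring_1"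
  by (cases "even n") (simp_all add: tensor_uminus_pure zmul_of_int, simp add: zmul_def)

lemma zmul_sum: "zmul n (sum f A) = (\<Sum>i\<in>A. zmul n (f i))"
  by (rule additive.sum[OF biadditive_additive(1)[OF biadditive_zmul]])

text \<open>
  Both sides expand into \<open>\<Sum> h\<^sup>[\<^sup>a\<^sup>] h\<^sup>[\<^sup>p\<^sup>] \<otimes> e\<^sup>a h\<^sup>[\<^sup>q\<^sup>] \<otimes> e\<^sup>p\<^sup>+\<^sup>q\<close> with multinomial coefficients, after
  moving \<open>e\<^sup>a\<close> to the left and shifting the argument of the coproduct of \<open>h\<^sup>[\<^sup>p\<^sup>+\<^sup>q\<^sup>]\<close> by \<open>a\<close>.
\<close>

lemma jordan_cocycle:
  fixes h e :: "'g::lie_ring uea"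
  assumes he: "h * e = e * (h + 1)" and prim: "Delta0 h = h \<otimes> 1 + 1 \<otimes> h" "Delta0 e = e \<otimes> 1 + 1 \<otimes> e"
  shows "map_ratl emb12 (jordan h e) * map_ratl Delta_id (jordan h e)
    = map_ratl emb23 (jordan h e) * map_ratl id_Delta (jordan h e)"
proof -
  let ?f = "\<lambda>i. ((-1) ^ i * falling h i) \<otimes> e ^ i"
  let ?C = "\<lambda>n k. int (n choose k)"
  have coeff: "(\<Sum>i\<le>n. zmul (?C n i) (emb12 (?f i) * Delta_id (?f (n - i))))
      = (\<Sum>i\<le>n. zmul (?C n i) (emb23 (?f i) * id_Delta (?f (n - i))))" for n
  proof -
    let ?L = "\<lambda>i p. (falling h i * falling h p) \<otimes> ((e ^ i * falling h (n - i - p)) \<otimes> e ^ (n - i))"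
    let ?R = "\<lambda>i p. falling h (n - i) \<otimes> ((falling h i * e ^ p) \<otimes> (e ^ i * e ^ (n - i - p)))"
    have sgn: "zmul ((-1) ^ i) (zmul ((-1) ^ (n - i)) z) = zmul ((-1) ^ n) z" if "i \<le> n" for i and z :: "('g uea, ('g uea, 'g uea) tensor) tensor"
      using that by (simp flip: zmul_zmul power_add)
    have L: "emb12 (?f i) * Delta_id (?f (n - i)) = zmul ((-1) ^ n) (\<Sum>p\<le>n - i. zmul (?C (n - i) p) (?L i p))"
      if "i \<le> n" for i
    proof -
      have e: "e ^ i * e ^ (n - i) = e ^ n" using that by (simp flip: power_add)
      have D: "Delta_id (?f (n - i)) = zmul ((-1) ^ (n - i)) (\<Sum>p\<le>n - i. zmul (?C (n - i) p)
         (falling h p \<otimes> (falling h (n - i - p) \<otimes> e ^ (n - i))))"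
        unfolding sign_left additive_zmul[OF additive_emb(3)] Delta_id_pure Delta0_falling[OF prim(1)]
        by (simp add: tensor_sum_pure tensor_zmul additive.sum[OF tensor_assoc_additive] additive_zmul[OF tensor_assoc_additive])
      have A: "emb12 (?f i) = zmul ((-1) ^ i) (falling h i \<otimes> (e ^ i \<otimes> 1))"
        unfolding sign_left additive_zmul[OF additive_emb(1)] by simp
      have "emb12 (?f i) * Delta_id (?f (n - i)) = zmul ((-1) ^ i) (zmul ((-1) ^ (n - i)) (\<Sum>p\<le>n - i. zmul (?C (n - i) p) (?L i p)))"
        unfolding A D zmul_mult(1) unfolding zmul_mult(2) sum_distrib_left tensor_mult_pure mult_1 ..
      then show ?thesis using sgn[OF that] by simp
    qed
    have R: "emb23 (?f i) * id_Delta (?f (n - i)) = zmul ((-1) ^ n) (\<Sum>p\<le>n - i. zmul (?C (n - i) p) (?R i p))"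
      if "i \<le> n" for i
    proof -
      have D: "id_Delta (?f (n - i)) = zmul ((-1) ^ (n - i)) (\<Sum>p\<le>n - i. zmul (?C (n - i) p)
         (falling h (n - i) \<otimes> (e ^ p \<otimes> e ^ (n - i - p))))"
        unfolding sign_left additive_zmul[OF additive_emb(4)] id_Delta_pure Delta0_power[OF prim(2)]
        by (simp add: tensor_sum_pure tensor_zmul)
      have A: "emb23 (?f i) = zmul ((-1) ^ i) (1 \<otimes> (falling h i \<otimes> e ^ i))"
        unfolding sign_left additive_zmul[OF additive_emb(2)] by (simp add: emb23_def)
      have "emb23 (?f i) * id_Delta (?f (n - i)) = zmul ((-1) ^ i) (zmul ((-1) ^ (n - i)) (\<Sum>p\<le>n - i. zmul (?C (n - i) p) (?R i p)))"
        unfolding A D zmul_mult(1) unfolding zmul_mult(2) sum_distrib_left tensor_mult_pure mult_1 ..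
      then show ?thesis using sgn[OF that] by simp
    qed
    \<comment> \<open>Terms are grouped by the exponent a of e in the middle tensor factor: this is
      the outer index on the left and the inner one on the right.\<close>
    have main: "(\<Sum>p\<le>n - a. zmul (?C n a) (zmul (?C (n - a) p) (?L a p)))
        = (\<Sum>i\<le>n - a. zmul (?C n i) (zmul (?C (n - i) a) (?R i a)))" if a: "a \<le> n" for a
    proof -
      define N where "N = n - a"
      define T where "T z = emb12 (falling h a \<otimes> e ^ a) * tensor_assoc (z \<otimes> e ^ N)" for z
      have T: "Modules.additive T"
        by (simp add: Modules.additive_def T_def tensor_add_left additive.add[OF tensor_assoc_additive] distrib_left)
      have Tp: "T (x \<otimes> y) = (falling h a * x) \<otimes> ((e ^ a * y) \<otimes> e ^ N)" for x y
        by (simp add: T_def tensor_mult_pure)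
      have "(\<Sum>p\<le>N. zmul (?C N p) (?L a p)) = T (\<Sum>p\<le>N. zmul (?C N p) (falling h p \<otimes> falling h (N - p)))"
        by (simp add: additive.sum[OF T] additive_zmul[OF T] Tp N_def)
      \<comment> \<open>The shift by a makes both factors fit: the falling factorial of h of length
        a continues with that of h - a, and moving e^a to the right turns h + a into h.\<close>
      also have "\<dots> = (\<Sum>p\<le>N. zmul (?C N p) (T (falling (h - of_nat a) p \<otimes> falling (h + of_nat a) (N - p))))"
        unfolding falling_coproduct_shift[of N h h a] by (simp only: additive.sum[OF T] additive_zmul[OF T])
      also have "\<dots> = (\<Sum>i\<le>N. zmul (?C N i) (T (falling (h - of_nat a) (N - i) \<otimes> falling (h + of_nat a) i)))"
        by (rule sum.reindex_bij_witness[of _ "\<lambda>i. N - i" "\<lambda>i. N - i"]) (auto simp: binomial_symmetric[symmetric])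
      also have "\<dots> = (\<Sum>i\<le>N. zmul (?C N i) (?R i a))"
      proof (rule sum.cong)
        fix i assume "i \<in> {..N}"
        then have i: "i \<le> N" "n - i = a + (N - i)" "n - i - a = N - i" using a by (auto simp: N_def)
        have "falling h a * falling (h - of_nat a) (N - i) = falling h (n - i)"
          unfolding i(2) falling_add ..
        moreover have "e ^ a * falling (h + of_nat a) i = falling h i * e ^ a"
          by (rule falling_conj[OF weight_power[OF he], symmetric])
        moreover have "e ^ i * e ^ (n - i - a) = e ^ N" using i by (simp flip: power_add)
        ultimately show "zmul (?C N i) (T (falling (h - of_nat a) (N - i) \<otimes> falling (h + of_nat a) i)) = zmul (?C N i) (?R i a)"
          unfolding Tp by simp
      qed simp
      finally have eq: "(\<Sum>p\<le>N. zmul (?C N p) (?L a p)) = (\<Sum>i\<le>N. zmul (?C N i) (?R i a))" .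
      \<comment> \<open>Both sides are the trinomial coefficient of a, i and n - a - i.\<close>
      have binom: "?C n a * ?C N i = ?C n i * ?C (n - i) a" if "i \<le> N" for i
      proof -
        have "a + i \<le> n" using that a by (simp add: N_def)
        then have "(n choose (a + i)) * ((a + i) choose a) = (n choose a) * (n - a choose i)"
          "(n choose (a + i)) * ((a + i) choose i) = (n choose i) * (n - i choose a)"
          using choose_mult[of a "a + i" n] choose_mult[of i "a + i" n] by simp_all
        moreover have "((a + i) choose a) = ((a + i) choose i)" using binomial_symmetric[of a "a + i"] by simp
        ultimately have "(n choose a) * (N choose i) = (n choose i) * (n - i choose a)" by (simp add: N_def)
        then show ?thesis by (metis of_nat_mult)
      qed
      have "(\<Sum>p\<le>N. zmul (?C n a) (zmul (?C N p) (?L a p))) = (\<Sum>i\<le>N. zmul (?C n a) (zmul (?C N i) (?R i a)))"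
        using arg_cong[OF eq, of "zmul (?C n a)"] by (simp only: zmul_sum)
      also have "\<dots> = (\<Sum>i\<le>N. zmul (?C n i) (zmul (?C (n - i) a) (?R i a)))"
        by (rule sum.cong) (simp_all add: binom flip: zmul_zmul)
      finally show ?thesis by (simp only: N_def)
    qed
    have comm: "zmul a (zmul ((-1) ^ n) z) = zmul ((-1) ^ n) (zmul a z)"
      for a and z :: "('g uea, ('g uea, 'g uea) tensor) tensor"
      by (simp add: mult.commute flip: zmul_zmul)
    have "(\<Sum>i\<le>n. zmul (?C n i) (emb12 (?f i) * Delta_id (?f (n - i))))
        = (\<Sum>i\<le>n. zmul (?C n i) (zmul ((-1) ^ n) (\<Sum>p\<le>n - i. zmul (?C (n - i) p) (?L i p))))"
      by (rule sum.cong) (simp_all only: L atMost_iff)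
    also have "\<dots> = zmul ((-1) ^ n) (\<Sum>i\<le>n. \<Sum>p\<le>n - i. zmul (?C n i) (zmul (?C (n - i) p) (?L i p)))"
      by (simp only: comm zmul_sum)
    also have "(\<Sum>i\<le>n. \<Sum>p\<le>n - i. zmul (?C n i) (zmul (?C (n - i) p) (?L i p)))
        = (\<Sum>a\<le>n. \<Sum>i\<le>n - a. zmul (?C n i) (zmul (?C (n - i) a) (?R i a)))"
      by (rule sum.cong, rule refl, rule main, simp only: atMost_iff)
    also have "\<dots> = (\<Sum>i\<le>n. \<Sum>p\<le>n - i. zmul (?C n i) (zmul (?C (n - i) p) (?R i p)))"
      by (rule sum_triangle_swap)
    also have "zmul ((-1) ^ n) \<dots>
        = (\<Sum>i\<le>n. zmul (?C n i) (zmul ((-1) ^ n) (\<Sum>p\<le>n - i. zmul (?C (n - i) p) (?R i p))))"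
      by (simp only: comm zmul_sum)
    also have "\<dots> = (\<Sum>i\<le>n. zmul (?C n i) (emb23 (?f i) * id_Delta (?f (n - i))))"
      by (rule sum.cong) (simp_all only: R atMost_iff)
    finally show ?thesis .
  qed
  then show ?thesis
    unfolding jordan_def map_ratl_egf[OF additive_emb(1)] map_ratl_egf[OF additive_emb(2)]
      map_ratl_egf[OF additive_emb(3)] map_ratl_egf[OF additive_emb(4)] egf_times by (simp only: coeff)
qed

lemma egf_comm:
  fixes u v :: "nat \<Rightarrow> 'a::{ring,monoid_mult}"
  assumes "\<And>i j. u i * v j = v j * u i"
  shows "egf u * egf v = egf v * egf u"
  by (rule fps_commI) (simp add: egf_def tensor_mult_pure assms mult.commute)

lemma zmul_comm: "x * y = y * x \<Longrightarrow> zmul a x * zmul b y = zmul b y * zmul a (x :: 'a::ring)"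
  by (simp add: zmul_mult mult.commute flip: zmul_zmul)

lemma Delta0_falling_comm:
  assumes "z * Delta0 g = Delta0 g * z"
  shows "z * Delta0 (falling g j) = Delta0 (falling g j) * z"
proof (induction j)
  case (Suc j)
  note add = ring_mapD(1)[OF ring_map_Delta0]
  have n: "Delta0 (of_nat j) = zmul (int j) 1"
    using additive_zmul[OF add, of "int j" 1] by (simp add: Delta0_simps zmul_of_int one_tensor_def)
  have "z * Delta0 (g - of_nat j) = Delta0 (g - of_nat j) * z"
    by (simp add: additive.diff[OF add] n left_diff_distrib right_diff_distrib assms zmul_mult)
  then have "Delta0 (falling g j) * (z * Delta0 (g - of_nat j)) = Delta0 (falling g j) * (Delta0 (g - of_nat j) * z)"
    by simp
  then show ?case by (simp add: falling_Suc Delta0_simps mult.assoc[symmetric] Suc)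
qed (simp add: Delta0_simps)

lemma Delta0_power_comm:
  assumes "z * Delta0 g = Delta0 g * z"
  shows "z * Delta0 (g ^ j) = Delta0 (g ^ j) * z"
proof (induction j)
  case (Suc j)
  then show ?case by (simp add: Delta0_simps mult.assoc[symmetric] assms) (simp add: mult.assoc)
qed (simp add: Delta0_simps)

text \<open>Since g and f are primitive and commute with h and e, the two inner factors on each side
  can be exchanged. This brings together the two parts belonging to the same pair, for which the
  cocycle identity is known.\<close>

lemma jordan_jordan_cocycle:
  fixes h e g f :: "'g::lie_ring uea"
  assumes rel: "h * e = e * (h + 1)" "g * f = f * (g + 1)"
    and comm: "h * g = g * h" "e * f = f * e" "h * f = f * h" "e * g = g * e"
    and prim: "Delta0 h = h \<otimes> 1 + 1 \<otimes> h" "Delta0 e = e \<otimes> 1 + 1 \<otimes> e"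
      "Delta0 g = g \<otimes> 1 + 1 \<otimes> g" "Delta0 f = f \<otimes> 1 + 1 \<otimes> f"
  shows "map_ratl emb12 (jordan g f * jordan h e) * map_ratl Delta_id (jordan g f * jordan h e)
    = map_ratl emb23 (jordan g f * jordan h e) * map_ratl id_Delta (jordan g f * jordan h e)"
proof -
  have F: "falling h i * x = x * falling h i" "e ^ i * x = x * e ^ i" if "x = g \<or> x = f" for i x
    using that comm by (auto intro: falling_comm power_commuting_commutes)
  have z: "(falling h i \<otimes> e ^ i) * Delta0 x = Delta0 x * (falling h i \<otimes> e ^ i)" if "x = g \<or> x = f" for i x
    using F[OF that] that prim by (auto simp: distrib_left distrib_right tensor_mult_pure)
  have 1: "map_ratl emb12 (jordan h e) * map_ratl Delta_id (jordan g f)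
      = map_ratl Delta_id (jordan g f) * map_ratl emb12 (jordan h e)"
    unfolding jordan_def map_ratl_egf[OF additive_emb(1)] map_ratl_egf[OF additive_emb(3)]
  proof (rule egf_comm)
    fix i j
    have "emb12 z * tensor_assoc (y \<otimes> b) = tensor_assoc ((z * y) \<otimes> b)"
      "tensor_assoc (y \<otimes> b) * emb12 z = tensor_assoc ((y * z) \<otimes> b)" for y z :: "('g uea, 'g uea) tensor" and b
      by (simp_all add: emb12_def tensor_mult_pure flip: ring_mapD(2)[OF ring_map_assoc])
    then have "emb12 (falling h i \<otimes> e ^ i) * tensor_assoc (Delta0 (falling g j) \<otimes> f ^ j)
      = tensor_assoc (Delta0 (falling g j) \<otimes> f ^ j) * emb12 (falling h i \<otimes> e ^ i)"
      by (simp only: Delta0_falling_comm[OF z] simp_thms)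
    then show "emb12 (((-1) ^ i * falling h i) \<otimes> e ^ i) * Delta_id (((-1) ^ j * falling g j) \<otimes> f ^ j)
      = Delta_id (((-1) ^ j * falling g j) \<otimes> f ^ j) * emb12 (((-1) ^ i * falling h i) \<otimes> e ^ i)"
      unfolding sign_left additive_zmul[OF additive_emb(1)] additive_zmul[OF additive_emb(3)] Delta_id_pure
      by (rule zmul_comm)
  qed
  have 2: "map_ratl emb23 (jordan h e) * map_ratl id_Delta (jordan g f)
      = map_ratl id_Delta (jordan g f) * map_ratl emb23 (jordan h e)"
    unfolding jordan_def map_ratl_egf[OF additive_emb(2)] map_ratl_egf[OF additive_emb(4)]
  proof (rule egf_comm)
    fix i j
    show "emb23 (((-1) ^ i * falling h i) \<otimes> e ^ i) * id_Delta (((-1) ^ j * falling g j) \<otimes> f ^ j)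
      = id_Delta (((-1) ^ j * falling g j) \<otimes> f ^ j) * emb23 (((-1) ^ i * falling h i) \<otimes> e ^ i)"
      unfolding sign_left additive_zmul[OF additive_emb(2)] additive_zmul[OF additive_emb(4)] id_Delta_pure
      by (rule zmul_comm) (simp add: emb23_def tensor_mult_pure Delta0_power_comm[OF z])
  qed
  note m = map_ratl_mult[OF additive_emb(1) ring_mapD(2)[OF ring_map_emb(1)]]
    map_ratl_mult[OF additive_emb(2) ring_mapD(2)[OF ring_map_emb(2)]]
    map_ratl_mult[OF additive_emb(3) ring_mapD(2)[OF ring_map_emb(3)]]
    map_ratl_mult[OF additive_emb(4) ring_mapD(2)[OF ring_map_emb(4)]]
  have "map_ratl emb12 (jordan g f * jordan h e) * map_ratl Delta_id (jordan g f * jordan h e)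
    = map_ratl emb12 (jordan g f) * (map_ratl emb12 (jordan h e) * map_ratl Delta_id (jordan g f)) * map_ratl Delta_id (jordan h e)"
    unfolding m by (simp only: mult.assoc)
  also have "\<dots> = (map_ratl emb12 (jordan g f) * map_ratl Delta_id (jordan g f))
      * (map_ratl emb12 (jordan h e) * map_ratl Delta_id (jordan h e))"
    unfolding 1 by (simp only: mult.assoc)
  also have "\<dots> = (map_ratl emb23 (jordan g f) * map_ratl id_Delta (jordan g f))
      * (map_ratl emb23 (jordan h e) * map_ratl id_Delta (jordan h e))"
    unfolding jordan_cocycle[OF rel(1) prim(1,2)] jordan_cocycle[OF rel(2) prim(3,4)] ..
  also have "\<dots> = map_ratl emb23 (jordan g f) * (map_ratl emb23 (jordan h e) * map_ratl id_Delta (jordan g f)) * map_ratl id_Delta (jordan h e)"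
    unfolding 2 by (simp only: mult.assoc)
  also have "\<dots> = map_ratl emb23 (jordan g f * jordan h e) * map_ratl id_Delta (jordan g f * jordan h e)"
    unfolding m by (simp only: mult.assoc)
  finally show ?thesis .
qed

lemma jordan_counit:
  assumes "eps0 h = 0" "eps0 e = 0"
  shows "map_ratl counit_left (jordan h e) = 1" "map_ratl counit_right (jordan h e) = 1"
proof -
  have h: "eps0 (falling h s) = (if s = 0 then 1 else 0)" for s
  proof (induction s)
    case (Suc s)
    have n: "eps0 (of_nat n :: 'a uea) = int n" for n
      by (induction n) (simp_all add: eps0_simps additive.zero[OF additive_eps0])
    show ?case by (simp add: falling_Suc eps0_simps Suc additive.diff[OF additive_eps0] assms n)
  qed (simp add: eps0_simps)
  have e: "eps0 (e ^ s) = (if s = 0 then 1 else 0)" for s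
    by (induction s) (simp_all add: eps0_simps assms)
  have s: "eps0 ((-1) ^ s * falling h s) = (if s = 0 then 1 else 0)" for s
    by (cases "s = 0") (simp_all add: h eps0_simps)
  show "map_ratl counit_left (jordan h e) = 1" "map_ratl counit_right (jordan h e) = 1"
    unfolding jordan_def map_ratl_egf[OF ring_mapD(1)[OF ring_map_counit(1)]]
      map_ratl_egf[OF ring_mapD(1)[OF ring_map_counit(2)]]
    by (auto simp: fps_eq_iff egf_def s e one_tensor_def)
qed

section \<open>Summability of double series\<close>

text \<open>Coefficient n sees only pairs with r + l at most n, all inside the square
  \<open>?X\<close>, so each coefficient of the partial sums is eventually constant. This links
  \<open>fsum\<close> with topological summation.\<close>

lemma fsum_has_sum:
  fixes D :: "nat \<times> nat \<Rightarrow> 'a::ab_group_add fps"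
  assumes "\<And>l r i. i < r + l \<Longrightarrow> fps_nth (D (l, r)) i = 0"
  shows "(D has_sum fsum (\<lambda>l. fsum (\<lambda>r. D (l, r)))) UNIV"
  unfolding has_sum_def tendsto_fps_iff
proof
  fix n
  let ?X = "{..n} \<times> {..n} :: (nat \<times> nat) set"
  have X: "fps_nth (fsum (\<lambda>l. fsum (\<lambda>r. D (l, r)))) n = (\<Sum>p\<in>?X. fps_nth (D p) n)"
    by (simp add: fsum_def sum.cartesian_product)
  show "\<forall>\<^sub>F Y in finite_subsets_at_top UNIV. fps_nth (sum D Y) n = fps_nth (fsum (\<lambda>l. fsum (\<lambda>r. D (l, r)))) n"
    unfolding eventually_finite_subsets_at_top
  proof (intro exI[of _ ?X] conjI allI impI)
    fix Y :: "(nat \<times> nat) set" assume Y: "finite Y \<and> ?X \<subseteq> Y \<and> Y \<subseteq> UNIV"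
    have "(\<Sum>p\<in>?X. fps_nth (D p) n) = (\<Sum>p\<in>Y. fps_nth (D p) n)"
      by (rule sum.mono_neutral_left) (use Y in \<open>auto intro!: assms\<close>)
    then show "fps_nth (sum D Y) n = fps_nth (fsum (\<lambda>l. fsum (\<lambda>r. D (l, r)))) n"
      unfolding X by (simp add: fps_sum_nth)
  qed auto
qed

section \<open>Relations in the enveloping ring of \<open>S\<^sup>+\<close>\<close>

lemma tpair_axis_right: "tpair d (axis a 1) = d $ a"
proof -
  have "tpair d (axis a 1) = (\<Sum>i\<in>UNIV. if i = a then d $ i else 0)"
    unfolding tpair_def axis_def by (rule sum.cong) auto
  then show ?thesis by simp
qed

lemma tpair_zero_right [simp]: "tpair d 0 = 0"
  by (simp add: tpair_def)

lemma tpair_hT: "tpair (hT a b) \<beta> = \<beta> $ a - \<beta> $ b"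
  by (simp add: hT_def tpair_linear tpair_axis)

lemma tpair_eT: "tpair (eT a b) \<beta> = \<beta> $ a - 2 * \<beta> $ b"
  by (simp add: eT_def tpair_linear tpair_axis)

text \<open>Membership depends on which components vanish and on one homogeneous equation, and a
  nonzero factor changes neither. Thus S^+ is saturated, which later permits division by l +
  1.\<close>

lemma single_scale_Splus:
  "Poly_Mapping.single \<alpha> d \<in> Splus \<Longrightarrow> Poly_Mapping.single \<alpha> (c *s d) \<in> Splus"
  "c \<noteq> 0 \<Longrightarrow> Poly_Mapping.single \<alpha> (c *s d) \<in> Splus \<Longrightarrow> Poly_Mapping.single \<alpha> d \<in> Splus"
  by (auto simp: single_Splus tpair_linear(3))

lemma Abs_splus_add:
  "u \<in> Splus \<Longrightarrow> v \<in> Splus \<Longrightarrow> Abs_splus (u + v) = Abs_splus u + Abs_splus v"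
  by (simp add: plus_splus.abs_eq eq_onp_def)

lemma uea_of_zero: "uea_of 0 = 0"
  using uea_of_add[of 0 0] by simp

lemma xd_zero [simp]: "xd \<alpha> 0 = 0"
  by (simp add: xd_def uea_of_zero flip: zero_splus.abs_eq zero_splus_def)

lemma xd_add:
  assumes "Poly_Mapping.single \<alpha> d \<in> Splus" "Poly_Mapping.single \<alpha> d' \<in> Splus"
  shows "xd \<alpha> (d + d') = xd \<alpha> d + xd \<alpha> d'"
  by (simp add: xd_def single_add Abs_splus_add assms uea_of_add)

lemma xd_scale_nat:
  assumes "Poly_Mapping.single \<alpha> d \<in> Splus"
  shows "xd \<alpha> (int n *s d) = of_nat n * xd \<alpha> d"
proof (induction n)
  case (Suc n)
  have "int (Suc n) *s d = int n *s d + d" by (simp add: vec_eq_iff algebra_simps)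
  then show ?case
    by (simp add: xd_add single_scale_Splus(1) assms Suc distrib_right add.commute)
qed simp

lemma xd_scale:
  assumes "Poly_Mapping.single \<alpha> d \<in> Splus"
  shows "xd \<alpha> (c *s d) = of_int c * xd \<alpha> d"
proof (cases c rule: int_cases2)
  case (nonneg n)
  then show ?thesis by (simp add: xd_scale_nat assms)
next
  case (nonpos n)
  have "xd \<alpha> (c *s d) + xd \<alpha> (int n *s d) = xd \<alpha> (c *s d + int n *s d)"
    by (rule xd_add[symmetric]) (intro single_scale_Splus(1) assms)+
  also have "c *s d + int n *s d = 0" using nonpos by (simp add: vec_eq_iff)
  finally have "xd \<alpha> (c *s d) = - (of_nat n * xd \<alpha> d)"
    by (simp add: xd_scale_nat assms eq_neg_iff_add_eq_0)
  then show ?thesis using nonpos by simp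
qed

lemma xd_bracket:
  assumes "Poly_Mapping.single \<alpha> d \<in> Splus" "Poly_Mapping.single \<beta> d' \<in> Splus"
  shows "xd \<alpha> d * xd \<beta> d' = xd \<beta> d' * xd \<alpha> d + xd (\<alpha> + \<beta>) (tpair d \<beta> *s d' - tpair d' \<alpha> *s d)"
proof -
  have "lie (Abs_splus (Poly_Mapping.single \<alpha> d)) (Abs_splus (Poly_Mapping.single \<beta> d')) =
      Abs_splus (Poly_Mapping.single (\<alpha> + \<beta>) (tpair d \<beta> *s d' - tpair d' \<alpha> *s d))"
    using assms by (simp add: lie_splus.abs_eq eq_onp_def vbracket_single)
  then show ?thesis
    using uea_of_lie[of "Abs_splus (Poly_Mapping.single \<alpha> d)" "Abs_splus (Poly_Mapping.single \<beta> d')"]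
    by (simp add: xd_def)
qed

lemma hU_weight:
  assumes "a \<noteq> b" "Poly_Mapping.single \<alpha> d \<in> Splus"
  shows "hU a b * xd \<alpha> d = xd \<alpha> d * (hU a b + of_int (\<alpha> $ a - \<alpha> $ b))"
proof -
  have "tpair (hT a b) \<alpha> *s d - tpair d 0 *s hT a b = (\<alpha> $ a - \<alpha> $ b) *s d"
    by (simp add: tpair_hT)
  with xd_bracket[OF single_h_Splus[OF assms(1)] assms(2)]
  have "hU a b * xd \<alpha> d = xd \<alpha> d * hU a b + of_int (\<alpha> $ a - \<alpha> $ b) * xd \<alpha> d"
    by (simp only: hU_def xd_scale[OF assms(2)] add_0)
  then show ?thesis by (simp only: distrib_left mult_of_int_commute)
qed

text \<open>The conditions defining S^+ can be tested exponent by exponent, so the homogeneous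
  components of an element lie in S^+ again.\<close>

lemma splus_induct [case_names zero add single]:
  fixes x :: "'n::finite splus"
  assumes "P 0" "\<And>x y. P x \<Longrightarrow> P y \<Longrightarrow> P (x + y)"
    "\<And>\<alpha> d. Poly_Mapping.single \<alpha> d \<in> Splus \<Longrightarrow> P (Abs_splus (Poly_Mapping.single \<alpha> d))"
  shows "P x"
proof -
  define w where "w = Rep_splus x"
  have w: "w \<in> Splus" unfolding w_def by (rule Rep_splus)
  note comp = Splus_component[OF w]
  have "P (Abs_splus (\<Sum>\<alpha>\<in>A. Poly_Mapping.single \<alpha> (Poly_Mapping.lookup w \<alpha>)))" for A
  proof (induction A rule: infinite_finite_induct)
    case (insert \<alpha> A)
    then show ?case
      by (simp add: Abs_splus_add comp Splus_sum assms(2,3))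
  qed (simp_all add: assms(1) flip: zero_splus.abs_eq zero_splus_def)
  moreover have "(\<Sum>\<alpha>\<in>Poly_Mapping.keys w. Poly_Mapping.single \<alpha> (Poly_Mapping.lookup w \<alpha>)) = w"
    by (rule poly_mapping_eqI) (simp add: lookup_sum lookup_single when_def in_keys_iff)
  ultimately show ?thesis by (metis w_def Rep_splus_inverse)
qed

section \<open>Recurrences for the coefficients A and B\<close>

lemma coefA_0 [simp]: "coefA \<alpha> a b 0 = 1"
  by (simp add: coefA_def)

lemma coefB_0 [simp]: "coefB \<alpha> d a b 0 = 0"
  by (simp add: coefB_def coefA_def)

text \<open>Multiplying by r! removes the division in \<open>coefA\<close> and leaves the recursion
  of the rising product.\<close>

lemma coefA_Suc: "(\<alpha> $ a - 2 * \<alpha> $ b + int r) * coefA \<alpha> a b (int r) = (int r + 1) * coefA \<alpha> a b (int r + 1)"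
proof -
  have e: "fact r * coefA \<alpha> a b (int r) = (\<Prod>j<r. \<alpha> $ a - 2 * \<alpha> $ b + int j)"
    using coefA_exact[of "int r" \<alpha> a b] by simp
  have "fact r * ((\<alpha> $ a - 2 * \<alpha> $ b + int r) * coefA \<alpha> a b (int r))
      = (\<alpha> $ a - 2 * \<alpha> $ b + int r) * (\<Prod>j<r. \<alpha> $ a - 2 * \<alpha> $ b + int j)"
    unfolding e[symmetric] by (rule mult.left_commute)
  also have "\<dots> = fact (Suc r) * coefA \<alpha> a b (int r + 1)"
  proof -
    have r: "int r + 1 = int (Suc r)" by simp
    show ?thesis
      unfolding r coefA_exact[of "int (Suc r)" \<alpha> a b, OF of_nat_0_le_iff, unfolded nat_int]
      by (simp only: prod.lessThan_Suc mult.commute)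
  qed
  also have "\<dots> = fact r * ((int r + 1) * coefA \<alpha> a b (int r + 1))" by (simp add: algebra_simps)
  finally have "fact r * ((\<alpha> $ a - 2 * \<alpha> $ b + int r) * coefA \<alpha> a b (int r))
      = fact r * ((int r + 1) * coefA \<alpha> a b (int r + 1))" .
  then show ?thesis by simp
qed

lemma coefB_Suc: "(\<alpha> $ a - 2 * \<alpha> $ b + int r) * coefB \<alpha> d a b (int r) - coefB \<alpha> d a b (int r) + d $ a * coefA \<alpha> a b (int r)
    = (int r + 1) * coefB \<alpha> d a b (int r + 1)"
proof (cases r)
  case (Suc s)
  show ?thesis
    using coefA_Suc[of \<alpha> a b s] Suc by (simp add: coefB_def tpair_axis_right algebra_simps)
qed (simp add: coefB_def tpair_axis_right coefA_def)

text \<open>One bracket with e(a, b), read in a single coordinate: \<open>x\<close> comes from the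
  field before any bracket, \<open>y\<close> from e(a, b), and \<open>coefA * d $ a - coefB\<close>
  is the pairing of the current field with the unit vector at a.\<close>

lemma coef_step:
  "(\<alpha> $ a - 2 * \<alpha> $ b + int r) * (coefA \<alpha> a b (int r) * x - coefB \<alpha> d a b (int r) * y)
      - (coefA \<alpha> a b (int r) * d $ a - coefB \<alpha> d a b (int r)) * y
    = (int r + 1) * (coefA \<alpha> a b (int r + 1) * x - coefB \<alpha> d a b (int r + 1) * y)"
  (is "?a * (?A * x - ?B * y) - (?A * _ - _) * y = _")
proof -
  have "?a * (?A * x - ?B * y) - (?A * d $ a - ?B) * y = (?a * ?A) * x - (?a * ?B - ?B + d $ a * ?A) * y"
    by (simp add: algebra_simps)
  then show ?thesis unfolding coefA_Suc coefB_Suc by (simp add: algebra_simps)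
qed

lemma integral_splus:
  fixes \<phi> :: "'n::finite splus \<Rightarrow> 'a::{ring,monoid_mult}"
  assumes \<phi>: "Modules.additive \<phi>"
    and single: "\<And>\<alpha> d. Poly_Mapping.single \<alpha> d \<in> Splus \<Longrightarrow>
      a * to_ratl (fps_const (\<phi> (Abs_splus (Poly_Mapping.single \<alpha> d)))) * b \<in> range to_ratl"
  shows "a * to_ratl (fps_const (\<phi> x)) * b \<in> range to_ratl"
proof (induction x rule: splus_induct)
  case zero
  show ?case using integral_zero by (simp add: additive.zero[OF \<phi>] additive.zero[OF additive_to_ratl])
next
  case (add x y)
  from integral_add[OF this] show ?case
    by (simp add: additive.add[OF \<phi>] additive.add[OF tlin_const_additive[OF tlin_to_ratl]] distrib_left distrib_right)
qed (rule single)

lemma mult_inverse_cancel: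
  fixes a b c d :: "'a::{ring,monoid_mult} fps"
  assumes "b * c = 1" "a * d = 1"
  shows "a * b * (c * d) = 1"
proof -
  have "a * b * (c * d) = a * (b * c) * d" by (simp only: mult.assoc)
  then show ?thesis by (simp only: assms fps_one_mult)
qed

lemma twistF_jordan: "twistF a b = jordan (hU a b) (eU a b)"
proof (rule fps_ext)
  fix s
  show "fps_nth (twistF a b) s = fps_nth (jordan (hU a b) (eU a b)) s"
    by (cases "even s") (simp_all add: twistF_def jordan_def egf_def tensor_uminus_pure)
qed

section \<open>The two commuting pairs in S^+ and their twist\<close>

locale index_quadruple =
  fixes k k' m m' :: "'n::finite"
  assumes ne: "k \<noteq> k'" "m \<noteq> m'" "k \<noteq> m" "k \<noteq> m'" "k' \<noteq> m"
begin

abbreviation "h \<equiv> hU k k'"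
abbreviation "e \<equiv> eU k k'"
abbreviation "g \<equiv> hU m m'"
abbreviation "f \<equiv> eU m m'"

lemma eT_nth: "eT k k' $ m = 0" "eT m m' $ m = 1" "eT k k' $ k = 1" "eT m m' $ k = 0"
  using ne by (auto simp: eT_def axis_def)

lemma shift_nth: "shift \<alpha> m k l r $ m = \<alpha> $ m + int r" "shift \<alpha> m k l r $ m' = \<alpha> $ m'"
  "shift \<alpha> m k l r $ k = \<alpha> $ k + int l" "shift \<alpha> m k l 0 $ k' = \<alpha> $ k'"
  using ne by (auto simp: shift_def axis_def)

lemma rel: "h * e = e * (h + 1)" "g * f = f * (g + 1)"
  using hU_weight[OF ne(1) single_e_Splus[OF ne(1)]] hU_weight[OF ne(2) single_e_Splus[OF ne(2)]] ne
  by (simp_all add: eU_def axis_def)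

text \<open>h and g have exponent 0, and the exponents of e and f are the unit vectors at k and m.
  By the inequalities k is neither m nor m' and m is neither k nor k', so every mixed pairing
  vanishes. The indices k' and m' may coincide, as no exponent is supported there.\<close>

lemma comm: "h * g = g * h" "e * f = f * e" "h * f = f * h" "e * g = g * e"
proof -
  show "h * g = g * h"
    using hU_weight[OF ne(1) single_h_Splus[OF ne(2)]] by (simp add: hU_def)
  show "h * f = f * h"
    using hU_weight[OF ne(1) single_e_Splus[OF ne(2)]] ne by (simp add: eU_def axis_def)
  show "e * g = g * e"
    using hU_weight[OF ne(2) single_e_Splus[OF ne(1)]] ne by (simp add: eU_def axis_def)
  show "e * f = f * e"
    using xd_bracket[OF single_e_Splus[OF ne(1)] single_e_Splus[OF ne(2)]]
    by (simp add: eU_def tpair_axis_right eT_nth)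
qed

lemma prim: "Delta0 h = h \<otimes> 1 + 1 \<otimes> h" "Delta0 e = e \<otimes> 1 + 1 \<otimes> e"
  "Delta0 g = g \<otimes> 1 + 1 \<otimes> g" "Delta0 f = f \<otimes> 1 + 1 \<otimes> f"
  by (simp_all add: hU_def eU_def xd_def Delta0_simps)

lemma dlr_00: "dlr \<alpha> d m m' k k' 0 0 = d" "shift \<alpha> m k 0 0 = \<alpha>"
  by (simp_all add: dlr_def shift_def)

lemma shift_Suc: "axis m 1 + shift \<alpha> m k l r = shift \<alpha> m k l (Suc r)"
  "axis k 1 + shift \<alpha> m k l r = shift \<alpha> m k (Suc l) r"
  by (simp_all add: shift_def vec_eq_iff algebra_simps)

lemma dlr_Suc_right:
  "tpair (eT m m') (shift \<alpha> m k l r) *s dlr \<alpha> d m m' k k' l r - tpair (dlr \<alpha> d m m' k k' l r) (axis m 1) *s eT m m'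
    = int (Suc r) *s dlr \<alpha> d m m' k k' l (Suc r)"
  unfolding tpair_eT tpair_axis_right shift_nth vec_eq_iff
proof
  fix i
  let ?A = "coefA \<alpha> k k' (int l)" and ?B = "coefB \<alpha> d k k' (int l)"
  show "((\<alpha> $ m + int r - 2 * \<alpha> $ m') *s dlr \<alpha> d m m' k k' l r - (dlr \<alpha> d m m' k k' l r $ m) *s eT m m') $ i
      = (int (Suc r) *s dlr \<alpha> d m m' k k' l (Suc r)) $ i"
    \<comment> \<open>Sorted by the coefficients of the second pair, \<open>dlr\<close> is A_r (A_l
      d - B_l e(k, k')) - B_r (A_l e(m, m')), which gives the two arguments.\<close>
    using coef_step[of \<alpha> m m' r "?A * d $ i - ?B * eT k k' $ i" d "?A * eT m m' $ i"]
    by (simp add: dlr_def eT_nth algebra_simps)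
qed

text \<open>Only r = 0 occurs because \<open>X l r\<close> is reached by l brackets with e followed
  by r brackets with f.\<close>

lemma dlr_Suc_left:
  "tpair (eT k k') (shift \<alpha> m k l 0) *s dlr \<alpha> d m m' k k' l 0 - tpair (dlr \<alpha> d m m' k k' l 0) (axis k 1) *s eT k k'
    = int (Suc l) *s dlr \<alpha> d m m' k k' (Suc l) 0"
  unfolding tpair_eT tpair_axis_right shift_nth vec_eq_iff
proof
  fix i
  show "((\<alpha> $ k + int l - 2 * \<alpha> $ k') *s dlr \<alpha> d m m' k k' l 0 - (dlr \<alpha> d m m' k k' l 0 $ k) *s eT k k') $ i
      = (int (Suc l) *s dlr \<alpha> d m m' k k' (Suc l) 0) $ i"
    using coef_step[of \<alpha> k k' l "d $ i" d "eT k k' $ i"] by (simp add: dlr_def eT_nth algebra_simps)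
qed

context
  fixes \<alpha> d :: "int ^ 'n"
  assumes S: "Poly_Mapping.single \<alpha> d \<in> Splus"
begin

abbreviation "X l r \<equiv> xd (shift \<alpha> m k l r) (dlr \<alpha> d m m' k k' l r)"

text \<open>A bracket with e or f stays in S^+ and is a positive multiple of the next field;
  saturation removes the multiple. This is the integrality of the divided powers.\<close>

lemma dlr_Splus: "Poly_Mapping.single (shift \<alpha> m k l r) (dlr \<alpha> d m m' k k' l r) \<in> Splus"
proof (induction r)
  case 0
  show ?case
  proof (induction l)
    case (Suc l)
    have "Poly_Mapping.single (shift \<alpha> m k (Suc l) 0) (int (Suc l) *s dlr \<alpha> d m m' k k' (Suc l) 0) \<in> Splus"
      using vbracket_single_Splus[OF single_e_Splus[OF ne(1)] Suc] unfolding dlr_Suc_left shift_Suc .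
    then show ?case by (rule single_scale_Splus(2)[rotated]) simp
  qed (simp add: dlr_00 S)
next
  case (Suc r)
  have "Poly_Mapping.single (shift \<alpha> m k l (Suc r)) (int (Suc r) *s dlr \<alpha> d m m' k k' l (Suc r)) \<in> Splus"
    using vbracket_single_Splus[OF single_e_Splus[OF ne(2)] Suc] unfolding dlr_Suc_right shift_Suc .
  then show ?case by (rule single_scale_Splus(2)[rotated]) simp
qed

lemma X_adjoint:
  "e * X l 0 = X l 0 * e + of_nat (Suc l) * X (Suc l) 0"
  "f * X l r = X l r * f + of_nat (Suc r) * X l (Suc r)"
  using xd_bracket[OF single_e_Splus[OF ne(1)] dlr_Splus[of l 0]] xd_bracket[OF single_e_Splus[OF ne(2)] dlr_Splus[of l r]]
  unfolding dlr_Suc_left dlr_Suc_right shift_Suc xd_scale_nat[OF dlr_Splus] eU_def .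

lemma X_weight:
  "h * X 0 0 = X 0 0 * (h + of_int (\<alpha> $ k - \<alpha> $ k'))"
  "g * X l 0 = X l 0 * (g + of_int (\<alpha> $ m - \<alpha> $ m'))"
  using hU_weight[OF ne(1) dlr_Splus[of 0 0]] hU_weight[OF ne(2) dlr_Splus[of l 0]]
  by (simp_all add: shift_nth del: of_int_diff)

end

abbreviation "F \<equiv> jordan g f * jordan h e"
abbreviation "G \<equiv> jordan (- h) e * jordan (- g) f"

lemma Delta_formula:
  assumes "Poly_Mapping.single \<alpha> d \<in> Splus"
  shows "F * to_ratl (fps_const (Delta0 (xd \<alpha> d))) * G =
    to_ratl (fps_const (xd \<alpha> d) \<otimes>\<^sub>t (zpow (one_et e) (\<alpha> $ k - \<alpha> $ k') * zpow (one_et f) (\<alpha> $ m - \<alpha> $ m'))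
      + fsum (\<lambda>l. fsum (\<lambda>r. fps_up (r + l) (fps_const ((-1) ^ (r + l) * rising 0 h l * rising 0 g r) \<otimes>\<^sub>t
          (zpow (one_et e) (- int l) * zpow (one_et f) (- int r) * fps_const (X \<alpha> d l r))))))"
proof -
  have "Delta0 (xd \<alpha> d) = X \<alpha> d 0 0 \<otimes> 1 + 1 \<otimes> X \<alpha> d 0 0"
    by (simp only: dlr_00 xd_def Delta0_simps)
  then show ?thesis
    using jordan_jordan_Delta[of h g e f "X \<alpha> d" "\<alpha> $ k - \<alpha> $ k'" "\<alpha> $ m - \<alpha> $ m'",
        OF comm X_weight(1)[OF assms] X_weight(2)[OF assms] X_adjoint[OF assms]]
    by (simp only: dlr_00)
qed

lemma S_formula:
  assumes "Poly_Mapping.single \<alpha> d \<in> Splus"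
  shows "jexp g f * jexp h e * to_ratl (fps_const (xd \<alpha> d)) * (jexp_inv h e * jexp_inv g f) =
    to_ratl (zpow (one_et e) (- \<alpha> $ k + \<alpha> $ k') * zpow (one_et f) (- \<alpha> $ m + \<alpha> $ m') *
      fsum (\<lambda>l. fsum (\<lambda>r. fps_up (r + l) (fps_const (X \<alpha> d l r * (rising 1 g r * rising 1 h l))))))"
  using jordan_jordan_antipode[of h e g f "X \<alpha> d" "\<alpha> $ k - \<alpha> $ k'" "\<alpha> $ m - \<alpha> $ m'",
      OF rel comm X_weight[OF assms] X_adjoint[OF assms]]
  by (simp only: dlr_00 minus_diff_eq diff_conv_add_uminus add.commute minus_add_distrib minus_minus)


lemma w_eq: "map_ratl (\<lambda>y. lact y 1) F = jexp g f * jexp h e"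
proof -
  have S: "S0 f = - f" "S0 e = - e" by (simp_all add: eU_def xd_def S0_simps)
  have "map_ratl (\<lambda>y. lact y 1) F = rprod lact (jordan g f) (map_ratl (\<lambda>y. lact y 1) (jordan h e))"
    by (simp only: rprod_act_one[symmetric] rprod_act_mult)
  also have "map_ratl (\<lambda>y. lact y 1) (jordan h e) = jexp h e"
    by (rule jordan_lact_one[OF S(2)])
  also have "rprod lact (jordan g f) (jexp h e) = jexp g f * jexp h e"
    by (rule jordan_lact[OF S(1) comm(3,2)])
  finally show ?thesis .
qed

lemma v_eq: "map_ratl (ract 1) G = jexp_inv h e * jexp_inv g f"
proof -
  have S: "S0 h = - h" "S0 g = - g" by (simp_all add: hU_def xd_def S0_simps)
  have "map_ratl (ract 1) G = rprod ract (map_ratl (ract 1) (jordan (- h) e)) (jordan (- g) f)"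
    by (simp only: rprod_act_one[symmetric] rprod_act_mult)
  also have "map_ratl (ract 1) (jordan (- h) e) = jexp_inv h e"
    by (rule jordan_ract_one[OF S(1)])
  also have "rprod ract (jexp_inv h e) (jordan (- g) f) = jexp_inv h e * jexp_inv g f"
    by (rule jordan_ract[OF S(2) comm(1,4)])
  finally show ?thesis .
qed

sublocale integral_twist F G
proof
  show "F * G = 1" "G * F = 1"
    by (rule mult_inverse_cancel; rule jordan_inverse)+
  show "map_ratl emb12 F * map_ratl Delta_id F = map_ratl emb23 F * map_ratl id_Delta F"
    by (rule jordan_jordan_cocycle[OF rel comm prim])
  have eps: "eps0 h = 0" "eps0 e = 0" "eps0 g = 0" "eps0 f = 0"
    by (simp_all add: hU_def eU_def xd_def eps0_simps)
  show "map_ratl counit_left F = 1" "map_ratl counit_right F = 1"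
    by (simp_all only: map_ratl_mult[OF ring_mapD(1,2)[OF ring_map_counit(1)]]
        map_ratl_mult[OF ring_mapD(1,2)[OF ring_map_counit(2)]] jordan_counit[OF eps(1,2)] jordan_counit[OF eps(3,4)] fps_one_mult)
  show "map_ratl (\<lambda>y. lact y 1) F * map_ratl (ract 1) G = 1" "map_ratl (ract 1) G * map_ratl (\<lambda>y. lact y 1) F = 1"
    unfolding w_eq v_eq by (rule mult_inverse_cancel; rule jexp_inverse[OF rel(1)] jexp_inverse[OF rel(2)])+
  have add: "Modules.additive (uea_of :: 'n splus \<Rightarrow> _)" by (simp add: Modules.additive_def uea_of_add)
  \<comment> \<open>By additivity homogeneous elements suffice, and for these the explicit formula
    exhibits the value as the image of an integral series.\<close>
  show "F * to_ratl (fps_const (Delta0 (uea_of x))) * G \<in> range to_ratl" for x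
    by (rule integral_splus[OF additive_comp[OF ring_mapD(1)[OF ring_map_Delta0] add]])
      (simp only: xd_def[symmetric] Delta_formula rangeI)
  show "map_ratl (\<lambda>y. lact y 1) F * to_ratl (fps_const (uea_of x)) * map_ratl (ract 1) G \<in> range to_ratl" for x
    unfolding w_eq v_eq
    by (rule integral_splus[OF add]) (simp only: xd_def[symmetric] S_formula rangeI)
qed (rule ratl_inj_splus)+

end

theorem lemma4p3:
  fixes k k' m m' :: "'n::finite"
  assumes "k \<noteq> k'" "m \<noteq> m'" "k \<noteq> m" "k \<noteq> m'" "k' \<noteq> m"
  shows
    "drinfeld_twist (twistF m m' * twistF k k') \<and>
     (\<exists>!Q. case Q of (\<Delta>, S, \<epsilon>) \<Rightarrow> quantization (twistF m m' * twistF k k') \<Delta> S \<epsilon>) \<and>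
     (\<forall>\<Delta> S \<epsilon> \<alpha> d.
        quantization (twistF m m' * twistF k k') \<Delta> S \<epsilon> \<longrightarrow>
        Poly_Mapping.single \<alpha> d \<in> Splus \<longrightarrow>
        (\<forall>l r. Poly_Mapping.single (shift \<alpha> m k l r) (dlr \<alpha> d m m' k k' l r) \<in> Splus) \<and>
        (let x = fps_const (xd \<alpha> d);
             y = (\<lambda>l r. fps_const (xd (shift \<alpha> m k l r) (dlr \<alpha> d m m' k k' l r)));
             h = hU k k'; g = hU m m';
             u = 1 - fps_const (eU k k') * fps_X; v = 1 - fps_const (eU m m') * fps_X;
             D = (\<lambda>(l, r). fps_const ((-1) ^ (r + l) * rising 0 h l * rising 0 g r)
                    \<otimes>\<^sub>t (zpow u (- int l) * zpow v (- int r) * y l r * fps_X ^ (r + l)));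
             A = (\<lambda>(l, r). y l r * fps_const (rising 1 g r * rising 1 h l) * fps_X ^ (r + l))
         in D summable_on UNIV \<and>
            \<Delta> x = x \<otimes>\<^sub>t (zpow u (\<alpha> $ k - \<alpha> $ k') * zpow v (\<alpha> $ m - \<alpha> $ m')) + infsum D UNIV \<and>
            A summable_on UNIV \<and>
            S x = - (zpow u (- \<alpha> $ k + \<alpha> $ k') * zpow v (- \<alpha> $ m + \<alpha> $ m') * infsum A UNIV) \<and>
            \<epsilon> x = 0))"
proof -
  interpret index_quadruple k k' m m' by standard (rule assms)+
  have F: "twistF m m' * twistF k k' = F" by (simp only: twistF_jordan)
  show ?thesis
    unfolding F
  proof (intro conjI allI impI, goal_cases)
    case 1
    show ?case by (rule drinfeld)
  next
    case 2
    show ?case by (rule quantization_unique_existence)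
  next
    case (3 \<Delta> S \<epsilon> \<alpha> d l r)
    show ?case by (rule dlr_Splus[OF 3(2)])
  next
    case (4 \<Delta> S \<epsilon> \<alpha> d)
    note q = 4(1) and Sp = 4(2)
    define y where "y l r = fps_const (X \<alpha> d l r)" for l r
    define D where "D = (\<lambda>(l, r). fps_const ((-1) ^ (r + l) * rising 0 h l * rising 0 g r)
                    \<otimes>\<^sub>t (zpow (one_et e) (- int l) * zpow (one_et f) (- int r) * y l r * fps_X ^ (r + l)))"
    define A where "A = (\<lambda>(l, r). y l r * fps_const (rising 1 g r * rising 1 h l) * fps_X ^ (r + l))"
    have D: "D (l, r) = fps_up (r + l) (fps_const ((-1) ^ (r + l) * rising 0 h l * rising 0 g r) \<otimes>\<^sub>t
          (zpow (one_et e) (- int l) * zpow (one_et f) (- int r) * fps_const (X \<alpha> d l r)))" for l r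
      by (simp only: D_def prod.case fps_up_X ctensor_up y_def)
    have A: "A (l, r) = fps_up (r + l) (fps_const (X \<alpha> d l r * (rising 1 g r * rising 1 h l)))" for l r
      by (simp only: A_def prod.case fps_up_X y_def fps_const_mult)
    \<comment> \<open>The (l, r) term is divisible by t^(r+l), so \<open>infsum\<close> can be
      replaced by the iterated \<open>fsum\<close> for which the formulas were proved.\<close>
    have Ds: "(D has_sum fsum (\<lambda>l. fsum (\<lambda>r. D (l, r)))) UNIV" and As: "(A has_sum fsum (\<lambda>l. fsum (\<lambda>r. A (l, r)))) UNIV"
      by (rule fsum_has_sum; simp add: D A)+
    have "to_ratl (\<Delta> (fps_const (xd \<alpha> d))) = F * to_ratl (fps_const (Delta0 (xd \<alpha> d))) * G"
      using q by (simp add: quantization_def inv_F ring_mapD(1)[OF ring_map_Delta0])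
    then have \<Delta>: "\<Delta> (fps_const (xd \<alpha> d)) = fps_const (xd \<alpha> d) \<otimes>\<^sub>t
        (zpow (one_et e) (\<alpha> $ k - \<alpha> $ k') * zpow (one_et f) (\<alpha> $ m - \<alpha> $ m')) + infsum D UNIV"
      unfolding Delta_formula[OF Sp] infsumI[OF Ds] D by (rule to_ratl_inj[OF inj(2)])
    have "to_ratl (S (fps_const (xd \<alpha> d))) = w * to_ratl (fps_const (S0 (xd \<alpha> d))) * v"
      using q by (simp add: quantization_def twist_w inv_w additive_S0)
    also have "fps_const (S0 (xd \<alpha> d)) = - fps_const (xd \<alpha> d)"
      by (simp add: xd_def S0_simps)
    also have "w * to_ratl (- fps_const (xd \<alpha> d)) * v = to_ratl (- (zpow (one_et e) (- \<alpha> $ k + \<alpha> $ k') *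
        zpow (one_et f) (- \<alpha> $ m + \<alpha> $ m') * infsum A UNIV))"
      unfolding infsumI[OF As] A w_def v_def w_eq v_eq additive.minus[OF tlin_additive[OF tlin_to_ratl]]
        mult_minus_left mult_minus_right S_formula[OF Sp] ..
    finally have S: "S (fps_const (xd \<alpha> d)) = - (zpow (one_et e) (- \<alpha> $ k + \<alpha> $ k') *
        zpow (one_et f) (- \<alpha> $ m + \<alpha> $ m') * infsum A UNIV)"
      by (rule to_ratl_inj[OF inj(1)])
    have \<epsilon>: "\<epsilon> (fps_const (xd \<alpha> d)) = 0"
      using q by (simp add: quantization_def additive_eps0 xd_def eps0_simps)
    show ?case
      unfolding Let_def y_def[symmetric] D_def[symmetric] A_def[symmetric]
      by (intro conjI has_sum_imp_summable[OF Ds] has_sum_imp_summable[OF As] \<Delta> S \<epsilon>)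
  qed
qed

end
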